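(* Let $(Y,\tau)$ be a separable Fréchet space and $\mathcal{B}$ its Borel $\sigma$-algebra. Let $\ell\geqslant1$ be an integer and let $\eta$ be a random field with values in $\big(Y^{\mathbb{Z}^d},\mathcal{B}^{\otimes\mathbb{Z}^d}\big)$ which is c.a.d.i., c.l. and $R_\ell$-invariant. Then for every $y\in Y$, $$ s(\eta;y)=-p^*(\eta;y), $$ where $s(\eta;\cdot)$ is the entropy of $\eta$ and $p^*(\eta;\cdot)$ is the Fenchel–Legendre transform of the pressure $p(\eta;\cdot)$ of $\eta$.
   Context: Fix $d\geqslant 1$. Boxes: $\Lambda(z;n)=z+([0,n[^d\cap\mathbb{Z}^d)$ for $n\geqslant 1$, $\Lambda(n)=\Lambda(0;n)$; $\mathrm{dist}$ is the distance associated with $|\cdot|_\infty$. For a field $\xi$ and finite $S\subset\mathbb{Z}^d$, $\xi_S=(\xi(z))_{z\in S}$; $\mathfrak{m}_\Lambda\xi=\frac1{|\Lambda|}\sum_{z\in\Lambda}\xi(z)$. $\mathcal{C}(Y^S)$ is the set of convex open subsets of $Y^S$ (product topology); $\mathcal{C}_0(Y)$ is a fixed base of convex open neighbourhoods of $0$ in $Y$. c.a.d.i.: $\eta$ is c.a.d.i. if there are $g,c:\mathbb{N}^*\to[0,+\infty[$ with $g(n)/n\to0$, $c(n)/|\Lambda(n)|\to0$ such that for all $z\in\mathbb{Z}^d$, $n\in\mathbb{N}^*$, finite $S\subset\mathbb{Z}^d$, $C\in\mathcal{C}(Y^{\Lambda(z;n)})$, $D\in\mathcal{C}(Y^S)$: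 if $\mathrm{dist}(S,\Lambda(z;n))>g(n)$ then $\mathbb{P}(\eta_{\Lambda(z;n)}\in C,\ \eta_S\in D)\geqslant e^{-c(n)}\,\mathbb{P}(\eta_{\Lambda(z;n)}\in C)\,\mathbb{P}(\eta_S\in D)$. c.l.: $\eta$ is c.l. if there are $t:\mathcal{C}_0(Y)\to]0,+\infty[$ and $\alpha:\mathcal{C}_0(Y)\to]0,1]$ such that for all $V\in\mathcal{C}_0(Y)$, $z\in\mathbb{Z}^d$, finite $S\subset\mathbb{Z}^d\setminus\{z\}$, $D\in\mathcal{C}(Y^S)$: $\mathbb{P}(\eta(z)\in t(V)V,\ \eta_S\in D)\geqslant\alpha(V)\,\mathbb{P}(\eta_S\in D)$. $R_\ell$-invariant: the law of $\eta$ is invariant under the translations of $R_\ell=(\ell\mathbb{Z})^d$. Entropy: let $\mathcal{C}$ be the set of all sets $x+tV$ with $x\in Y$, $t>0$, $V\in\mathcal{C}_0(Y)$. Then $s(\eta;y)=\inf_{A\in\mathcal{C},\,A\ni y}\ \liminf_{n\to\infty}\frac1{|\Lambda(n)|}\log\mathbb{P}(\mathfrak{m}_{\Lambda(n)}\eta\in A)$ (with $\log0=-\infty$). Pressure: for $\lambda\in Y^*$ (topological dual), $p_\Lambda(\eta;\lambda)=\frac1{|\Lambda|}\log\mathbb{E}\big[\exp\langle\lambda|\sum_{z\in\Lambda}\eta(z)\rangle\big]$ and $p(\eta;\lambda)=\lim_{n\to\infty}p_{\Lambda(n)}(\eta;\lambda)\in[-\infty,+\infty]$ (this limit exists under the hypotheses).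 $p^*(\eta;y)=\sup_{\lambda\in Y^*}(\langle\lambda|y\rangle-p(\eta;\lambda))$. *)

theory Defs
  imports "HOL-Probability.Probability"
begin

section \<open>Separable Frechet spaces\<close>

text \<open>
  As for \<^class>\<open>banach\<close> and \<^class>\<open>polish_space\<close>, a compatible complete metric is part of the
  type. Everything below depends only on the topology of the space.
\<close>

class frechet_space = real_vector + topological_ab_group_add + complete_space +
  assumes tendsto_scaleR_frechet:
      "((\<lambda>p. fst p *\<^sub>R snd p) \<longlongrightarrow> r *\<^sub>R x) (nhds r \<times>\<^sub>F nhds x)"
    and dist_translation: "dist (x + z) (y + z) = dist x y"
    and locally_convex: "open U \<Longrightarrow> 0 \<in> U \<Longrightarrow>
      \<exists>V. open V \<and> (\<forall>x\<in>V. \<forall>y\<in>V. \<forall>u\<ge>0. \<forall>v\<ge>0. u + v = 1 \<longrightarrow> u *\<^sub>R x + v *\<^sub>R y \<in> V)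
        \<and> 0 \<in> V \<and> V \<subseteq> U"

class separable_frechet_space = frechet_space +
  assumes separable: "\<exists>D. countable D \<and> (\<forall>U. open U \<and> U \<noteq> {} \<longrightarrow> D \<inter> U \<noteq> {})"

instance separable_frechet_space \<subseteq> polish_space
proof
  obtain D :: "'a set" where D: "countable D" "\<And>U. open U \<Longrightarrow> U \<noteq> {} \<Longrightarrow> D \<inter> U \<noteq> {}"
    using separable by blast
  define B where "B = (\<lambda>(x, n). ball x (1 / real (Suc n))) ` (D \<times> (UNIV :: nat set))"
  have "topological_basis B"
  proof (rule topological_basisI)
    show "open U" if "U \<in> B" for U using that by (auto simp: B_def)
  next
    fix U and x :: 'a assume "open U" "x \<in> U"
    then obtain e where e: "e > 0" "ball x e \<subseteq> U" by (auto simp: open_contains_ball)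
    obtain n where n: "1 / real (Suc n) < e / 2"
      using e(1) by (metis half_gt_zero inverse_eq_divide reals_Archimedean)
    have "D \<inter> ball x (1 / real (Suc n)) \<noteq> {}" by (rule D(2)) auto
    then obtain y where y: "y \<in> D" "dist y x < 1 / real (Suc n)"
      by (auto simp: dist_commute)
    have "ball y (1 / real (Suc n)) \<subseteq> ball x e"
    proof
      fix w assume "w \<in> ball y (1 / real (Suc n))"
      then have "dist y w < 1 / real (Suc n)" by simp
      moreover have "dist x w \<le> dist y x + dist y w" by (rule dist_triangle3)
      ultimately show "w \<in> ball x e" using y n by simp
    qed
    moreover have "ball y (1 / real (Suc n)) \<in> B"
      unfolding B_def using y(1) by (auto intro!: image_eqI[of _ _ "(y, n)"])
    moreover have "x \<in> ball y (1 / real (Suc n))" using y by simp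
    ultimately show "\<exists>U'\<in>B. x \<in> U' \<and> U' \<subseteq> U" using e by blast
  qed
  moreover have "countable B" unfolding B_def using D by auto
  ultimately show "\<exists>B :: 'a set set. countable B \<and> open = generate_topology B"
    using topological_basis_imp_subbasis by blast
qed


section \<open>The lattice\<close>

text \<open>The lattice of dimension \<open>d \<ge> 1\<close> is \<open>int ^ 'd\<close> with \<open>d = CARD('d)\<close>.\<close>

definition lattice_box :: "int ^ 'd \<Rightarrow> nat \<Rightarrow> (int ^ 'd) set" where
  "lattice_box z n = (\<lambda>x. z + x) ` {x. \<forall>i. 0 \<le> x $ i \<and> x $ i < int n}"

definition sup_norm :: "int ^ 'd \<Rightarrow> int" where
  "sup_norm x = Max (range (\<lambda>i. \<bar>x $ i\<bar>))"

text \<open>Extended-real valued, so that the distance to the empty set is \<open>\<infinity>\<close>.\<close>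

definition lattice_dist :: "(int ^ 'd) set \<Rightarrow> (int ^ 'd) set \<Rightarrow> ereal" where
  "lattice_dist S T = (INF x\<in>S. INF y\<in>T. ereal (real_of_int (sup_norm (x - y))))"


section \<open>Convex open sets\<close>

text \<open>Elements of \<open>Y\<^sup>S\<close> are encoded as functions that are \<^term>\<open>undefined\<close> outside \<open>S\<close>.\<close>

definition convex_open :: "'i set \<Rightarrow> ('i \<Rightarrow> 'y::{real_vector, topological_space}) set set" where
  "convex_open S =
     {C. openin (product_topology (\<lambda>_. euclidean) S) C \<and>
         (\<forall>x\<in>C. \<forall>y\<in>C. \<forall>u\<in>{0..1}. (\<lambda>z\<in>S. (1 - u) *\<^sub>R x z + u *\<^sub>R y z) \<in> C)}"

definition convex_nhds_base :: "('y::{real_vector, topological_space}) set set \<Rightarrow> bool" where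
  "convex_nhds_base C0 \<longleftrightarrow>
     (\<forall>V\<in>C0. open V \<and> convex V \<and> 0 \<in> V) \<and>
     (\<forall>U. open U \<and> 0 \<in> U \<longrightarrow> (\<exists>V\<in>C0. V \<subseteq> U))"


section \<open>Random fields\<close>

definition random_field ::
    "'w measure \<Rightarrow> ('w \<Rightarrow> int ^ 'd \<Rightarrow> 'y::topological_space) \<Rightarrow> bool" where
  "random_field M \<eta> \<longleftrightarrow> prob_space M \<and> \<eta> \<in> M \<rightarrow>\<^sub>M (\<Pi>\<^sub>M z\<in>UNIV. borel)"

definition cadi ::
    "'w measure \<Rightarrow> ('w \<Rightarrow> int ^ 'd \<Rightarrow> 'y::{real_vector, topological_space}) \<Rightarrow> bool" where
  "cadi M \<eta> \<longleftrightarrow>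
     (\<exists>(g :: nat \<Rightarrow> real) (c :: nat \<Rightarrow> real).
        (\<forall>n\<ge>1. 0 \<le> g n \<and> 0 \<le> c n) \<and>
        (\<lambda>n. g n / real n) \<longlonglongrightarrow> 0 \<and>
        (\<lambda>n. c n / real (card (lattice_box (0 :: int ^ 'd) n))) \<longlonglongrightarrow> 0 \<and>
        (\<forall>z. \<forall>n\<ge>1. \<forall>S. finite S \<longrightarrow>
          (\<forall>C\<in>convex_open (lattice_box z n). \<forall>D\<in>convex_open S.
             lattice_dist S (lattice_box z n) > ereal (g n) \<longrightarrow>
             measure M {\<omega>\<in>space M. restrict (\<eta> \<omega>) (lattice_box z n) \<in> C \<and> restrict (\<eta> \<omega>) S \<in> D}
             \<ge> exp (- c n) * measure M {\<omega>\<in>space M. restrict (\<eta> \<omega>) (lattice_box z n) \<in> C}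
                 * measure M {\<omega>\<in>space M. restrict (\<eta> \<omega>) S \<in> D})))"

definition cl ::
    "'w measure \<Rightarrow> 'y set set \<Rightarrow> ('w \<Rightarrow> int ^ 'd \<Rightarrow> 'y::{real_vector, topological_space}) \<Rightarrow> bool"
  where
  "cl M C0 \<eta> \<longleftrightarrow>
     (\<exists>(t :: 'y set \<Rightarrow> real) (\<alpha> :: 'y set \<Rightarrow> real).
        (\<forall>V\<in>C0. 0 < t V \<and> 0 < \<alpha> V \<and> \<alpha> V \<le> 1) \<and>
        (\<forall>V\<in>C0. \<forall>z. \<forall>S. finite S \<and> z \<notin> S \<longrightarrow>
          (\<forall>D\<in>convex_open S.
             measure M {\<omega>\<in>space M. \<eta> \<omega> z \<in> (\<lambda>v. t V *\<^sub>R v) ` V \<and> restrict (\<eta> \<omega>) S \<in> D}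
             \<ge> \<alpha> V * measure M {\<omega>\<in>space M. restrict (\<eta> \<omega>) S \<in> D})))"

definition R_invariant ::
    "'w measure \<Rightarrow> nat \<Rightarrow> ('w \<Rightarrow> int ^ 'd \<Rightarrow> 'y::topological_space) \<Rightarrow> bool" where
  "R_invariant M l \<eta> \<longleftrightarrow>
     (\<forall>a :: int ^ 'd. (\<forall>i. int l dvd a $ i) \<longrightarrow>
        distr M (\<Pi>\<^sub>M z\<in>UNIV. borel) (\<lambda>\<omega> z. \<eta> \<omega> (z + a)) =
        distr M (\<Pi>\<^sub>M z\<in>UNIV. borel) \<eta>)"


section \<open>Entropy and pressure\<close>

definition elog :: "ennreal \<Rightarrow> ereal" where
  "elog x = (if x = 0 then - \<infinity> else if x = \<infinity> then \<infinity> else ereal (ln (enn2real x)))"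

definition field_mean :: "'i set \<Rightarrow> ('i \<Rightarrow> 'y::real_vector) \<Rightarrow> 'y" where
  "field_mean L \<xi> = (1 / real (card L)) *\<^sub>R (\<Sum>z\<in>L. \<xi> z)"

definition entropy_sets :: "('y::real_vector) set set \<Rightarrow> 'y set set" where
  "entropy_sets C0 = {(\<lambda>v. x + t *\<^sub>R v) ` V | x t V. t > 0 \<and> V \<in> C0}"

definition field_entropy ::
    "'w measure \<Rightarrow> 'y set set \<Rightarrow> ('w \<Rightarrow> int ^ 'd \<Rightarrow> 'y::real_vector) \<Rightarrow> 'y \<Rightarrow> ereal" where
  "field_entropy M C0 \<eta> y =
     (INF A\<in>{A \<in> entropy_sets C0. y \<in> A}.
        liminf (\<lambda>n. elog (emeasure M {\<omega>\<in>space M. field_mean (lattice_box 0 n) (\<eta> \<omega>) \<in> A})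
                     / ereal (real (card (lattice_box (0 :: int ^ 'd) n)))))"

definition topological_dual :: "('y::{real_vector, topological_space} \<Rightarrow> real) set" where
  "topological_dual = {f. linear f \<and> continuous_on UNIV f}"

definition finite_pressure ::
    "'w measure \<Rightarrow> (int ^ 'd) set \<Rightarrow> ('w \<Rightarrow> int ^ 'd \<Rightarrow> 'y::real_vector) \<Rightarrow> ('y \<Rightarrow> real) \<Rightarrow> ereal"
  where
  "finite_pressure M L \<eta> f =
     elog (\<integral>\<^sup>+ \<omega>. ennreal (exp (f (\<Sum>z\<in>L. \<eta> \<omega> z))) \<partial>M) / ereal (real (card L))"

definition pressure ::
    "'w measure \<Rightarrow> ('w \<Rightarrow> int ^ 'd \<Rightarrow> 'y::real_vector) \<Rightarrow> ('y \<Rightarrow> real) \<Rightarrow> ereal" where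
  "pressure M \<eta> f = lim (\<lambda>n. finite_pressure M (lattice_box 0 n) \<eta> f)"

definition pressure_conjugate ::
    "'w measure \<Rightarrow> ('w \<Rightarrow> int ^ 'd \<Rightarrow> 'y::{real_vector, topological_space}) \<Rightarrow> 'y \<Rightarrow> ereal" where
  "pressure_conjugate M \<eta> y = (SUP f\<in>topological_dual. ereal (f y) - pressure M \<eta> f)"

end

(* Idea. Tile a large box by translates of a box of side m, separated by corridors. The superlevel
   sets of exp(phi(sum)) restricted to a convex set are convex, so by c.a.d.i. (and the layer-cake
   formula) the exponential moments over the blocks factorise up to exp(- c m) per block, while c.l.
   keeps the few sites in the corridors inside a fixed multiple of a small neighbourhood of 0. Two
   consequences follow. Taking two kinds of blocks shows that the entropy s is concave. Taking one
   kind and covering a finite-dimensional convex hull that carries most of the mass, one finds by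
   successive localisation a point x with s(x) + phi(x) close to the upper limit of the finite-volume
   pressures; with the Chebyshev bound this yields existence of the pressure and p = (- s)^*. As - s is
   convex, lower semicontinuous and nonnegative, Hahn-Banach gives - s = p^*. *)
theory Submission
  imports Defs
begin

section \<open>Neighbourhoods in Frechet spaces\<close>

text \<open>Exponential moments may be infinite and no exponential tightness is available, so
  near-maximisers of \<open>s + \<phi>\<close> cannot be sought inside one compact set; they arise
  as limits of centres of shrinking neighbourhoods, and this is where completeness enters. Both
  hypotheses give lower bounds, and for convex events only. Hence unlikely regions are not discarded
  by an estimate: the mean over the large box is shown to put enough mass on a finite union of
  neighbourhoods, and the pigeonhole principle picks one of them. Superadditivity has a second use:
  it turns a bound along infinitely many box sizes into one for all large sizes, at the price of a
  larger neighbourhood, and so closes the gap between upper and lower limits. Entropy and pressure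
  share one estimate, because the law of the mean is the tilted measure of
  \<open>\<phi> = 0\<close>. Rates are compared with real thresholds, so that logarithms of 0 and
  infinite masses need no separate treatment.\<close>

lemma tendsto_scaleR_frechet_space:
  fixes g :: "'b \<Rightarrow> 'y::frechet_space"
  assumes "(f \<longlongrightarrow> r) F" "(g \<longlongrightarrow> x) F"
  shows "((\<lambda>a. f a *\<^sub>R g a) \<longlongrightarrow> r *\<^sub>R x) F"
  using filterlim_compose[OF tendsto_scaleR_frechet filterlim_Pair[OF assms]] by simp

lemma continuous_on_scaleR_frechet_space:
  fixes g :: "'b::topological_space \<Rightarrow> 'y::frechet_space"
  assumes "continuous_on S f" "continuous_on S g"
  shows "continuous_on S (\<lambda>a. f a *\<^sub>R g a)"
  using assms by (auto simp: continuous_on_def intro!: tendsto_scaleR_frechet_space)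

lemma open_vimage_affine:
  fixes U :: "'y::frechet_space set"
  assumes "open U"
  shows "open {v. x + c *\<^sub>R v \<in> U}"
proof -
  have "continuous_on UNIV (\<lambda>v. x + c *\<^sub>R v)"
    by (intro continuous_intros continuous_on_scaleR_frechet_space)
  then have "open ((\<lambda>v. x + c *\<^sub>R v) -` U)" using assms by (simp add: open_vimage)
  then show ?thesis by (simp add: vimage_def)
qed

lemma affine_image_eq:
  fixes V :: "'y::real_vector set"
  assumes "c \<noteq> 0"
  shows "(\<lambda>v. x + c *\<^sub>R v) ` V = {v. - (1 / c) *\<^sub>R x + (1 / c) *\<^sub>R v \<in> V}"
proof safe
  fix v assume "v \<in> V"
  then show "- (1 / c) *\<^sub>R x + (1 / c) *\<^sub>R (x + c *\<^sub>R v) \<in> V"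
    using assms by (simp add: algebra_simps)
next
  fix v assume "- (1 / c) *\<^sub>R x + (1 / c) *\<^sub>R v \<in> V"
  moreover have "v = x + c *\<^sub>R (- (1 / c) *\<^sub>R x + (1 / c) *\<^sub>R v)"
    using assms by (simp add: scaleR_right_distrib scaleR_right_diff_distrib)
  ultimately show "v \<in> (\<lambda>v. x + c *\<^sub>R v) ` V" by blast
qed

lemma open_affine_image:
  fixes V :: "'y::frechet_space set"
  assumes "open V" "c \<noteq> 0"
  shows "open ((\<lambda>v. x + c *\<^sub>R v) ` V)"
  unfolding affine_image_eq[OF assms(2)] by (rule open_vimage_affine[OF assms(1)])

lemma convex_affine_image: "convex V \<Longrightarrow> convex ((\<lambda>v. x + c *\<^sub>R v) ` V)"
  using convex_affinity by blast

text \<open>Members of \<open>C0\<close> need not be symmetric. Symmetry is added because errors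
  occur with both signs and because one-sided bounds of linear functionals then bound their absolute
  values.\<close>

definition disk :: "'y::{real_vector, topological_space} set \<Rightarrow> bool" where
  "disk W \<longleftrightarrow> open W \<and> convex W \<and> 0 \<in> W \<and> (\<forall>w\<in>W. - w \<in> W)"

definition dilate :: "real \<Rightarrow> 'y::real_vector set \<Rightarrow> 'y set" where
  "dilate r W = (\<lambda>w. r *\<^sub>R w) ` W"

lemma disk_UNIV: "disk UNIV"
  by (simp add: disk_def)

lemma exists_disk_subset:
  fixes U :: "'y::frechet_space set"
  assumes "open U" "0 \<in> U"
  obtains W where "disk W" "W \<subseteq> U"
proof -
  obtain V where V: "open V" "\<forall>x\<in>V. \<forall>y\<in>V. \<forall>u\<ge>0. \<forall>v\<ge>0. u + v = 1 \<longrightarrow> u *\<^sub>R x + v *\<^sub>R y \<in> V" "0 \<in> V" "V \<subseteq> U"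
    using locally_convex[OF assms] by blast
  have cV: "convex V" using V(2) unfolding convex_def by blast
  define W where "W = V \<inter> {v. 0 + (- 1) *\<^sub>R v \<in> V}"
  have "convex {v. - v \<in> V}"
  proof (rule convexI)
    fix x y u v assume A: "x \<in> {v. - v \<in> V}" "y \<in> {v. - v \<in> V}" "0 \<le> u" "0 \<le> v" "u + v = (1::real)"
    have "u *\<^sub>R (- x) + v *\<^sub>R (- y) \<in> V" using A V(2) by blast
    then show "u *\<^sub>R x + v *\<^sub>R y \<in> {v. - v \<in> V}" by simp
  qed
  moreover have "open {v. 0 + (- 1) *\<^sub>R v \<in> V}" using V(1) by (rule open_vimage_affine)
  ultimately have "disk W" unfolding disk_def W_def using V cV by (auto intro: convex_Int)
  then show ?thesis using that V(4) W_def by blast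
qed

lemma disk_Int: "disk W \<Longrightarrow> disk W' \<Longrightarrow> disk (W \<inter> W')"
  by (auto simp: disk_def convex_Int)

lemma dilate_0: "disk W \<Longrightarrow> 0 \<in> dilate r W"
  unfolding dilate_def disk_def by (metis image_eqI scaleR_zero_right)

lemma dilate_1 [simp]: "dilate 1 W = W"
  by (simp add: dilate_def)

lemma dilate_dilate: "dilate r (dilate s W) = dilate (r * s) W"
  by (auto simp: dilate_def image_image)

lemma disk_dilate:
  fixes W :: "'y::frechet_space set"
  assumes "disk W" "0 < r"
  shows "disk (dilate r W)"
proof -
  have "open (dilate r W)" using open_affine_image[of W r 0] assms by (simp add: disk_def dilate_def)
  moreover have "convex (dilate r W)" using assms by (simp add: disk_def dilate_def convex_scaling)
  moreover have "\<forall>w\<in>dilate r W. - w \<in> dilate r W"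
  proof
    fix w assume "w \<in> dilate r W"
    then obtain v where "v \<in> W" "w = r *\<^sub>R v" by (auto simp: dilate_def)
    then have "- v \<in> W" "- w = r *\<^sub>R (- v)" using assms by (auto simp: disk_def)
    then show "- w \<in> dilate r W" unfolding dilate_def by blast
  qed
  ultimately show ?thesis using dilate_0[OF assms(1)] by (auto simp: disk_def)
qed

lemma dilate_scale: "disk W \<Longrightarrow> x \<in> dilate r W \<Longrightarrow> c *\<^sub>R x \<in> dilate (\<bar>c\<bar> * r) W"
proof -
  assume W: "disk W" and "x \<in> dilate r W"
  then obtain v where v: "v \<in> W" "x = r *\<^sub>R v" by (auto simp: dilate_def)
  \<comment> \<open>The sign of \<open>c\<close> is absorbed by symmetry, so only its absolute value
    enters the factor.\<close>
  have "sgn c *\<^sub>R v \<in> W" using v W by (auto simp: disk_def sgn_if)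
  moreover have "c *\<^sub>R x = (\<bar>c\<bar> * r) *\<^sub>R (sgn c *\<^sub>R v)"
  proof -
    have "(\<bar>c\<bar> * r) * sgn c = c * r" by (simp add: sgn_if)
    then have "(\<bar>c\<bar> * r) *\<^sub>R (sgn c *\<^sub>R v) = (c * r) *\<^sub>R v" by (metis scaleR_scaleR)
    then show ?thesis using v(2) by (metis scaleR_scaleR)
  qed
  ultimately show ?thesis unfolding dilate_def by blast
qed

text \<open>By convexity: up to the factor \<open>r + s\<close> the sum is the convex combination
  with weights \<open>r / (r + s)\<close> and \<open>s / (r + s)\<close>. Both factors may be 0,
  hence the case distinction.\<close>

lemma dilate_add:
  assumes "disk W" "x \<in> dilate r W" "y \<in> dilate s W" "0 \<le> r" "0 \<le> s"
  shows "x + y \<in> dilate (r + s) W"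
proof (cases "r + s = 0")
  case True
  then have "r = 0" "s = 0" using assms by auto
  then show ?thesis using assms by (auto simp: dilate_def)
next
  case False
  obtain v w where v: "v \<in> W" "x = r *\<^sub>R v" and w: "w \<in> W" "y = s *\<^sub>R w"
    using assms by (auto simp: dilate_def)
  have "(r / (r + s)) *\<^sub>R v + (s / (r + s)) *\<^sub>R w \<in> W"
    using assms v w False unfolding disk_def
    by (intro convexD) (auto simp: add_divide_distrib[symmetric])
  moreover have "x + y = (r + s) *\<^sub>R ((r / (r + s)) *\<^sub>R v + (s / (r + s)) *\<^sub>R w)"
    using v w False by (simp add: scaleR_right_distrib)
  ultimately show ?thesis unfolding dilate_def by blast
qed

lemma dilate_mono:
  assumes "disk W" "0 \<le> r" "r \<le> s"
  shows "dilate r W \<subseteq> dilate s W"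
proof
  fix x assume "x \<in> dilate r W"
  then have "x + 0 \<in> dilate (r + (s - r)) W"
    using assms by (intro dilate_add dilate_0) auto
  then show "x \<in> dilate s W" by simp
qed

lemma dilate_sum:
  assumes "disk W" "finite I" "\<And>i. i \<in> I \<Longrightarrow> w i \<in> dilate r W" "0 \<le> r"
  shows "(\<Sum>i\<in>I. w i) \<in> dilate (real (card I) * r) W"
  using assms(2,3)
proof (induction I rule: finite_induct)
  case empty
  then show ?case using dilate_0[OF assms(1)] by simp
next
  case (insert i I)
  have "w i + (\<Sum>i\<in>I. w i) \<in> dilate (r + real (card I) * r) W"
    using insert assms by (intro dilate_add) auto
  then show ?case using insert by (simp add: algebra_simps)
qed

lemma disk_absorbs:
  fixes x :: "'y::frechet_space"
  assumes "disk W"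
  obtains e where "0 < e" "\<And>s. \<bar>s\<bar> \<le> e \<Longrightarrow> s *\<^sub>R x \<in> W"
proof -
  have "((\<lambda>s. s *\<^sub>R x) \<longlongrightarrow> 0 *\<^sub>R x) (at (0::real))"
    by (intro tendsto_scaleR_frechet_space tendsto_intros)
  then have "\<forall>\<^sub>F s in at 0. s *\<^sub>R x \<in> W"
    using assms by (auto simp: tendsto_def disk_def)
  then obtain d where d: "d > 0" "\<And>s. s \<noteq> 0 \<Longrightarrow> dist s 0 < d \<Longrightarrow> s *\<^sub>R x \<in> W"
    unfolding eventually_at by auto
  show ?thesis
  proof (rule that[of "d / 2"])
    fix s :: real assume "\<bar>s\<bar> \<le> d / 2"
    then show "s *\<^sub>R x \<in> W" using d assms by (cases "s = 0") (auto simp: disk_def dist_real_def)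
  qed (use d in simp)
qed

section \<open>Continuity of linear functionals through neighbourhoods\<close>

lemma disk_dual_bounded:
  fixes f :: "'y::frechet_space \<Rightarrow> real"
  assumes "f \<in> topological_dual" "0 < e"
  obtains W where "disk W" "\<And>w. w \<in> W \<Longrightarrow> \<bar>f w\<bar> \<le> e"
proof -
  have lin: "linear f" and c: "continuous_on UNIV f" using assms by (auto simp: topological_dual_def)
  have "open (f -` {-e<..<e})" using c by (intro open_vimage) auto
  moreover have "0 \<in> f -` {-e<..<e}" using assms linear_0[OF lin] by simp
  ultimately obtain W where "disk W" "W \<subseteq> f -` {-e<..<e}" by (rule exists_disk_subset)
  then show ?thesis by (intro that[of W]) force+
qed

text \<open>A one-sided bound suffices: symmetry turns it into a bound on the absolute value, and
  small multiples of the disk then give continuity at every point.\<close>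

lemma bounded_on_disk_imp_dual:
  fixes f :: "'y::frechet_space \<Rightarrow> real"
  assumes lin: "linear f" and W: "disk W" and bd: "\<And>w. w \<in> W \<Longrightarrow> f w \<le> c"
  shows "f \<in> topological_dual"
proof -
  interpret f: linear f by (rule lin)
  have "isCont f x" for x
    unfolding continuous_at
  proof (rule tendstoI)
    fix e :: real assume e: "0 < e"
    define r where "r = e / (\<bar>c\<bar> + 1)"
    have r: "0 < r" "r * c < e"
    proof -
      show "0 < r" using e by (simp add: r_def)
      have "r * c \<le> r * \<bar>c\<bar>" using \<open>0 < r\<close> by (intro mult_left_mono) auto
      also have "\<dots> < r * (\<bar>c\<bar> + 1)" using \<open>0 < r\<close> by (intro mult_strict_left_mono) auto
      also have "\<dots> = e" by (simp add: r_def)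
      finally show "r * c < e" .
    qed
    define O' where "O' = {v. - (1 / r) *\<^sub>R x + (1 / r) *\<^sub>R v \<in> W}"
    have "open O'" unfolding O'_def using W by (intro open_vimage_affine) (simp add: disk_def)
    moreover have "x \<in> O'" using W by (simp add: O'_def disk_def)
    moreover have "dist (f v) (f x) < e" if "v \<in> O'" for v
    proof -
      define w where "w = - (1 / r) *\<^sub>R x + (1 / r) *\<^sub>R v"
      have w: "w \<in> W" "- w \<in> W" using that W by (auto simp: O'_def w_def disk_def)
      have "r *\<^sub>R w = v - x" using r(1) by (simp add: w_def scaleR_right_diff_distrib)
      then have "f v - f x = r * f w" by (metis f.diff f.scale real_scaleR_def)
      moreover have "f w \<le> c" "- f w \<le> c" using bd[OF w(1)] bd[OF w(2)] by (simp_all add: f.neg)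
      then have "\<bar>f w\<bar> \<le> c" by simp
      then have "r * \<bar>f w\<bar> \<le> r * c" using r by (intro mult_left_mono) auto
      moreover have "\<bar>r * f w\<bar> = r * \<bar>f w\<bar>" using r by (simp add: abs_mult)
      ultimately have "\<bar>f v - f x\<bar> \<le> r * c" using \<open>r * \<bar>f w\<bar> \<le> r * c\<close> by simp
      then show ?thesis using r by (simp add: dist_real_def)
    qed
    ultimately show "\<forall>\<^sub>F v in at x. dist (f v) (f x) < e"
      unfolding eventually_at_topological by blast
  qed
  then show ?thesis using lin by (simp add: topological_dual_def continuous_at_imp_continuous_on)
qed

text \<open>Adding a vertex makes the hull a continuous image of \<open>{0..1}\<close> times the old
  hull, so compactness passes along the induction.\<close>

lemma compact_convex_hull_finite:
  fixes F :: "'y::frechet_space set"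
  assumes "finite F"
  shows "compact (convex hull F)"
  using assms
proof (induction F rule: finite_induct)
  case empty
  then show ?case by simp
next
  case (insert a F)
  show ?case
  proof (cases "F = {}")
    case True
    then show ?thesis by simp
  next
    case False
    have "convex hull (insert a F) = (\<lambda>p. (1 - fst p) *\<^sub>R a + fst p *\<^sub>R snd p) ` ({0..1} \<times> (convex hull F))"
      unfolding convex_hull_insert[OF False]
    proof safe
      fix u v :: real and b assume "0 \<le> u" "0 \<le> v" "u + v = 1" "b \<in> convex hull F"
      then have "u = 1 - v" "v \<in> {0..1}" by auto
      then show "u *\<^sub>R a + v *\<^sub>R b \<in> (\<lambda>p. (1 - fst p) *\<^sub>R a + fst p *\<^sub>R snd p) ` ({0..1} \<times> (convex hull F))"
        using \<open>b \<in> convex hull F\<close> by (intro image_eqI[of _ _ "(v, b)"]) auto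
    next
      fix t :: real and b assume "t \<in> {0..1}" "b \<in> convex hull F"
      then show "\<exists>u\<ge>0. \<exists>v\<ge>0. \<exists>b'. u + v = 1 \<and> b' \<in> convex hull F \<and>
          (1 - fst (t, b)) *\<^sub>R a + fst (t, b) *\<^sub>R snd (t, b) = u *\<^sub>R a + v *\<^sub>R b'"
        by (intro exI[of _ "1 - t"] exI[of _ t] exI[of _ b] conjI) auto
    qed
    moreover have "continuous_on ({0..1} \<times> (convex hull F)) (\<lambda>p. (1 - fst p) *\<^sub>R a + fst p *\<^sub>R snd p)"
      by (intro continuous_intros continuous_on_scaleR_frechet_space)
    ultimately show ?thesis
      using insert by (simp add: compact_continuous_image compact_Times)
  qed
qed

text \<open>Compactness supplies the finite net for the pigeonhole argument in
  \<open>heavy_localise\<close>.\<close>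

lemma convex_hull_finite_totally_bounded:
  fixes F :: "'y::frechet_space set"
  assumes "finite F" "disk W"
  obtains T where "finite T" "\<And>x. x \<in> convex hull F \<Longrightarrow> \<exists>c\<in>T. x - c \<in> W"
proof -
  have op: "open ((\<lambda>v. c + 1 *\<^sub>R v) ` W)" for c
    using assms(2) by (intro open_affine_image) (auto simp: disk_def)
  have "convex hull F \<subseteq> (\<Union>c\<in>convex hull F. (\<lambda>v. c + 1 *\<^sub>R v) ` W)"
  proof
    fix x assume "x \<in> convex hull F"
    moreover have "x \<in> (\<lambda>v. x + 1 *\<^sub>R v) ` W" using assms(2) by (force simp: disk_def)
    ultimately show "x \<in> (\<Union>c\<in>convex hull F. (\<lambda>v. c + 1 *\<^sub>R v) ` W)" by blast
  qed
  then obtain T where T: "T \<subseteq> convex hull F" "finite T" "convex hull F \<subseteq> (\<Union>c\<in>T. (\<lambda>v. c + 1 *\<^sub>R v) ` W)"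
    using compactE_image[OF compact_convex_hull_finite[OF assms(1)], of "convex hull F" "\<lambda>c. (\<lambda>v. c + 1 *\<^sub>R v) ` W"] op
    by metis
  have "\<exists>c\<in>T. x - c \<in> W" if x: "x \<in> convex hull F" for x
  proof -
    obtain c w where "c \<in> T" "w \<in> W" "x = c + 1 *\<^sub>R w" using T(3) x by blast
    then have "x - c = w" by simp
    then show ?thesis using \<open>c \<in> T\<close> \<open>w \<in> W\<close> by blast
  qed
  then show ?thesis by (rule that[OF T(2)])
qed

section \<open>Hahn-Banach\<close>

definition sublinear :: "('a::real_vector \<Rightarrow> real) \<Rightarrow> bool" where
  "sublinear q \<longleftrightarrow> (\<forall>x y. q (x + y) \<le> q x + q y) \<and> (\<forall>c>0. \<forall>x. q (c *\<^sub>R x) = c * q x)"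

lemma sublinear_0: "sublinear q \<Longrightarrow> q 0 = 0"
proof -
  assume "sublinear q"
  then have "q ((2::real) *\<^sub>R 0) = 2 * q 0" unfolding sublinear_def by (metis zero_less_numeral)
  then show ?thesis by simp
qed

lemma sublinear_minus: "sublinear q \<Longrightarrow> - q (- x) \<le> q x"
proof -
  assume q: "sublinear q"
  then have "q (x + - x) \<le> q x + q (- x)" unfolding sublinear_def by blast
  then show ?thesis using sublinear_0[OF q] by simp
qed

text \<open>The functional \<open>q'\<close> lowers \<open>q\<close> as much as possible in the direction \<open>a\<close> while staying
  sublinear, so minimality forces \<open>q' = q\<close>.\<close>

lemma minimal_sublinear_additive:
  assumes q: "sublinear q"
    and min: "\<And>q'. sublinear q' \<Longrightarrow> (\<And>x. q' x \<le> q x) \<Longrightarrow> q' = q"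
  shows "q (x + a) = q x + q a"
proof -
  have sub: "q (x + y) \<le> q x + q y" and hom: "c > 0 \<Longrightarrow> q (c *\<^sub>R x) = c * q x" for x y c
    using q by (auto simp: sublinear_def)
  have hom0: "c \<ge> 0 \<Longrightarrow> q (c *\<^sub>R x) = c * q x" for c x
    using hom[of c x] sublinear_0[OF q] by (cases "c = 0") auto
  define q' where "q' x = (INF t\<in>{0..}. q (x + t *\<^sub>R a) - t * q a)" for x
  \<comment> \<open>Subadditivity bounds the values below by \<open>- q (- x)\<close>, so the
    infimum is a real number.\<close>
  have lb: "- q (- x) \<le> q (x + t *\<^sub>R a) - t * q a" if "t \<ge> 0" for x t
  proof -
    have "t * q a = q ((x + t *\<^sub>R a) + (- x))" using hom0[OF that, of a] by simp
    also have "\<dots> \<le> q (x + t *\<^sub>R a) + q (- x)" by (rule sub)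
    finally show ?thesis by simp
  qed
  have bdd: "bdd_below ((\<lambda>t. q (x + t *\<^sub>R a) - t * q a) ` {0..})" for x
    using lb[of _ x] by (intro bdd_belowI2[where m = "- q (- x)"]) auto
  have le: "q' x \<le> q (x + t *\<^sub>R a) - t * q a" if "t \<ge> 0" for x t
    unfolding q'_def using bdd that by (intro cINF_lower) auto
  have ge: "b \<le> q' x" if "\<And>t. t \<ge> 0 \<Longrightarrow> b \<le> q (x + t *\<^sub>R a) - t * q a" for b x
    unfolding q'_def using that by (intro cINF_greatest) auto
  have "sublinear q'"
    unfolding sublinear_def
  proof (intro conjI allI impI)
    fix x y
    have "q' (x + y) - (q (y + u *\<^sub>R a) - u * q a) \<le> q' x" if "u \<ge> 0" for u
    proof (rule ge)
      fix t :: real assume "t \<ge> 0"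
      have "q' (x + y) \<le> q (x + y + (t + u) *\<^sub>R a) - (t + u) * q a" using \<open>t \<ge> 0\<close> that by (intro le) auto
      also have "q (x + y + (t + u) *\<^sub>R a) = q ((x + t *\<^sub>R a) + (y + u *\<^sub>R a))" by (simp add: algebra_simps)
      also have "\<dots> \<le> q (x + t *\<^sub>R a) + q (y + u *\<^sub>R a)" by (rule sub)
      finally show "q' (x + y) - (q (y + u *\<^sub>R a) - u * q a) \<le> q (x + t *\<^sub>R a) - t * q a"
        by (simp add: algebra_simps)
    qed
    then have *: "q' (x + y) - q' x \<le> q (y + u *\<^sub>R a) - u * q a" if "u \<ge> 0" for u
      using that by (simp add: algebra_simps)
    have "q' (x + y) - q' x \<le> q' y" by (rule ge) (rule *)
    then show "q' (x + y) \<le> q' x + q' y" by simp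
  next
    \<comment> \<open>One inequality for all positive factors is enough: the reverse one is the same
      statement for \<open>1 / c\<close>.\<close>
    have aux: "q' (c *\<^sub>R x) \<ge> c * q' x" if "c > 0" for c x
    proof (rule ge)
      fix t :: real assume "t \<ge> 0"
      have "c * q' x \<le> c * (q (x + (t / c) *\<^sub>R a) - (t / c) * q a)"
        using that \<open>t \<ge> 0\<close> by (intro mult_left_mono le) auto
      also have "\<dots> = c * q (x + (t / c) *\<^sub>R a) - t * q a" using that by (simp add: right_diff_distrib)
      also have "c * q (x + (t / c) *\<^sub>R a) = q (c *\<^sub>R (x + (t / c) *\<^sub>R a))" using that by (simp add: hom)
      also have "c *\<^sub>R (x + (t / c) *\<^sub>R a) = c *\<^sub>R x + t *\<^sub>R a" using that by (simp add: scaleR_right_distrib)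
      finally show "c * q' x \<le> q (c *\<^sub>R x + t *\<^sub>R a) - t * q a" .
    qed
    fix c :: real and x assume c: "c > 0"
    have "(1 / c) * q' (c *\<^sub>R x) \<le> q' x" using aux[of "1 / c" "c *\<^sub>R x"] c by simp
    then have "q' (c *\<^sub>R x) \<le> c * q' x" using c by (simp add: field_simps)
    then show "q' (c *\<^sub>R x) = c * q' x" using aux[OF c] by (simp add: antisym)
  qed
  moreover have "q' x \<le> q x" for x using le[of 0 x] by simp
  ultimately have "q' = q" by (rule min)
  \<comment> \<open>Minimality identifies the infimum with \<open>q\<close>; its member at
    \<open>t = 1\<close> gives the missing inequality.\<close>
  then have "q x \<le> q (x + a) - q a" using le[of 1 x] by simp
  then show ?thesis using sub[of x a] by simp
qed

text \<open>In the subadditivity estimate two members \<open>q\<close> and \<open>r\<close> of the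
  chain occur; the smaller of them lies below both, so its own subadditivity suffices. Without
  comparability an infimum of sublinear functionals need not be sublinear.\<close>

lemma INF_sublinear_chain:
  assumes ne: "C \<noteq> {}" and sl: "\<And>q. q \<in> C \<Longrightarrow> sublinear q"
    and chain: "\<And>q r. q \<in> C \<Longrightarrow> r \<in> C \<Longrightarrow> (\<forall>x. q x \<le> r x) \<or> (\<forall>x. r x \<le> q x)"
    and lb: "\<And>q x. q \<in> C \<Longrightarrow> b x \<le> q x"
  shows "sublinear (\<lambda>x. INF q\<in>C. q x)"
proof -
  let ?u = "\<lambda>x. INF q\<in>C. q x"
  have bdd: "bdd_below ((\<lambda>q. q x) ` C)" for x using lb by (intro bdd_belowI2[where m = "b x"]) auto
  have le: "q \<in> C \<Longrightarrow> ?u x \<le> q x" for q x using bdd by (intro cINF_lower) auto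
  have ge: "(\<And>q. q \<in> C \<Longrightarrow> d \<le> q x) \<Longrightarrow> d \<le> ?u x" for d x using ne by (intro cINF_greatest) auto
  show ?thesis unfolding sublinear_def
  proof (intro conjI allI impI)
    fix x y
    have "?u (x + y) - r y \<le> ?u x" if r: "r \<in> C" for r
    proof (rule ge)
      fix q assume q: "q \<in> C"
      consider "\<forall>x. q x \<le> r x" | "\<forall>x. r x \<le> q x" using chain[OF q r] by blast
      then show "?u (x + y) - r y \<le> q x"
      proof cases
        case 1
        have "?u (x + y) \<le> q (x + y)" by (rule le[OF q])
        also have "\<dots> \<le> q x + q y" using sl[OF q] unfolding sublinear_def by blast
        also have "\<dots> \<le> q x + r y" using 1 by auto
        finally show ?thesis by simp
      next
        case 2
        have "?u (x + y) \<le> r (x + y)" by (rule le[OF r])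
        also have "\<dots> \<le> r x + r y" using sl[OF r] unfolding sublinear_def by blast
        also have "\<dots> \<le> q x + r y" using 2 by auto
        finally show ?thesis by simp
      qed
    qed
    then have *: "?u (x + y) - ?u x \<le> r y" if "r \<in> C" for r using that by (simp add: algebra_simps)
    have "?u (x + y) - ?u x \<le> ?u y" by (rule ge) (rule *)
    then show "?u (x + y) \<le> ?u x + ?u y" by simp
  next
    have aux: "?u (c *\<^sub>R x) \<ge> c * ?u x" if "c > 0" for c x
    proof (rule ge)
      fix q assume q: "q \<in> C"
      then have "q (c *\<^sub>R x) = c * q x" using sl[OF q] that unfolding sublinear_def by blast
      then show "c * ?u x \<le> q (c *\<^sub>R x)" using le[OF q, of x] that by simp
    qed
    fix c :: real and x assume c: "c > 0"
    have "(1 / c) * ?u (c *\<^sub>R x) \<le> ?u x" using aux[of "1 / c" "c *\<^sub>R x"] c by simp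
    then have "?u (c *\<^sub>R x) \<le> c * ?u x" using c by (simp add: field_simps)
    then show "?u (c *\<^sub>R x) = c * ?u x" using aux[OF c] by (simp add: antisym)
  qed
qed

text \<open>Zorn's lemma, with the order reversed, yields a minimal sublinear functional below
  \<open>q\<close>; minimality makes it additive, and additivity extends homogeneity to negative
  factors.\<close>

theorem sublinear_dominates_linear:
  fixes q :: "'a::real_vector \<Rightarrow> real"
  assumes q: "sublinear q"
  obtains f where "linear f" "\<And>x. f x \<le> q x"
proof -
  define A where "A = {r. sublinear r \<and> (\<forall>x. r x \<le> q x)}"
  \<comment> \<open>The bound is the same for all members of \<open>A\<close>, so infima along
    chains are real.\<close>
  have ge: "- q (- x) \<le> r x" if "r \<in> A" for r x
    using that sublinear_minus[of r x] unfolding A_def by (smt (verit) mem_Collect_eq)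
  define P where "P r s \<longleftrightarrow> (\<forall>x. s x \<le> (r x :: real))" for r s :: "'a \<Rightarrow> real"
  have "\<exists>m\<in>A. \<forall>a\<in>A. P m a \<longrightarrow> a = m"
  proof (rule predicate_Zorn)
    show "partial_order_on A (relation_of P A)"
      unfolding partial_order_on_def preorder_on_def refl_on_def trans_def antisym_def relation_of_def P_def
      by (auto intro: order_trans antisym simp: fun_eq_iff)
  next
    fix C assume C: "C \<in> Chains (relation_of P A)"
    then have CA: "C \<subseteq> A" unfolding Chains_def relation_of_def by blast
    show "\<exists>u\<in>A. \<forall>a\<in>C. P a u"
    proof (cases "C = {}")
      case True
      have "q \<in> A" using q by (simp add: A_def)
      then show ?thesis using True by blast
    next
      case False
      let ?u = "\<lambda>x. INF r\<in>C. r x"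
      have bdd: "bdd_below ((\<lambda>r. r x) ` C)" for x
        using ge CA by (intro bdd_belowI2[where m = "- q (- x)"]) auto
      have le: "r \<in> C \<Longrightarrow> ?u x \<le> r x" for r x using bdd by (intro cINF_lower) auto
      have "sublinear ?u"
      proof (rule INF_sublinear_chain[OF False])
        show "sublinear r" if "r \<in> C" for r using that CA by (auto simp: A_def)
        show "(\<forall>x. r x \<le> s x) \<or> (\<forall>x. s x \<le> r x)" if "r \<in> C" "s \<in> C" for r s
          using C that unfolding Chains_def relation_of_def P_def by blast
        show "- q (- x) \<le> r x" if "r \<in> C" for r x using that CA ge by blast
      qed
      moreover have "?u x \<le> q x" for x
      proof -
        obtain r where "r \<in> C" using False by blast
        moreover have "r x \<le> q x" using \<open>r \<in> C\<close> CA by (auto simp: A_def)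
        ultimately show ?thesis using le[of r x] by linarith
      qed
      ultimately have "?u \<in> A" by (simp add: A_def)
      moreover have "\<forall>a\<in>C. P a ?u" using le unfolding P_def by simp
      ultimately show ?thesis by (intro bexI[of _ ?u])
    qed
  qed
  then obtain f where f: "f \<in> A" "\<And>a. a \<in> A \<Longrightarrow> P f a \<Longrightarrow> a = f" by blast
  have sf: "sublinear f" and fq: "\<And>x. f x \<le> q x" using f(1) by (auto simp: A_def)
  have add: "f (x + y) = f x + f y" for x y
  proof (rule minimal_sublinear_additive[OF sf])
    fix q' assume "sublinear q'" "\<And>x. q' x \<le> f x"
    then show "q' = f" using f(2)[of q'] fq unfolding A_def P_def by (auto intro: order_trans)
  qed
  have neg: "f (- x) = - f x" for x using add[of x "- x"] sublinear_0[OF sf] by simp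
  have "linear f"
  proof (rule linearI)
    fix c :: real and x
    have pos: "c > 0 \<Longrightarrow> f (c *\<^sub>R x) = c * f x" for c x using sf unfolding sublinear_def by blast
    consider "c > 0" | "c = 0" | "- c > 0" by linarith
    then show "f (c *\<^sub>R x) = c *\<^sub>R f x"
    proof cases
      case 3
      then show ?thesis using pos[OF 3, of x] neg[of "c *\<^sub>R x"] by simp
    qed (use pos sublinear_0[OF sf] in auto)
  qed (rule add)
  then show ?thesis using fq that by blast
qed

section \<open>A continuous affine minorant of a convex function\<close>

text \<open>Here \<open>E\<close> is the epigraph of a convex function. Because that function is nonnegative, its
  inf-convolution with \<open>max a 0\<close> times the gauge of \<open>W\<close> is still at least \<open>a\<close> at \<open>y\<close>, and it is finite
  everywhere, so that no vertical hyperplane can occur.\<close>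

lemma affine_minorant:
  fixes E :: "('y::frechet_space \<times> real) set"
  assumes E: "convex E" "E \<noteq> {}" and nonneg: "\<And>x r. (x, r) \<in> E \<Longrightarrow> 0 \<le> r"
    and W: "disk W" and near: "\<And>x r. (x, r) \<in> E \<Longrightarrow> x - y \<in> W \<Longrightarrow> a \<le> r"
  obtains f where "f \<in> topological_dual" "\<And>x r. (x, r) \<in> E \<Longrightarrow> f x - f y \<le> r - a"
proof -
  define C where "C = max a 0"
  have C: "0 \<le> C" "a \<le> C" by (auto simp: C_def)
  \<comment> \<open>\<open>E\<close> smeared out by multiples of \<open>W\<close> at the price
    \<open>C\<close> per unit, and recentred so that \<open>(y, a)\<close> becomes the
    origin.\<close>
  define G where "G = {(v, \<tau>). \<exists>x r s. (x, r) \<in> E \<and> 0 < s \<and> v + y - x \<in> dilate s W \<and> \<tau> = r + C * s - a}"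
  have GI: "(v, \<tau>) \<in> G" if "(x, r) \<in> E" "0 < s" "v + y - x \<in> dilate s W" "\<tau> = r + C * s - a" for v \<tau> x r s
    using that unfolding G_def by blast
  have GE: "\<exists>x r s. (x, r) \<in> E \<and> 0 < s \<and> v + y - x \<in> dilate s W \<and> \<tau> = r + C * s - a" if "(v, \<tau>) \<in> G" for v \<tau>
    using that by (simp add: G_def)
  have G0: "0 \<le> \<tau>" if "(0, \<tau>) \<in> G" for \<tau>
  proof -
    have "\<exists>x r s. (x, r) \<in> E \<and> 0 < s \<and> y - x \<in> dilate s W \<and> \<tau> = r + C * s - a"
      using that by (simp add: G_def)
    then obtain x r s where x: "(x, r) \<in> E" "0 < s" "y - x \<in> dilate s W" "\<tau> = r + C * s - a"
      by blast
    \<comment> \<open>Either the penalty \<open>C * s\<close> alone reaches \<open>a\<close>, or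
      \<open>x\<close> is so close to \<open>y\<close> that \<open>near\<close> applies.\<close>
    show ?thesis
    proof (cases "s \<ge> 1")
      case True
      have "C * 1 \<le> C * s" using True C by (intro mult_left_mono) auto
      then show ?thesis using nonneg[OF x(1)] x(4) C by simp
    next
      case False
      then have "y - x \<in> W" using dilate_mono[OF W, of s 1] x by auto
      then have "x - y \<in> W" using W unfolding disk_def by (metis minus_diff_eq)
      then have "a \<le> r" using near x(1) by blast
      moreover have "0 \<le> C * s" using C x by simp
      ultimately show ?thesis using x by simp
    qed
  qed
  have Gconv: "(u1 *\<^sub>R v1 + u2 *\<^sub>R v2, u1 * \<tau>1 + u2 * \<tau>2) \<in> G"
    if g: "(v1, \<tau>1) \<in> G" "(v2, \<tau>2) \<in> G" and that: "0 < u1" "0 < u2" "u1 + u2 = 1" for v1 v2 \<tau>1 \<tau>2 u1 u2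
  proof -
    obtain x1 r1 s1 where 1: "(x1, r1) \<in> E" "0 < s1" "v1 + y - x1 \<in> dilate s1 W" "\<tau>1 = r1 + C * s1 - a"
      using GE[OF g(1)] by blast
    obtain x2 r2 s2 where 2: "(x2, r2) \<in> E" "0 < s2" "v2 + y - x2 \<in> dilate s2 W" "\<tau>2 = r2 + C * s2 - a"
      using GE[OF g(2)] by blast
    have "u1 *\<^sub>R (x1, r1) + u2 *\<^sub>R (x2, r2) \<in> E" using 1 2 that E(1) by (intro convexD) auto
    then have e: "(u1 *\<^sub>R x1 + u2 *\<^sub>R x2, u1 * r1 + u2 * r2) \<in> E" by simp
    have "u1 *\<^sub>R (v1 + y - x1) + u2 *\<^sub>R (v2 + y - x2) \<in> dilate (\<bar>u1\<bar> * s1 + \<bar>u2\<bar> * s2) W"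
      using 1 2 that by (intro dilate_add[OF W] dilate_scale[OF W]) auto
    also have "u1 *\<^sub>R (v1 + y - x1) + u2 *\<^sub>R (v2 + y - x2)
        = u1 *\<^sub>R v1 + u2 *\<^sub>R v2 + (u1 + u2) *\<^sub>R y - (u1 *\<^sub>R x1 + u2 *\<^sub>R x2)"
      by (simp add: algebra_simps)
    finally have d: "u1 *\<^sub>R v1 + u2 *\<^sub>R v2 + y - (u1 *\<^sub>R x1 + u2 *\<^sub>R x2) \<in> dilate (u1 * s1 + u2 * s2) W"
      using that by simp
    have "u1 * \<tau>1 + u2 * \<tau>2 = u1 * r1 + u2 * r2 + C * (u1 * s1 + u2 * s2) - (u1 + u2) * a"
      unfolding 1(4) 2(4) by (simp add: algebra_simps)
    moreover have "0 < u1 * s1 + u2 * s2" using 1 2 that by (simp add: add_pos_pos)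
    ultimately show ?thesis using GI[OF e _ d] that by simp
  qed
  \<comment> \<open>Slopes of the rays from the origin to points of \<open>G\<close> above the
    direction \<open>v\<close>. Their infimum is sublinear since \<open>G\<close> is convex, and
    finite since \<open>G\<close> has nonnegative heights over the origin.\<close>
  define Q where "Q v = {\<tau> / t | t \<tau>. 0 < t \<and> (t *\<^sub>R v, \<tau>) \<in> G}" for v
  have QI: "\<tau> / t \<in> Q v" if "0 < t" "(t *\<^sub>R v, \<tau>) \<in> G" for t v \<tau>
    unfolding Q_def using that by blast
  have Qadd: "p1 + p2 \<in> Q (v1 + v2)" if p: "p1 \<in> Q v1" "p2 \<in> Q v2" for v1 v2 p1 p2
  proof -
    obtain t1 \<tau>1 where 1: "p1 = \<tau>1 / t1" "0 < t1" "(t1 *\<^sub>R v1, \<tau>1) \<in> G" using p(1) by (auto simp: Q_def)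
    obtain t2 \<tau>2 where 2: "p2 = \<tau>2 / t2" "0 < t2" "(t2 *\<^sub>R v2, \<tau>2) \<in> G" using p(2) by (auto simp: Q_def)
    \<comment> \<open>The reciprocals of the two scales add: with this \<open>t\<close> the two
      points, weighted by \<open>t2 / (t1 + t2)\<close> and \<open>t1 / (t1 + t2)\<close>, combine
      to a point over \<open>t *\<^sub>R (v1 + v2)\<close>.\<close>
    define t where "t = t1 * t2 / (t1 + t2)"
    have t: "0 < t" using 1 2 by (simp add: t_def)
    have g: "((t2 / (t1 + t2)) *\<^sub>R t1 *\<^sub>R v1 + (t1 / (t1 + t2)) *\<^sub>R t2 *\<^sub>R v2,
           t2 / (t1 + t2) * \<tau>1 + t1 / (t1 + t2) * \<tau>2) \<in> G"
      by (rule Gconv[OF 1(3) 2(3)]) (use 1 2 in \<open>auto simp: add_divide_distrib[symmetric]\<close>)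
    have a1: "(t2 / (t1 + t2)) *\<^sub>R t1 *\<^sub>R v1 + (t1 / (t1 + t2)) *\<^sub>R t2 *\<^sub>R v2 = t *\<^sub>R (v1 + v2)"
      by (simp add: t_def algebra_simps)
    have a2: "t2 / (t1 + t2) * \<tau>1 + t1 / (t1 + t2) * \<tau>2 = t * (p1 + p2)"
      using 1(2) 2(2) by (simp add: t_def 1(1) 2(1) divide_simps)
    have "(t *\<^sub>R (v1 + v2), t * (p1 + p2)) \<in> G" using g unfolding a1 a2 .
    moreover have "p1 + p2 = t * (p1 + p2) / t" using t by simp
    ultimately show ?thesis using t unfolding Q_def by blast
  qed
  have Qne: "Q v \<noteq> {}" for v
  proof -
    obtain x r where x: "(x, r) \<in> E" using E(2) by auto
    \<comment> \<open>\<open>W\<close> absorbs every vector, so there are points of \<open>G\<close>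
      over every \<open>v\<close>.\<close>
    obtain e where e: "0 < e" "\<And>s. \<bar>s\<bar> \<le> e \<Longrightarrow> s *\<^sub>R (v + y - x) \<in> W" using disk_absorbs[OF W] by metis
    have "e *\<^sub>R (v + y - x) \<in> W" using e by simp
    then have "(1 / e) *\<^sub>R (e *\<^sub>R (v + y - x)) \<in> dilate (1 / e) W" unfolding dilate_def by (rule imageI)
    then have "(v, r + C * (1 / e) - a) \<in> G" using e x by (intro GI[OF x, of "1 / e"]) auto
    then have "(r + C * (1 / e) - a) / 1 \<in> Q v" by (intro QI) simp_all
    then show ?thesis by blast
  qed
  have Q0: "0 \<le> p" if "p \<in> Q 0" for p using that G0 by (auto simp: Q_def)
  have Qlb: "- p' \<le> p" if "p \<in> Q v" "p' \<in> Q (- v)" for p p' v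
    using Q0[of "p + p'"] Qadd[OF that] by simp
  have bdd: "bdd_below (Q v)" for v
  proof -
    obtain p' where "p' \<in> Q (- v)" using Qne by blast
    then show ?thesis using Qlb by (intro bdd_belowI[where m = "- p'"]) auto
  qed
  define q where "q v = Inf (Q v)" for v
  have qle: "p \<in> Q v \<Longrightarrow> q v \<le> p" for p v unfolding q_def using bdd by (intro cInf_lower)
  have qge: "(\<And>p. p \<in> Q v \<Longrightarrow> b \<le> p) \<Longrightarrow> b \<le> q v" for b v unfolding q_def using Qne by (intro cInf_greatest)
  have "sublinear q"
    unfolding sublinear_def
  proof (intro conjI allI impI)
    fix v w
    have "q (v + w) - p \<le> q v" if "p \<in> Q w" for p
      by (rule qge) (use qle[OF Qadd[OF _ that]] in \<open>simp add: algebra_simps\<close>)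
    then have *: "q (v + w) - q v \<le> p" if "p \<in> Q w" for p using that by (simp add: algebra_simps)
    have "q (v + w) - q v \<le> q w" by (rule qge) (rule *)
    then show "q (v + w) \<le> q v + q w" by simp
  next
    have aux: "c * q v \<le> q (c *\<^sub>R v)" if c: "c > 0" for c v
    proof (rule qge)
      fix p assume "p \<in> Q (c *\<^sub>R v)"
      then obtain t \<tau> where t: "p = \<tau> / t" "0 < t" "(t *\<^sub>R c *\<^sub>R v, \<tau>) \<in> G" by (auto simp: Q_def)
      then have "\<tau> / (t * c) \<in> Q v" using c by (intro QI) simp_all
      then have "c * q v \<le> c * (\<tau> / (t * c))" using c by (intro mult_left_mono qle) auto
      then show "c * q v \<le> p" using t c by simp
    qed
    fix c :: real and v assume c: "c > 0"
    have "(1 / c) * q (c *\<^sub>R v) \<le> q v" using aux[of "1 / c" "c *\<^sub>R v"] c by simp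
    then have "q (c *\<^sub>R v) \<le> c * q v" using c by (simp add: field_simps)
    then show "q (c *\<^sub>R v) = c * q v" using aux[OF c] by (simp add: antisym)
  qed
  then obtain f where f: "linear f" "\<And>v. f v \<le> q v" using sublinear_dominates_linear by blast
  interpret f: linear f by (rule f(1))
  have fG: "f v \<le> \<tau>" if "(v, \<tau>) \<in> G" for v \<tau>
  proof -
    have "\<tau> / 1 \<in> Q v" using that by (intro QI) simp_all
    then show ?thesis using f(2)[of v] qle[of "\<tau>" v] by simp
  qed
  have main: "f x - f y \<le> r - a" if "(x, r) \<in> E" for x r
  proof (rule field_le_epsilon)
    fix e :: real assume e: "0 < e"
    \<comment> \<open>The penalty \<open>C * s\<close> becomes at most \<open>e\<close>; since
      \<open>e\<close> is arbitrary it disappears from the final bound.\<close>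
    define s where "s = e / (C + 1)"
    have s: "0 < s" "C * s \<le> e" using e C by (auto simp: s_def field_simps)
    have "(x - y, r + C * s - a) \<in> G" by (rule GI[OF that s(1)]) (use dilate_0[OF W] in auto)
    then show "f x - f y \<le> r - a + e" using fG s(2) by (force simp: f.diff)
  qed
  \<comment> \<open>A single point of \<open>E\<close>, with penalty factor 1, bounds
    \<open>f\<close> on all of \<open>W\<close> and thereby gives continuity.\<close>
  obtain x r where x: "(x, r) \<in> E" using E(2) by auto
  have "f w \<le> r + C - a - f (x - y)" if "w \<in> W" for w
  proof -
    have "(x - y + w, r + C * 1 - a) \<in> G" by (rule GI[OF x, of 1]) (use that in auto)
    then show ?thesis using fG by (force simp: f.add)
  qed
  then have "f \<in> topological_dual" by (rule bounded_on_disk_imp_dual[OF f(1) W])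
  then show ?thesis using main that by blast
qed

section \<open>Lattice boxes\<close>

lemma mem_lattice_box: "x \<in> lattice_box z n \<longleftrightarrow> (\<forall>i. z $ i \<le> x $ i \<and> x $ i < z $ i + int n)"
proof
  assume "\<forall>i. z $ i \<le> x $ i \<and> x $ i < z $ i + int n"
  then have "x - z \<in> {x. \<forall>i. 0 \<le> x $ i \<and> x $ i < int n}" by (auto simp: algebra_simps)
  moreover have "x = z + (x - z)" by simp
  ultimately show "x \<in> lattice_box z n" unfolding lattice_box_def by blast
qed (auto simp: lattice_box_def)

lemma card_lattice_box: "card (lattice_box (z :: int ^ 'd) n) = n ^ CARD('d)"
  and finite_lattice_box [simp]: "finite (lattice_box (z :: int ^ 'd) n)"
proof -
  let ?P = "PiE (UNIV :: 'd set) (\<lambda>_. {0..<int n})"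
  have "{x :: int ^ 'd. \<forall>i. 0 \<le> x $ i \<and> x $ i < int n} = vec_lambda ` ?P"
  proof safe
    fix x :: "int ^ 'd" assume "\<forall>i. 0 \<le> x $ i \<and> x $ i < int n"
    then show "x \<in> vec_lambda ` ?P" by (intro image_eqI[of _ _ "vec_nth x"]) auto
  qed (auto simp: PiE_iff)
  moreover have "inj_on vec_lambda ?P" by (rule inj_onI) (metis vec_lambda_inverse UNIV_I)
  moreover have "finite ?P" "card ?P = n ^ CARD('d)" by (auto simp: card_PiE intro!: finite_PiE)
  moreover have "inj_on ((+) z) A" for A by simp
  ultimately show "card (lattice_box z n) = n ^ CARD('d)" "finite (lattice_box z n)"
    unfolding lattice_box_def by (auto simp: card_image)
qed

lemma sup_norm_ge: "\<bar>x $ i\<bar> \<le> sup_norm x"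
  unfolding sup_norm_def by (intro Max_ge) auto

text \<open>The corners are multiples of \<open>L\<close>, indexed by the points of a box of side
  \<open>n div L\<close>; being multiples of \<open>L\<close> makes invariance applicable once
  \<open>l\<close> divides \<open>L\<close>. Two different blocks lie in different cells in some
  coordinate, where their points are at least \<open>L - (m - 1)\<close> apart.\<close>

lemma separated_blocks_exist:
  assumes "1 \<le> m" "m \<le> L"
  obtains a :: "nat \<Rightarrow> int ^ 'd" where
    "\<And>k i. k < (n div L) ^ CARD('d) \<Longrightarrow> int L dvd a k $ i"
    "\<And>k. k < (n div L) ^ CARD('d) \<Longrightarrow> lattice_box (a k) m \<subseteq> lattice_box 0 n"
    "\<And>j k x y. j < (n div L) ^ CARD('d) \<Longrightarrow> k < (n div L) ^ CARD('d) \<Longrightarrow> j \<noteq> k \<Longrightarrow>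
       x \<in> lattice_box (a j) m \<Longrightarrow> y \<in> lattice_box (a k) m \<Longrightarrow> int L - int m + 1 \<le> sup_norm (x - y)"
proof -
  let ?N = "n div L"
  let ?K = "lattice_box (0 :: int ^ 'd) ?N"
  obtain h where h: "bij_betw h {0..<card ?K} ?K"
    using ex_bij_betw_nat_finite[OF finite_lattice_box] by blast
  define a where "a k = (\<chi> i. int L * h k $ i)" for k
  have hK: "h k \<in> ?K" if "k < ?N ^ CARD('d)" for k
    using h that bij_betwE[OF h] by (auto simp: card_lattice_box)
  have NL: "int L * int ?N \<le> int n"
    by (metis of_nat_mult of_nat_le_iff times_div_less_eq_dividend)
  show ?thesis
  proof (rule that[of a])
    show "int L dvd a k $ i" for k i by (simp add: a_def)
    show "lattice_box (a k) m \<subseteq> lattice_box 0 n" if "k < ?N ^ CARD('d)" for k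
    proof
      fix x assume x: "x \<in> lattice_box (a k) m"
      show "x \<in> lattice_box 0 n"
        unfolding mem_lattice_box
      proof (intro allI conjI)
        fix i
        have "\<forall>i. 0 \<le> h k $ i \<and> h k $ i < int ?N" using hK[OF that] by (simp add: mem_lattice_box)
        then have "0 \<le> h k $ i" "h k $ i < int ?N" by blast+
        then have i: "0 \<le> h k $ i" "h k $ i + 1 \<le> int ?N" by linarith+
        have xi: "int L * h k $ i \<le> x $ i" "x $ i < int L * h k $ i + int m"
          using x by (auto simp: mem_lattice_box a_def)
        show "(0 :: int ^ 'd) $ i \<le> x $ i" using xi i by (simp add: order_trans[OF _ xi(1)])
        have "int L * (h k $ i + 1) \<le> int L * int ?N" using i by (intro mult_left_mono) auto
        then show "x $ i < (0 :: int ^ 'd) $ i + int n" using xi NL assms by (simp add: algebra_simps)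
      qed
    qed
    show "int L - int m + 1 \<le> sup_norm (x - y)"
      if "j < ?N ^ CARD('d)" "k < ?N ^ CARD('d)" "j \<noteq> k"
        "x \<in> lattice_box (a j) m" "y \<in> lattice_box (a k) m" for j k x y
    proof -
      have "h j \<noteq> h k" using h that by (auto simp: bij_betw_def inj_on_def card_lattice_box)
      then obtain i where i: "h j $ i \<noteq> h k $ i" by (auto simp: vec_eq_iff)
      have xi: "int L * h j $ i \<le> x $ i" "x $ i < int L * h j $ i + int m"
        and yi: "int L * h k $ i \<le> y $ i" "y $ i < int L * h k $ i + int m"
        using that by (auto simp: mem_lattice_box a_def)
      have *: "int L * p + int L \<le> int L * q" if "p < q" for p q
        using mult_left_mono[of "p + 1" q "int L"] that by (simp add: algebra_simps)
      have "int L - int m + 1 \<le> \<bar>x $ i - y $ i\<bar>"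
        using i *[of "h j $ i" "h k $ i"] *[of "h k $ i" "h j $ i"] xi yi by linarith
      then show ?thesis using sup_norm_ge[of "x - y" i] by simp
    qed
  qed
qed

text \<open>Since \<open>g m\<close> is small compared with \<open>m\<close>, the spacing can be
  chosen barely larger than \<open>m\<close>, so the corridors have small density. The lower bound
  on the number of blocks serves \<open>entropy_concave\<close>, where a proportion of blocks is
  rounded.\<close>

lemma block_asymptotics:
  fixes g c :: "nat \<Rightarrow> real" and d l :: nat
  assumes g0: "\<And>n. n \<ge> 1 \<Longrightarrow> 0 \<le> g n" and g: "(\<lambda>n. g n / real n) \<longlonglongrightarrow> 0"
    and c: "(\<lambda>n. c n / real (n ^ d)) \<longlonglongrightarrow> 0" and l: "1 \<le> l" and d: "1 \<le> d"
    and e: "0 < e" "e < 1"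
  obtains m0 where "1 \<le> m0" "\<And>m. m0 \<le> m \<Longrightarrow> \<exists>L. l dvd L \<and> real m + g m \<le> real L \<and> m \<le> L \<and>
     c m \<le> e * real (m ^ d) \<and>
     (\<exists>n0. \<forall>n\<ge>n0. (1 - e) * real (n ^ d) \<le> real ((n div L) ^ d * m ^ d) \<and>
        (n div L) ^ d * m ^ d \<le> n ^ d \<and> 1 / e \<le> real ((n div L) ^ d))"
proof -
  \<comment> \<open>Bernoulli's inequality gives
    \<open>(1 - 2 * \<delta>) ^ d \<ge> 1 - 2 * d * \<delta> = 1 - e\<close>: one
    \<open>\<delta>\<close> pays for the corridors, the other for the incomplete cells at the
    boundary.\<close>
  define \<delta> where "\<delta> = e / (2 * real d)"
  have \<delta>: "0 < \<delta>" using e d by (simp add: \<delta>_def)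
  have dd: "2 * real d * \<delta> = e" using d by (simp add: \<delta>_def)
  have "(\<lambda>n. g n / real n + (1 + real l) * (1 / real n)) \<longlonglongrightarrow> 0 + (1 + real l) * 0"
    by (intro tendsto_intros g lim_1_over_n)
  then have "\<forall>\<^sub>F n in sequentially. g n / real n + (1 + real l) * (1 / real n) < \<delta>"
    using \<delta> by (intro order_tendstoD) auto
  moreover have "\<forall>\<^sub>F n in sequentially. c n / real (n ^ d) < e"
    using c e by (intro order_tendstoD) auto
  ultimately have "\<forall>\<^sub>F n in sequentially. g n / real n + (1 + real l) * (1 / real n) < \<delta> \<and> c n / real (n ^ d) < e"
    by (rule eventually_conj)
  then obtain m1 where m1: "\<And>n. n \<ge> m1 \<Longrightarrow> g n / real n + (1 + real l) * (1 / real n) < \<delta> \<and> c n / real (n ^ d) < e"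
    by (auto simp: eventually_sequentially)
  show ?thesis
  proof (rule that[of "max m1 1"])
    fix m assume m: "max m1 1 \<le> m"
    then have mpos: "1 \<le> m" "m1 \<le> m" by auto
    have mm: "g m + (1 + real l) < \<delta> * real m"
      using m1[OF mpos(2)] mpos by (simp add: field_simps)
    \<comment> \<open>A multiple of \<open>l\<close> strictly above \<open>m + g m\<close>. Rounding
      up \<open>g m\<close> costs at most 1 and divisibility at most \<open>l\<close>, whence the
      term \<open>1 + real l\<close> in the condition on \<open>m\<close>.\<close>
    define L where "L = l * ((m + nat \<lceil>g m\<rceil>) div l + 1)"
    have L1: "m + nat \<lceil>g m\<rceil> < L" unfolding L_def using l
      by (metis add.commute add_mult_distrib2 div_mult_mod_eq dvd_triv_left mod_less_divisor mult.commute mult.right_neutral nat_add_left_cancel_less less_le_trans zero_less_one)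
    have L2: "L \<le> m + nat \<lceil>g m\<rceil> + l" unfolding L_def
      by (simp add: times_div_less_eq_dividend)
    have gn: "g m \<le> real (nat \<lceil>g m\<rceil>)" "real (nat \<lceil>g m\<rceil>) \<le> g m + 1"
      using g0[OF mpos(1)] by linarith+
    have Lr: "real m + g m \<le> real L" using L1 gn by linarith
    have "real L \<le> real m + g m + 1 + real l" using L2 gn by linarith
    then have Lm: "real L \<le> real m * (1 + \<delta>)" using mm by (simp add: algebra_simps)
    have cm: "c m \<le> e * real (m ^ d)" using m1[OF mpos(2)] mpos by (simp add: field_simps)
    have Lpos: "0 < L" using L1 by simp
    obtain n1 :: nat where n1: "real m / \<delta> < real n1" using reals_Archimedean2 by blast
    obtain n2 :: nat where n2: "1 / e < real n2" using reals_Archimedean2 by blast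
    have "(1 - e) * real (n ^ d) \<le> real ((n div L) ^ d * m ^ d) \<and>
        (n div L) ^ d * m ^ d \<le> n ^ d \<and> 1 / e \<le> real ((n div L) ^ d)"
      if n: "max n1 (n2 * L) \<le> n" for n
    proof (intro conjI)
      let ?N = "n div L"
      have npos: "0 < real n" "real m < \<delta> * real n"
      proof -
        have "real m / \<delta> < real n" using n1 n by linarith
        then show "real m < \<delta> * real n" using \<delta> by (simp add: field_simps)
        then have "0 < \<delta> * real n" using mpos by linarith
        then show "0 < real n" using \<delta> by (simp add: zero_less_mult_iff)
      qed
      have mL: "m \<le> L" using L1 by simp
      have "?N * m \<le> ?N * L" using mL by simp
      also have "\<dots> \<le> n" by simp
      finally have "?N * m \<le> n" .
      then have "(?N * m) ^ d \<le> n ^ d" by (rule power_mono) simp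
      then show "?N ^ d * m ^ d \<le> n ^ d" by (simp add: power_mult_distrib)
      have "n < (?N + 1) * L" using Lpos by (metis add.commute dividend_less_div_times mult.commute mult_Suc plus_1_eq_Suc)
      then have "real n < (real ?N + 1) * real L" by (metis of_nat_1 of_nat_add of_nat_less_iff of_nat_mult)
      also have "\<dots> \<le> (real ?N + 1) * (real m * (1 + \<delta>))" using Lm by (intro mult_left_mono) auto
      finally have a: "real n < (real ?N * real m + real m) * (1 + \<delta>)" by (simp add: algebra_simps)
      \<comment> \<open>The product of \<open>1 - \<delta>\<close> and \<open>1 + \<delta>\<close>
        is at most 1, which removes the spacing factor; then \<open>m < \<delta> * n\<close> absorbs
        the incomplete cell.\<close>
      have "(1 - \<delta>) * real n \<le> (1 - \<delta>) * ((real ?N * real m + real m) * (1 + \<delta>))"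
        using a e d by (intro mult_left_mono) (auto simp: \<delta>_def field_simps)
      also have "\<dots> = (real ?N * real m + real m) * (1 - \<delta> * \<delta>)" by (simp add: algebra_simps)
      also have "\<dots> \<le> (real ?N * real m + real m) * 1" by (intro mult_left_mono) auto
      finally have "(1 - 2 * \<delta>) * real n \<le> real ?N * real m" using npos by (simp add: algebra_simps)
      moreover have d1: "0 \<le> 1 - 2 * \<delta>" using e d by (simp add: \<delta>_def field_simps)
      ultimately have "((1 - 2 * \<delta>) * real n) ^ d \<le> (real ?N * real m) ^ d" by (intro power_mono) auto
      moreover have "1 - e \<le> (1 - 2 * \<delta>) ^ d"
        using Bernoulli_inequality[of "- 2 * \<delta>" d] d1 dd by (simp add: algebra_simps)
      then have "(1 - e) * real (n ^ d) \<le> (1 - 2 * \<delta>) ^ d * real (n ^ d)" by (intro mult_right_mono) auto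
      ultimately show "(1 - e) * real (n ^ d) \<le> real (?N ^ d * m ^ d)" by (simp add: power_mult_distrib)
      have "n2 \<le> ?N" using n Lpos by (metis div_le_mono max.bounded_iff nonzero_mult_div_cancel_right less_not_refl)
      moreover have "?N \<le> ?N ^ d" using d by (cases "?N = 0") (auto intro: self_le_power)
      ultimately show "1 / e \<le> real (?N ^ d)" using n2 by linarith
    qed
    then have "\<exists>n0. \<forall>n\<ge>n0. (1 - e) * real (n ^ d) \<le> real ((n div L) ^ d * m ^ d) \<and>
        (n div L) ^ d * m ^ d \<le> n ^ d \<and> 1 / e \<le> real ((n div L) ^ d)" by blast
    moreover have "l dvd L" by (simp add: L_def)
    moreover have "m \<le> L" using L1 by simp
    ultimately show "\<exists>L. l dvd L \<and> real m + g m \<le> real L \<and> m \<le> L \<and> c m \<le> e * real (m ^ d) \<and>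
     (\<exists>n0. \<forall>n\<ge>n0. (1 - e) * real (n ^ d) \<le> real ((n div L) ^ d * m ^ d) \<and>
        (n div L) ^ d * m ^ d \<le> n ^ d \<and> 1 / e \<le> real ((n div L) ^ d))" using Lr cm by blast
  qed simp
qed

section \<open>Convex events\<close>

text \<open>The events to which c.a.d.i. and c.l. apply, tagged with the sites they depend on.
  Hiding the convex set lets an intersection be used again as a single such event.\<close>

definition convex_event ::
  "'w measure \<Rightarrow> ('w \<Rightarrow> 'i \<Rightarrow> 'y::{real_vector, topological_space}) \<Rightarrow> 'i set \<Rightarrow> 'w set \<Rightarrow> bool" where
  "convex_event M \<eta> S E \<longleftrightarrow> (\<exists>C\<in>convex_open S. E = {\<omega>\<in>space M. restrict (\<eta> \<omega>) S \<in> C})"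

lemma convex_event_Int:
  fixes \<eta> :: "'w \<Rightarrow> 'i \<Rightarrow> 'y::{real_vector, topological_space}"
  assumes "convex_event M \<eta> S E" "convex_event M \<eta> T F"
  shows "convex_event M \<eta> (S \<union> T) (E \<inter> F)"
proof -
  obtain C where C: "C \<in> convex_open S" "E = {\<omega>\<in>space M. restrict (\<eta> \<omega>) S \<in> C}"
    using assms(1) unfolding convex_event_def by blast
  obtain D where D: "D \<in> convex_open T" "F = {\<omega>\<in>space M. restrict (\<eta> \<omega>) T \<in> D}"
    using assms(2) unfolding convex_event_def by blast
  let ?X = "product_topology (\<lambda>_. euclidean) (S \<union> T) :: ('i \<Rightarrow> 'y) topology"
  define H where "H = {\<xi> \<in> topspace ?X. restrict \<xi> S \<in> C} \<inter> {\<xi> \<in> topspace ?X. restrict \<xi> T \<in> D}"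
  have "openin ?X {\<xi> \<in> topspace ?X. restrict \<xi> S \<in> C}"
    by (rule openin_continuous_map_preimage[OF continuous_on_restrict]) (use C in \<open>auto simp: convex_open_def\<close>)
  moreover have "openin ?X {\<xi> \<in> topspace ?X. restrict \<xi> T \<in> D}"
    by (rule openin_continuous_map_preimage[OF continuous_on_restrict]) (use D in \<open>auto simp: convex_open_def\<close>)
  ultimately have "openin ?X H" unfolding H_def by (rule openin_Int)
  moreover have "(\<lambda>z\<in>S \<union> T. (1 - u) *\<^sub>R x z + u *\<^sub>R y z) \<in> H" if H: "x \<in> H" "y \<in> H" "u \<in> {0..1}" for x y u
  proof -
    have eq: "restrict (\<lambda>z\<in>S \<union> T. (1 - u) *\<^sub>R x z + u *\<^sub>R y z) R =
        (\<lambda>z\<in>R. (1 - u) *\<^sub>R restrict x R z + u *\<^sub>R restrict y R z)" if "R \<subseteq> S \<union> T" for R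
      using that by (auto simp: fun_eq_iff)
    have "(\<lambda>z\<in>S. (1 - u) *\<^sub>R restrict x S z + u *\<^sub>R restrict y S z) \<in> C"
      using C(1) H unfolding convex_open_def H_def by blast
    moreover have "(\<lambda>z\<in>T. (1 - u) *\<^sub>R restrict x T z + u *\<^sub>R restrict y T z) \<in> D"
      using D(1) H unfolding convex_open_def H_def by blast
    ultimately show ?thesis unfolding H_def using eq[of S] eq[of T] by auto
  qed
  moreover have "E \<inter> F = {\<omega>\<in>space M. restrict (\<eta> \<omega>) (S \<union> T) \<in> H}"
    unfolding C D H_def by (auto simp: restrict_restrict Int_absorb1 Int_absorb2)
  ultimately show ?thesis unfolding convex_event_def convex_open_def by blast
qed

lemma continuous_map_field_mean:
  "continuous_map (product_topology (\<lambda>_. euclidean) S) euclidean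
     (field_mean S :: ('i \<Rightarrow> 'y::frechet_space) \<Rightarrow> 'y)"
proof -
  have "limitin euclidean (field_mean S) (field_mean S \<xi>) (atin (product_topology (\<lambda>_. euclidean) S) \<xi>)"
    if "\<xi> \<in> topspace (product_topology (\<lambda>_. euclidean) S)" for \<xi> :: "'i \<Rightarrow> 'y"
  proof -
    have "((\<lambda>\<xi>. \<xi> z) \<longlongrightarrow> \<xi> z) (atin (product_topology (\<lambda>_. euclidean) S) \<xi>)" if z: "z \<in> S" for z
    proof -
      have "continuous_map (product_topology (\<lambda>_. euclidean) S) euclidean (\<lambda>\<xi>::'i \<Rightarrow> 'y. \<xi> z)"
        using continuous_map_product_projection[OF z, of "\<lambda>_. euclidean"] by simp
      then show ?thesis using \<open>\<xi> \<in> topspace _\<close> unfolding continuous_map_atin by simp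
    qed
    then have "(field_mean S \<longlongrightarrow> field_mean S \<xi>) (atin (product_topology (\<lambda>_. euclidean) S) \<xi>)"
      unfolding field_mean_def
      by (intro tendsto_scaleR_frechet_space tendsto_sum tendsto_const)
    then show ?thesis by simp
  qed
  then show ?thesis unfolding continuous_map_atin by blast
qed

lemma field_mean_restrict: "field_mean S (restrict \<xi> S) = field_mean S \<xi>"
  by (simp add: field_mean_def)

lemma field_mean_affine:
  "field_mean S (\<lambda>z\<in>S. (1 - u) *\<^sub>R x z + u *\<^sub>R y z) = (1 - u) *\<^sub>R field_mean S x + u *\<^sub>R field_mean S y"
  by (simp add: field_mean_def sum.distrib scaleR_sum_right[symmetric] scaleR_right_distrib mult.commute)

lemma convex_event_mean:
  fixes \<eta> :: "'w \<Rightarrow> 'i \<Rightarrow> 'y::frechet_space"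
  assumes "open U" "convex U"
  shows "convex_event M \<eta> S {\<omega>\<in>space M. field_mean S (\<eta> \<omega>) \<in> U}"
proof -
  let ?X = "product_topology (\<lambda>_. euclidean) S :: ('i \<Rightarrow> 'y) topology"
  define H where "H = {\<xi> \<in> topspace ?X. field_mean S \<xi> \<in> U}"
  have "openin ?X H"
    unfolding H_def by (rule openin_continuous_map_preimage[OF continuous_map_field_mean]) (use assms in auto)
  moreover have "(\<lambda>z\<in>S. (1 - u) *\<^sub>R x z + u *\<^sub>R y z) \<in> H" if "x \<in> H" "y \<in> H" "u \<in> {0..1}" for x y u
    using that assms(2) unfolding H_def by (auto simp: field_mean_affine intro: convexD)
  ultimately have "H \<in> convex_open S" unfolding convex_open_def by blast
  moreover have "{\<omega>\<in>space M. field_mean S (\<eta> \<omega>) \<in> U} = {\<omega>\<in>space M. restrict (\<eta> \<omega>) S \<in> H}"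
    unfolding H_def by (auto simp: field_mean_restrict)
  ultimately show ?thesis unfolding convex_event_def by blast
qed

lemma convex_event_space:
  fixes \<eta> :: "'w \<Rightarrow> 'i \<Rightarrow> 'y::frechet_space"
  shows "convex_event M \<eta> {} (space M)"
  using convex_event_mean[of UNIV M \<eta> "{}"] by simp

text \<open>Countability of the index type and second countability of \<open>Y\<close> make the
  product sigma-algebra the Borel sigma-algebra of the product, so it contains the open cylinder
  over the convex set.\<close>

lemma convex_event_sets:
  fixes \<eta> :: "'w \<Rightarrow> 'i::countable \<Rightarrow> 'y::separable_frechet_space"
  assumes "\<eta> \<in> M \<rightarrow>\<^sub>M (\<Pi>\<^sub>M z\<in>UNIV. borel)" "convex_event M \<eta> S E"
  shows "E \<in> sets M"
proof -
  obtain C where C: "C \<in> convex_open S" "E = {\<omega>\<in>space M. restrict (\<eta> \<omega>) S \<in> C}"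
    using assms(2) unfolding convex_event_def by blast
  have "openin (product_topology (\<lambda>_. euclidean) UNIV) {\<xi> \<in> topspace (product_topology (\<lambda>_. euclidean) UNIV). restrict \<xi> S \<in> C}"
    by (rule openin_continuous_map_preimage[OF continuous_on_restrict]) (use C in \<open>auto simp: convex_open_def\<close>)
  then have "open {\<xi>. restrict \<xi> S \<in> C}" by (simp add: open_fun_def)
  then have "{\<xi>. restrict \<xi> S \<in> C} \<in> sets (\<Pi>\<^sub>M z\<in>UNIV. borel)"
    unfolding sets_PiM_equal_borel by simp
  with assms(1) have "\<eta> -` {\<xi>. restrict \<xi> S \<in> C} \<inter> space M \<in> sets M" by (rule measurable_sets)
  then show ?thesis unfolding C by (simp add: vimage_def Int_def conj_commute)
qed

lemma measurable_field_mean: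
  "field_mean S \<in> (\<Pi>\<^sub>M z\<in>UNIV. borel) \<rightarrow>\<^sub>M (borel :: 'y::separable_frechet_space measure)"
proof -
  have "(\<lambda>v. (1 / real (card S)) *\<^sub>R v) \<in> borel_measurable (borel :: 'y measure)"
    by (intro borel_measurable_continuous_onI continuous_on_scaleR_frechet_space continuous_intros)
  moreover have "(\<lambda>\<xi>. \<Sum>z\<in>S. \<xi> z) \<in> (\<Pi>\<^sub>M z\<in>UNIV. borel) \<rightarrow>\<^sub>M (borel :: 'y measure)"
    by (intro borel_measurable_sum measurable_component_singleton) auto
  ultimately show ?thesis unfolding field_mean_def by (rule measurable_compose[rotated])
qed

text \<open>The extra factor \<open>F\<close> stays inside the integral: in
  \<open>product_decoupling\<close> it carries the other blocks, the corridors and the event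
  \<open>D\<close>, while one block is resolved into its superlevel sets.\<close>

lemma (in sigma_finite_measure) nn_integral_layer_cake:
  fixes f :: "'a \<Rightarrow> real"
  assumes [measurable]: "F \<in> borel_measurable M" "f \<in> borel_measurable M"
  shows "(\<integral>\<^sup>+ \<omega>. F \<omega> * ennreal (f \<omega>) \<partial>M) =
    (\<integral>\<^sup>+ t. (\<integral>\<^sup>+ \<omega>. F \<omega> * indicator {\<omega>\<in>space M. t < f \<omega>} \<omega> \<partial>M) * indicator {0..} t \<partial>lborel)"
proof -
  interpret P: pair_sigma_finite M lborel ..
  have "(\<integral>\<^sup>+ \<omega>. F \<omega> * ennreal (f \<omega>) \<partial>M) = (\<integral>\<^sup>+ \<omega>. (\<integral>\<^sup>+ t. F \<omega> * indicator {0..<f \<omega>} t \<partial>lborel) \<partial>M)"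
  proof (rule nn_integral_cong)
    fix \<omega>
    show "F \<omega> * ennreal (f \<omega>) = (\<integral>\<^sup>+ t. F \<omega> * indicator {0..<f \<omega>} t \<partial>lborel)"
      by (cases "0 \<le> f \<omega>") (simp_all add: nn_integral_cmult ennreal_neg)
  qed
  also have "\<dots> = (\<integral>\<^sup>+ \<omega>. (\<integral>\<^sup>+ t. F \<omega> * (if 0 \<le> t \<and> t < f \<omega> then 1 else 0) \<partial>lborel) \<partial>M)"
    by (intro nn_integral_cong) (auto split: split_indicator)
  also have "\<dots> = (\<integral>\<^sup>+ t. (\<integral>\<^sup>+ \<omega>. F \<omega> * (if 0 \<le> t \<and> t < f \<omega> then 1 else 0) \<partial>M) \<partial>lborel)"
    by (rule P.Fubini'[symmetric]) measurable
  also have "\<dots> = (\<integral>\<^sup>+ t. (\<integral>\<^sup>+ \<omega>. F \<omega> * indicator {\<omega>\<in>space M. t < f \<omega>} \<omega> \<partial>M) * indicator {0..} t \<partial>lborel)"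
  proof (rule nn_integral_cong)
    fix t :: real
    have "(\<integral>\<^sup>+ \<omega>. F \<omega> * (if 0 \<le> t \<and> t < f \<omega> then 1 else 0) \<partial>M) =
        (\<integral>\<^sup>+ \<omega>. F \<omega> * indicator {\<omega>\<in>space M. t < f \<omega>} \<omega> * indicator {0..} t \<partial>M)"
      by (intro nn_integral_cong) (auto split: split_indicator)
    also have "\<dots> = (\<integral>\<^sup>+ \<omega>. F \<omega> * indicator {\<omega>\<in>space M. t < f \<omega>} \<omega> \<partial>M) * indicator {0..} t"
      by (rule nn_integral_multc) measurable
    finally show "(\<integral>\<^sup>+ \<omega>. F \<omega> * (if 0 \<le> t \<and> t < f \<omega> then 1 else 0) \<partial>M) =
      (\<integral>\<^sup>+ \<omega>. F \<omega> * indicator {\<omega>\<in>space M. t < f \<omega>} \<omega> \<partial>M) * indicator {0..} t" .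
  qed
  finally show ?thesis .
qed

section \<open>Weakly dependent fields\<close>

text \<open>The functions from both hypotheses are fixed here, since later constants depend on them,
  and the two inequalities are restated for convex events so that they can be iterated.\<close>

locale mixing_field = prob_space M
  for M :: "'w measure" and \<eta> :: "'w \<Rightarrow> int ^ 'd \<Rightarrow> 'y::separable_frechet_space" +
  fixes C0 :: "'y set set" and l :: nat and g c :: "nat \<Rightarrow> real" and t \<alpha> :: "'y set \<Rightarrow> real"
  assumes base: "convex_nhds_base C0"
    and l: "1 \<le> l"
    and field_meas [measurable]: "\<eta> \<in> M \<rightarrow>\<^sub>M (\<Pi>\<^sub>M z\<in>UNIV. borel)"
    and g_nonneg: "\<And>n. 1 \<le> n \<Longrightarrow> 0 \<le> g n"
    and g_lim: "(\<lambda>n. g n / real n) \<longlonglongrightarrow> 0"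
    and c_lim: "(\<lambda>n. c n / real (n ^ CARD('d))) \<longlonglongrightarrow> 0"
    and decoupling: "\<And>z n S E F. 1 \<le> n \<Longrightarrow> finite S \<Longrightarrow> convex_event M \<eta> (lattice_box z n) E \<Longrightarrow>
      convex_event M \<eta> S F \<Longrightarrow> ereal (g n) < lattice_dist S (lattice_box z n) \<Longrightarrow>
      exp (- c n) * prob E * prob F \<le> prob (E \<inter> F)"
    and t_pos: "\<And>V. V \<in> C0 \<Longrightarrow> 0 < t V"
    and alpha_pos: "\<And>V. V \<in> C0 \<Longrightarrow> 0 < \<alpha> V"
    and alpha_le: "\<And>V. V \<in> C0 \<Longrightarrow> \<alpha> V \<le> 1"
    and local_control: "\<And>V z S E. V \<in> C0 \<Longrightarrow> finite S \<Longrightarrow> z \<notin> S \<Longrightarrow> convex_event M \<eta> S E \<Longrightarrow>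
      \<alpha> V * prob E \<le> prob ({\<omega>\<in>space M. \<eta> \<omega> z \<in> dilate (t V) V} \<inter> E)"
    and invariant: "R_invariant M l \<eta>"
begin

lemma event_meas: "convex_event M \<eta> S E \<Longrightarrow> E \<in> sets M"
  by (rule convex_event_sets[OF field_meas])

lemma mean_meas [measurable]: "(\<lambda>\<omega>. field_mean S (\<eta> \<omega>)) \<in> M \<rightarrow>\<^sub>M borel"
  using measurable_compose[OF field_meas measurable_field_mean] .

lemma base_sub:
  assumes "disk W"
  obtains V where "V \<in> C0" "V \<subseteq> W" "open V" "convex V" "0 \<in> V"
  using base assms unfolding convex_nhds_base_def disk_def by metis

lemma convex_event_site:
  assumes "V \<in> C0"
  shows "convex_event M \<eta> {z} {\<omega>\<in>space M. \<eta> \<omega> z \<in> dilate (t V) V}"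
proof -
  have "open ((\<lambda>v. 0 + t V *\<^sub>R v) ` V)" "convex ((\<lambda>v. 0 + t V *\<^sub>R v) ` V)"
    using t_pos[OF assms] base assms unfolding convex_nhds_base_def
    by (auto intro!: open_affine_image convex_affine_image simp del: add_0)
  then show ?thesis
    using convex_event_mean[of "(\<lambda>v. 0 + t V *\<^sub>R v) ` V" M \<eta> "{z}"] by (simp add: field_mean_def dilate_def)
qed

definition quiet :: "'y set \<Rightarrow> (int ^ 'd) set \<Rightarrow> 'w set" where
  "quiet V Z = {\<omega>\<in>space M. \<forall>z\<in>Z. \<eta> \<omega> z \<in> dilate (t V) V}"

text \<open>Local control is applied to one site after the other, each time to the event obtained so
  far. That event has to stay convex, which is why both claims go through one induction.\<close>

lemma quiet_prob:
  assumes "V \<in> C0" "finite Z" "finite S" "Z \<inter> S = {}" "convex_event M \<eta> S E"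
  shows "\<alpha> V ^ card Z * prob E \<le> prob (quiet V Z \<inter> E) \<and> convex_event M \<eta> (Z \<union> S) (quiet V Z \<inter> E)"
  using assms(2,4)
proof (induction Z rule: finite_induct)
  case empty
  have "E \<subseteq> space M" using event_meas[OF assms(5)] by (rule sets.sets_into_space)
  then have "quiet V {} \<inter> E = E" by (auto simp: quiet_def)
  then show ?case using assms by simp
next
  case (insert z Z)
  let ?G = "{\<omega>\<in>space M. \<eta> \<omega> z \<in> dilate (t V) V}"
  have eq: "quiet V (insert z Z) \<inter> E = ?G \<inter> (quiet V Z \<inter> E)" by (auto simp: quiet_def)
  have IH: "\<alpha> V ^ card Z * prob E \<le> prob (quiet V Z \<inter> E)" "convex_event M \<eta> (Z \<union> S) (quiet V Z \<inter> E)"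
    using insert by auto
  have "\<alpha> V ^ card (insert z Z) * prob E = \<alpha> V * (\<alpha> V ^ card Z * prob E)" using insert by simp
  also have "\<dots> \<le> \<alpha> V * prob (quiet V Z \<inter> E)"
    using IH alpha_pos[OF assms(1)] by (intro mult_left_mono) auto
  also have "\<dots> \<le> prob (?G \<inter> (quiet V Z \<inter> E))"
    using insert assms IH by (intro local_control[of V "Z \<union> S"]) auto
  finally have 1: "\<alpha> V ^ card (insert z Z) * prob E \<le> prob (?G \<inter> (quiet V Z \<inter> E))" .
  have "convex_event M \<eta> ({z} \<union> (Z \<union> S)) (?G \<inter> (quiet V Z \<inter> E))"
    by (rule convex_event_Int[OF convex_event_site[OF assms(1)] IH(2)])
  then show ?case using 1 eq by simp
qed

lemma quiet_meas: "V \<in> C0 \<Longrightarrow> finite Z \<Longrightarrow> quiet V Z \<in> sets M"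
proof -
  assume "V \<in> C0" "finite Z"
  then have "quiet V Z \<inter> space M \<in> sets M"
    using quiet_prob[of V Z "{}" "space M"] convex_event_space[of M \<eta>] event_meas by blast
  moreover have "quiet V Z \<inter> space M = quiet V Z" by (auto simp: quiet_def)
  ultimately show ?thesis by simp
qed

text \<open>Integer coordinates give the extra 1, and this makes the inequality strict, as c.a.d.i.
  demands.\<close>

lemma lattice_dist_gt:
  assumes "real m + g m \<le> real L"
    and "\<And>x y. x \<in> S \<Longrightarrow> y \<in> T \<Longrightarrow> int L - int m + 1 \<le> sup_norm (x - y)"
  shows "ereal (g m) < lattice_dist S T"
proof -
  have "ereal (g m) < ereal (real_of_int (int L - int m + 1))" using assms(1) by simp
  also have "\<dots> \<le> lattice_dist S T"
    unfolding lattice_dist_def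
    by (intro INF_greatest) (use assms(2) in \<open>simp only: ereal_less_eq of_int_le_iff\<close>)
  finally show ?thesis .
qed

text \<open>Functions with convex open superlevel sets decouple like indicators: write each of them as an
  integral over its superlevel sets, one block at a time.\<close>

lemma product_decoupling:
  fixes a :: "nat \<Rightarrow> int ^ 'd" and f :: "nat \<Rightarrow> 'w \<Rightarrow> real"
  assumes V: "V \<in> C0" and m: "1 \<le> m" "real m + g m \<le> real L"
    and Z: "finite Z"
    and f: "\<And>j. f j \<in> borel_measurable M"
    and lev: "\<And>j s. 0 \<le> s \<Longrightarrow> convex_event M \<eta> (lattice_box (a j) m) {\<omega>\<in>space M. s < f j \<omega>}"
    and T: "finite T"
    and ZT: "\<And>j. j \<in> T \<Longrightarrow> Z \<inter> lattice_box (a j) m = {}"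
    and sep: "\<And>i j x y. i \<in> T \<Longrightarrow> j \<in> T \<Longrightarrow> i \<noteq> j \<Longrightarrow> x \<in> lattice_box (a i) m \<Longrightarrow> y \<in> lattice_box (a j) m \<Longrightarrow>
       int L - int m + 1 \<le> sup_norm (x - y)"
    and S: "finite S" "Z \<inter> S = {}" "convex_event M \<eta> S D"
    and sepS: "\<And>j x y. j \<in> T \<Longrightarrow> x \<in> S \<Longrightarrow> y \<in> lattice_box (a j) m \<Longrightarrow> int L - int m + 1 \<le> sup_norm (x - y)"
  shows "ennreal (\<alpha> V ^ card Z) * (\<Prod>j\<in>T. ennreal (exp (- c m)) * (\<integral>\<^sup>+ \<omega>. ennreal (f j \<omega>) \<partial>M)) * emeasure M D
    \<le> (\<integral>\<^sup>+ \<omega>. (\<Prod>j\<in>T. ennreal (f j \<omega>)) * indicator (quiet V Z \<inter> D) \<omega> \<partial>M)"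
  using T ZT sep S sepS
\<comment> \<open>\<open>S\<close> and \<open>D\<close> vary because a superlevel set of the block
  taken out is added to \<open>D\<close>, and its box to \<open>S\<close>, before the hypothesis for
  the other blocks is used.\<close>
proof (induction T arbitrary: S D rule: finite_induct)
  case empty
  \<comment> \<open>With no block left only the corridors remain, and local control on them gives
    the power of \<open>\<alpha> V\<close>.\<close>
  have "ennreal (\<alpha> V ^ card Z) * emeasure M D = ennreal (\<alpha> V ^ card Z * prob D)"
    using alpha_pos[OF V] by (simp add: emeasure_eq_measure ennreal_mult)
  also have "\<dots> \<le> ennreal (prob (quiet V Z \<inter> D))"
    using quiet_prob[of V Z S D] empty V Z by (intro ennreal_leI) auto
  also have "\<dots> = (\<integral>\<^sup>+ \<omega>. indicator (quiet V Z \<inter> D) \<omega> \<partial>M)"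
    using quiet_meas[OF V Z] event_meas[OF empty(5)] by (simp add: emeasure_eq_measure sets.Int)
  finally show ?case by simp
next
  case (insert j T)
  note [measurable] = f
  let ?B = "lattice_box (a j) m"
  let ?q = "ennreal (\<alpha> V ^ card Z) * (\<Prod>i\<in>T. ennreal (exp (- c m)) * (\<integral>\<^sup>+ \<omega>. ennreal (f i \<omega>) \<partial>M))"
  let ?E = "\<lambda>s. {\<omega>\<in>space M. s < f j \<omega>}"
  have Dm [measurable]: "D \<in> sets M" and Gm [measurable]: "quiet V Z \<in> sets M"
    using event_meas[OF insert.prems(5)] quiet_meas[OF V Z] by auto
  have step: "?q * (ennreal (exp (- c m)) * emeasure M D) * emeasure M (?E s)
      \<le> (\<integral>\<^sup>+ \<omega>. (\<Prod>i\<in>T. ennreal (f i \<omega>)) * indicator (quiet V Z \<inter> D) \<omega> * indicator (?E s) \<omega> \<partial>M)"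
    if s: "0 \<le> s" for s
  proof -
    have ce: "convex_event M \<eta> (S \<union> ?B) (D \<inter> ?E s)"
      by (rule convex_event_Int[OF insert.prems(5) lev[OF s]])
    have dist: "ereal (g m) < lattice_dist S ?B"
      using insert.prems(6) m by (intro lattice_dist_gt[of m L]) auto
    have "exp (- c m) * prob (?E s) * prob D \<le> prob (?E s \<inter> D)"
      by (rule decoupling[OF m(1) insert.prems(3) lev[OF s] insert.prems(5) dist])
    then have "ennreal (exp (- c m) * prob (?E s) * prob D) \<le> ennreal (prob (D \<inter> ?E s))"
      by (simp add: Int_commute ennreal_leI)
    then have "ennreal (exp (- c m)) * emeasure M D * emeasure M (?E s) \<le> emeasure M (D \<inter> ?E s)"
      by (simp add: emeasure_eq_measure ennreal_mult mult_ac)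
    then have "?q * (ennreal (exp (- c m)) * emeasure M D * emeasure M (?E s)) \<le> ?q * emeasure M (D \<inter> ?E s)"
      by (rule mult_left_mono) simp
    also have "\<dots> \<le> (\<integral>\<^sup>+ \<omega>. (\<Prod>i\<in>T. ennreal (f i \<omega>)) * indicator (quiet V Z \<inter> (D \<inter> ?E s)) \<omega> \<partial>M)"
    proof (rule insert.IH[OF _ _ _ _ ce])
      show "Z \<inter> lattice_box (a i) m = {}" if "i \<in> T" for i using insert.prems(1) that by blast
      show "int L - int m + 1 \<le> sup_norm (x - y)"
        if "i \<in> T" "k \<in> T" "i \<noteq> k" "x \<in> lattice_box (a i) m" "y \<in> lattice_box (a k) m" for i k x y
        using insert.prems(2) that by blast
      show "finite (S \<union> ?B)" using insert.prems by simp
      show "Z \<inter> (S \<union> ?B) = {}" using insert.prems(1)[of j] insert.prems(4) by auto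
      show "int L - int m + 1 \<le> sup_norm (x - y)"
        if "i \<in> T" "x \<in> S \<union> ?B" "y \<in> lattice_box (a i) m" for i x y
        using that insert.prems(2)[of j i x y] insert.prems(6)[of i x y] insert.hyps by blast
    qed
    also have "\<dots> = (\<integral>\<^sup>+ \<omega>. (\<Prod>i\<in>T. ennreal (f i \<omega>)) * indicator (quiet V Z \<inter> D) \<omega> * indicator (?E s) \<omega> \<partial>M)"
      by (intro nn_integral_cong) (auto split: split_indicator)
    finally show ?thesis by (simp add: mult_ac)
  qed
  have "(\<integral>\<^sup>+ \<omega>. ennreal (f j \<omega>) \<partial>M) = (\<integral>\<^sup>+ \<omega>. 1 * ennreal (f j \<omega>) \<partial>M)" by simp
  also have "\<dots> = (\<integral>\<^sup>+ s. (\<integral>\<^sup>+ \<omega>. 1 * indicator (?E s) \<omega> \<partial>M) * indicator {0..} s \<partial>lborel)"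
    by (rule nn_integral_layer_cake) measurable
  also have "\<dots> = (\<integral>\<^sup>+ s. emeasure M (?E s) * indicator {0..} s \<partial>lborel)" by simp
  finally have fj: "(\<integral>\<^sup>+ \<omega>. ennreal (f j \<omega>) \<partial>M) = (\<integral>\<^sup>+ s. emeasure M (?E s) * indicator {0..} s \<partial>lborel)" .
  have mE: "(\<lambda>s. emeasure M (?E s)) \<in> borel_measurable lborel"
  proof -
    have "(\<lambda>s. \<integral>\<^sup>+ \<omega>. (if s < f j \<omega> then 1 else 0) \<partial>M) \<in> borel_measurable lborel" by measurable
    moreover have "(\<integral>\<^sup>+ \<omega>. (if s < f j \<omega> then 1 else 0) \<partial>M) = emeasure M (?E s)" for s
    proof -
      have "(\<integral>\<^sup>+ \<omega>. (if s < f j \<omega> then 1 else 0) \<partial>M) = (\<integral>\<^sup>+ \<omega>. indicator (?E s) \<omega> \<partial>M)"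
        by (intro nn_integral_cong) (auto split: split_indicator)
      then show ?thesis by simp
    qed
    ultimately show ?thesis by simp
  qed
  have "ennreal (\<alpha> V ^ card Z) * (\<Prod>i\<in>insert j T. ennreal (exp (- c m)) * (\<integral>\<^sup>+ \<omega>. ennreal (f i \<omega>) \<partial>M)) * emeasure M D
     = ?q * (ennreal (exp (- c m)) * emeasure M D) * (\<integral>\<^sup>+ \<omega>. ennreal (f j \<omega>) \<partial>M)"
    using insert.hyps by (simp add: mult_ac)
  also have "\<dots> = (\<integral>\<^sup>+ s. ?q * (ennreal (exp (- c m)) * emeasure M D) * (emeasure M (?E s) * indicator {0..} s) \<partial>lborel)"
    unfolding fj using mE by (intro nn_integral_cmult[symmetric]) measurable
  also have "\<dots> \<le> (\<integral>\<^sup>+ s. (\<integral>\<^sup>+ \<omega>. ((\<Prod>i\<in>T. ennreal (f i \<omega>)) * indicator (quiet V Z \<inter> D) \<omega>) * indicator (?E s) \<omega> \<partial>M) * indicator {0..} s \<partial>lborel)"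
    by (intro nn_integral_mono) (use step in \<open>auto split: split_indicator simp: mult_ac\<close>)
  also have "\<dots> = (\<integral>\<^sup>+ \<omega>. ((\<Prod>i\<in>T. ennreal (f i \<omega>)) * indicator (quiet V Z \<inter> D) \<omega>) * ennreal (f j \<omega>) \<partial>M)"
    by (rule nn_integral_layer_cake[symmetric]) measurable
  also have "\<dots> = (\<integral>\<^sup>+ \<omega>. (\<Prod>i\<in>insert j T. ennreal (f i \<omega>)) * indicator (quiet V Z \<inter> D) \<omega> \<partial>M)"
    using insert.hyps by (simp add: mult_ac)
  finally show ?case .
qed

section \<open>Exponentially tilted laws of the mean\<close>

definition weight :: "('y \<Rightarrow> real) \<Rightarrow> nat \<Rightarrow> 'w \<Rightarrow> real" where
  "weight \<phi> n \<omega> = exp (real (n ^ CARD('d)) * \<phi> (field_mean (lattice_box 0 n) (\<eta> \<omega>)))"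

text \<open>The tilt is not normalised: its total mass is the exponential moment behind the
  pressure, possibly infinite, and for \<open>\<phi> = 0\<close> it is the law of the mean. Without
  a normalising factor the masses of the blocks simply multiply.\<close>

definition tilted :: "('y \<Rightarrow> real) \<Rightarrow> nat \<Rightarrow> 'y measure" where
  "tilted \<phi> n = distr (density M (\<lambda>\<omega>. ennreal (weight \<phi> n \<omega>))) borel (\<lambda>\<omega>. field_mean (lattice_box 0 n) (\<eta> \<omega>))"

lemma sets_tilted [simp, measurable_cong]: "sets (tilted \<phi> n) = sets borel"
  by (simp add: tilted_def)

lemma dual_meas:
  assumes "\<phi> \<in> topological_dual"
  shows "\<phi> \<in> borel_measurable (borel :: 'y measure)"
  using assms unfolding topological_dual_def by (auto intro: borel_measurable_continuous_onI)

lemma weight_meas: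
  assumes "\<phi> \<in> topological_dual"
  shows "weight \<phi> n \<in> borel_measurable M"
proof -
  note [measurable] = dual_meas[OF assms]
  show ?thesis unfolding weight_def by measurable
qed

lemma emeasure_tilted:
  assumes "\<phi> \<in> topological_dual" and A: "A \<in> sets borel"
  shows "emeasure (tilted \<phi> n) A =
    (\<integral>\<^sup>+ \<omega>. ennreal (weight \<phi> n \<omega>) * indicator A (field_mean (lattice_box 0 n) (\<eta> \<omega>)) \<partial>M)"
proof -
  note [measurable] = weight_meas[OF assms(1)] A
  have "emeasure (tilted \<phi> n) A = emeasure (density M (\<lambda>\<omega>. ennreal (weight \<phi> n \<omega>)))
      ((\<lambda>\<omega>. field_mean (lattice_box 0 n) (\<eta> \<omega>)) -` A \<inter> space M)"
    unfolding tilted_def by (subst emeasure_distr) (auto simp: A)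
  also have "\<dots> = (\<integral>\<^sup>+ \<omega>. ennreal (weight \<phi> n \<omega>) *
      indicator ((\<lambda>\<omega>. field_mean (lattice_box 0 n) (\<eta> \<omega>)) -` A \<inter> space M) \<omega> \<partial>M)"
    by (rule emeasure_density) measurable
  also have "\<dots> = (\<integral>\<^sup>+ \<omega>. ennreal (weight \<phi> n \<omega>) * indicator A (field_mean (lattice_box 0 n) (\<eta> \<omega>)) \<partial>M)"
    by (intro nn_integral_cong) (auto split: split_indicator)
  finally show ?thesis .
qed

lemma zero_dual: "(\<lambda>_. 0) \<in> topological_dual"
  by (simp add: topological_dual_def linear_iff)

lemma emeasure_tilted_0:
  assumes "A \<in> sets borel"
  shows "emeasure (tilted (\<lambda>_. 0) n) A = emeasure M {\<omega>\<in>space M. field_mean (lattice_box 0 n) (\<eta> \<omega>) \<in> A}"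
proof -
  note [measurable] = assms
  have "emeasure (tilted (\<lambda>_. 0) n) A = (\<integral>\<^sup>+ \<omega>. indicator {\<omega>\<in>space M. field_mean (lattice_box 0 n) (\<eta> \<omega>) \<in> A} \<omega> \<partial>M)"
    unfolding emeasure_tilted[OF zero_dual assms] weight_def
    by (intro nn_integral_cong) (auto split: split_indicator)
  then show ?thesis by simp
qed

lemma field_mean_translate:
  "field_mean (lattice_box (a :: int ^ 'd) m) \<xi> = field_mean (lattice_box 0 m) (\<lambda>z. \<xi> (z + a))"
proof -
  have "lattice_box a m = (\<lambda>z. z + a) ` lattice_box 0 m"
    by (auto simp: lattice_box_def image_image add.commute)
  then have "(\<Sum>z\<in>lattice_box a m. \<xi> z) = (\<Sum>z\<in>lattice_box 0 m. \<xi> (z + a))"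
    by (simp add: sum.reindex)
  then show ?thesis by (simp add: field_mean_def card_lattice_box)
qed

lemma nn_integral_mean_translate:
  fixes h :: "'y \<Rightarrow> ennreal"
  assumes "h \<in> borel_measurable borel" and a: "\<And>i. int l dvd a $ i"
  shows "(\<integral>\<^sup>+ \<omega>. h (field_mean (lattice_box a m) (\<eta> \<omega>)) \<partial>M) = (\<integral>\<^sup>+ \<omega>. h (field_mean (lattice_box 0 m) (\<eta> \<omega>)) \<partial>M)"
proof -
  let ?P = "\<Pi>\<^sub>M z\<in>UNIV. (borel :: 'y measure)"
  have hm: "(\<lambda>\<xi>. h (field_mean (lattice_box 0 m) \<xi>)) \<in> borel_measurable ?P"
    by (rule measurable_compose[OF measurable_field_mean assms(1)])
  have tm: "(\<lambda>\<omega> z. \<eta> \<omega> (z + a)) \<in> M \<rightarrow>\<^sub>M ?P"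
  proof (rule measurable_PiM_single')
    show "(\<lambda>\<omega>. \<eta> \<omega> (z + a)) \<in> borel_measurable M" for z
      using measurable_compose[OF field_meas measurable_component_singleton[of "z + a"]] by simp
  qed simp
  have "(\<integral>\<^sup>+ \<omega>. h (field_mean (lattice_box a m) (\<eta> \<omega>)) \<partial>M)
      = (\<integral>\<^sup>+ \<omega>. h (field_mean (lattice_box 0 m) (\<lambda>z. \<eta> \<omega> (z + a))) \<partial>M)"
    by (simp only: field_mean_translate[of a])
  also have "\<dots> = (\<integral>\<^sup>+ \<xi>. h (field_mean (lattice_box 0 m) \<xi>) \<partial>distr M ?P (\<lambda>\<omega> z. \<eta> \<omega> (z + a)))"
    by (rule nn_integral_distr[OF tm, symmetric]) (use hm in simp)
  also have "distr M ?P (\<lambda>\<omega> z. \<eta> \<omega> (z + a)) = distr M ?P \<eta>"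
    using invariant a unfolding R_invariant_def by blast
  also have "(\<integral>\<^sup>+ \<xi>. h (field_mean (lattice_box 0 m) \<xi>) \<partial>distr M ?P \<eta>)
      = (\<integral>\<^sup>+ \<omega>. h (field_mean (lattice_box 0 m) (\<eta> \<omega>)) \<partial>M)"
    by (rule nn_integral_distr[OF field_meas]) (use hm in simp)
  finally show ?thesis .
qed

text \<open>Prescriptions for the block means multiply up to \<open>exp (- c m)\<close> per block.
  Each of the \<open>r\<close> corridor sites costs a factor \<open>\<alpha> V\<close> in
  probability and, because \<open>\<phi>\<close> is at most 1 in absolute value on \<open>W\<close>,
  at most \<open>t V\<close> in the exponent. Sets and rates may differ between blocks, which
  concavity of the entropy needs.\<close>

lemma tilted_block_lower_bound:
  fixes U :: "nat \<Rightarrow> 'y set" and \<beta> :: "nat \<Rightarrow> real"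
  assumes \<phi>: "\<phi> \<in> topological_dual" and W: "disk W" "\<And>w. w \<in> W \<Longrightarrow> \<bar>\<phi> w\<bar> \<le> 1"
    and V: "V \<in> C0" "V \<subseteq> W"
    and m: "1 \<le> m" "real m + g m \<le> real L" "m \<le> L" and L: "l dvd L" and n: "1 \<le> n"
    and K: "K = (n div L) ^ CARD('d)"
    and U: "\<And>k. k < K \<Longrightarrow> open (U k)" "\<And>k. k < K \<Longrightarrow> convex (U k)"
    and \<beta>: "\<And>k. k < K \<Longrightarrow> ennreal (exp (real (m ^ CARD('d)) * \<beta> k)) \<le> emeasure (tilted \<phi> m) (U k)"
    and A: "A \<in> sets borel"
    and r: "r = real (n ^ CARD('d)) - real (K * m ^ CARD('d))"
    and incl: "\<And>u w. (\<And>k. k < K \<Longrightarrow> u k \<in> U k) \<Longrightarrow> w \<in> dilate (r / real (n ^ CARD('d)) * t V) W \<Longrightarrow>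
      (real (m ^ CARD('d)) / real (n ^ CARD('d))) *\<^sub>R (\<Sum>k<K. u k) + w \<in> A"
  shows "ennreal (exp (real (m ^ CARD('d)) * (\<Sum>k<K. \<beta> k) - real K * c m - r * (t V - ln (\<alpha> V))))
     \<le> emeasure (tilted \<phi> n) A"
proof -
  interpret \<phi>: linear \<phi> using \<phi> by (simp add: topological_dual_def)
  let ?M = "real (m ^ CARD('d))" and ?N = "real (n ^ CARD('d))"
  note tV = t_pos[OF V(1)] and aV = alpha_pos[OF V(1)]
  have Npos: "0 < ?N" and Mpos: "0 < ?M" using n m by auto
  obtain a :: "nat \<Rightarrow> int ^ 'd" where a:
    "\<And>k i. k < K \<Longrightarrow> int L dvd a k $ i"
    "\<And>k. k < K \<Longrightarrow> lattice_box (a k) m \<subseteq> lattice_box 0 n"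
    "\<And>j k x y. j < K \<Longrightarrow> k < K \<Longrightarrow> j \<noteq> k \<Longrightarrow>
       x \<in> lattice_box (a j) m \<Longrightarrow> y \<in> lattice_box (a k) m \<Longrightarrow> int L - int m + 1 \<le> sup_norm (x - y)"
    unfolding K using separated_blocks_exist[OF m(1,3), of n] by blast
  let ?B = "\<lambda>k. lattice_box (a k) m"
  define Z where "Z = lattice_box 0 n - (\<Union>k<K. ?B k)"
  have disj: "?B j \<inter> ?B k = {}" if "j < K" "k < K" "j \<noteq> k" for j k
  proof (rule ccontr)
    assume "?B j \<inter> ?B k \<noteq> {}"
    then obtain x where "x \<in> ?B j" "x \<in> ?B k" by blast
    then have "int L - int m + 1 \<le> sup_norm (x - x)" using a(3) that by blast
    then show False using m(3) by (simp add: sup_norm_def)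
  qed
  have Zfin: "finite Z" by (simp add: Z_def)
  have "card (\<Union>k<K. ?B k) = K * m ^ CARD('d)"
    by (subst card_UN_disjoint) (use disj in \<open>auto simp: card_lattice_box\<close>)
  moreover have "(\<Union>k<K. ?B k) \<subseteq> lattice_box 0 n" using a(2) by blast
  ultimately have cardZ: "real (card Z) = r"
    unfolding Z_def r by (subst card_Diff_subset)
      (use card_mono[OF finite_lattice_box \<open>(\<Union>k<K. ?B k) \<subseteq> lattice_box 0 n\<close>] in
        \<open>auto simp: card_lattice_box of_nat_diff\<close>)
  \<comment> \<open>\<open>product_decoupling\<close> asks for convex superlevel sets at every
    index, so the family is extended by the whole space beyond \<open>K\<close>.\<close>
  define U' where "U' k = (if k < K then U k else UNIV)" for k
  have U': "open (U' k)" "convex (U' k)" for k using U by (auto simp: U'_def)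
  define F where "F k \<xi> = (exp (?M * \<phi> (field_mean (?B k) \<xi>)) * indicator (U' k) (field_mean (?B k) \<xi>) :: real)" for k \<xi>
  define f where "f k \<omega> = F k (\<eta> \<omega>)" for k \<omega>
  note [measurable] = dual_meas[OF \<phi>]
  have [measurable]: "U' k \<in> sets borel" for k using U' by simp
  have fm: "f k \<in> borel_measurable M" for k unfolding f_def F_def by measurable
  have lev: "convex_event M \<eta> (?B k) {\<omega>\<in>space M. s < f k \<omega>}" if s: "0 \<le> s" for k s
  proof -
    define G where "G = U' k \<inter> {v. s < exp (?M * \<phi> v)}"
    have "open {v. s < exp (?M * \<phi> v)}"
      using \<phi> by (intro open_Collect_less continuous_intros) (auto simp: topological_dual_def)
    then have "open G" using U' by (simp add: G_def open_Int)
    \<comment> \<open>A superlevel set of the exponential of a multiple of \<open>\<phi>\<close>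
      comes from a half-line, and at level 0 it is the whole space.\<close>
    moreover have "convex {v. s < exp (?M * \<phi> v)}"
    proof (cases "s = 0")
      case False
      then have "{v. s < exp (?M * \<phi> v)} = \<phi> -` {ln s / ?M<..}"
      proof -
        have "s < exp (?M * \<phi> v) \<longleftrightarrow> ln s / ?M < \<phi> v" for v
        proof -
          have "s < exp (?M * \<phi> v) \<longleftrightarrow> ln s < ?M * \<phi> v"
            using s False by (metis exp_gt_zero exp_less_cancel_iff exp_ln less_le)
          then show ?thesis using Mpos by (simp add: divide_less_eq mult.commute)
        qed
        then show ?thesis by auto
      qed
      then show ?thesis using convex_linear_vimage[OF \<phi>.linear_axioms] by simp
    qed simp
    then have "convex G" using U' by (simp add: G_def convex_Int)
    moreover have "{\<omega>\<in>space M. s < f k \<omega>} = {\<omega>\<in>space M. field_mean (?B k) (\<eta> \<omega>) \<in> G}"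
      using s by (auto simp: f_def F_def G_def split: split_indicator)
    ultimately show ?thesis using convex_event_mean[of G M \<eta> "?B k"] by simp
  qed
  have int_f: "(\<integral>\<^sup>+ \<omega>. ennreal (f k \<omega>) \<partial>M) = emeasure (tilted \<phi> m) (U k)" if k: "k < K" for k
  proof -
    have dv: "\<And>i. int l dvd a k $ i" using a(1)[OF k] L by (meson dvd_trans int_dvd_int_iff)
    let ?h = "\<lambda>v. ennreal (exp (?M * \<phi> v) * indicator (U' k) v)"
    have "(\<integral>\<^sup>+ \<omega>. ennreal (f k \<omega>) \<partial>M) = (\<integral>\<^sup>+ \<omega>. ?h (field_mean (?B k) (\<eta> \<omega>)) \<partial>M)"
      by (simp add: f_def F_def)
    also have "\<dots> = (\<integral>\<^sup>+ \<omega>. ?h (field_mean (lattice_box 0 m) (\<eta> \<omega>)) \<partial>M)"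
      by (rule nn_integral_mean_translate[OF _ dv]) measurable
    also have "\<dots> = emeasure (tilted \<phi> m) (U k)"
      using k U by (subst emeasure_tilted[OF \<phi>])
        (auto simp: weight_def U'_def ennreal_mult split: split_indicator intro!: nn_integral_cong)
    finally show ?thesis .
  qed
  let ?Q = "quiet V Z"
  have "?Q \<inter> space M = ?Q" by (auto simp: quiet_def)
  have "ennreal (\<alpha> V ^ card Z) * (\<Prod>j<K. ennreal (exp (- c m)) * (\<integral>\<^sup>+ \<omega>. ennreal (f j \<omega>) \<partial>M)) * emeasure M (space M)
    \<le> (\<integral>\<^sup>+ \<omega>. (\<Prod>j<K. ennreal (f j \<omega>)) * indicator (?Q \<inter> space M) \<omega> \<partial>M)"
    by (rule product_decoupling[OF V(1) m(1,2) Zfin fm lev, where S = "{}"])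
      (use a(3) convex_event_space in \<open>auto simp: Z_def\<close>)
  then have dec: "ennreal (\<alpha> V ^ card Z) * (\<Prod>j<K. ennreal (exp (- c m)) * (\<integral>\<^sup>+ \<omega>. ennreal (f j \<omega>) \<partial>M))
    \<le> (\<integral>\<^sup>+ \<omega>. (\<Prod>j<K. ennreal (f j \<omega>)) * indicator ?Q \<omega> \<partial>M)"
    using \<open>?Q \<inter> space M = ?Q\<close> by (simp add: emeasure_space_1)
  have point: "(\<Prod>j<K. ennreal (f j \<omega>)) * indicator ?Q \<omega> \<le>
     ennreal (exp (t V * r)) * (ennreal (weight \<phi> n \<omega>) * indicator A (field_mean (lattice_box 0 n) (\<eta> \<omega>)))"
    if "\<omega> \<in> space M" for \<omega>
  \<comment> \<open>The left side vanishes unless the corridors are quiet and all block means lie in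
    their sets.\<close>
  proof (cases "\<omega> \<in> ?Q \<and> (\<forall>k<K. field_mean (?B k) (\<eta> \<omega>) \<in> U k)")
    case False
    have "(\<Prod>j<K. ennreal (f j \<omega>)) * indicator ?Q \<omega> = 0"
    proof (cases "\<omega> \<in> ?Q")
      case True
      then obtain k where "k < K" "f k \<omega> = 0" using False by (auto simp: f_def F_def U'_def)
      then have "(\<Prod>j<K. ennreal (f j \<omega>)) = 0" by (intro prod_zero bexI[of _ k]) auto
      then show ?thesis by simp
    qed simp
    then show ?thesis by (simp only: zero_le)
  next
    case True
    define u where "u k = field_mean (?B k) (\<eta> \<omega>)" for k
    define w where "w = (1 / ?N) *\<^sub>R (\<Sum>z\<in>Z. \<eta> \<omega> z)"
    have sB: "(\<Sum>z\<in>?B k. \<eta> \<omega> z) = ?M *\<^sub>R u k" for k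
      using Mpos by (simp add: u_def field_mean_def card_lattice_box)
    have "(\<Sum>z\<in>lattice_box 0 n. \<eta> \<omega> z) = (\<Sum>z\<in>(\<Union>k<K. ?B k). \<eta> \<omega> z) + (\<Sum>z\<in>Z. \<eta> \<omega> z)"
      unfolding Z_def using \<open>(\<Union>k<K. ?B k) \<subseteq> lattice_box 0 n\<close>
      by (subst sum.subset_diff[OF \<open>(\<Union>k<K. ?B k) \<subseteq> lattice_box 0 n\<close>]) (auto simp: add.commute)
    also have "(\<Sum>z\<in>(\<Union>k<K. ?B k). \<eta> \<omega> z) = (\<Sum>k<K. \<Sum>z\<in>?B k. \<eta> \<omega> z)"
      by (rule sum.UNION_disjoint) (use disj in auto)
    also have "\<dots> = ?M *\<^sub>R (\<Sum>k<K. u k)" by (simp add: sB scaleR_sum_right)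
    finally have mean: "field_mean (lattice_box 0 n) (\<eta> \<omega>) = (?M / ?N) *\<^sub>R (\<Sum>k<K. u k) + w"
      by (simp add: field_mean_def card_lattice_box w_def scaleR_right_distrib)
    have site: "\<eta> \<omega> z \<in> dilate (t V) W" if "z \<in> Z" for z
    proof -
      have "\<eta> \<omega> z \<in> dilate (t V) V" using True that by (auto simp: quiet_def)
      then show ?thesis using V(2) unfolding dilate_def by blast
    qed
    then have sumZ: "(\<Sum>z\<in>Z. \<eta> \<omega> z) \<in> dilate (r * t V) W"
      using dilate_sum[OF W(1) Zfin, of "\<eta> \<omega>" "t V"] tV cardZ by simp
    then have "w \<in> dilate (\<bar>1 / ?N\<bar> * (r * t V)) W" unfolding w_def by (rule dilate_scale[OF W(1)])
    then have "w \<in> dilate (r / ?N * t V) W" by simp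
    then have inA: "field_mean (lattice_box 0 n) (\<eta> \<omega>) \<in> A"
      unfolding mean using True by (intro incl) (auto simp: u_def)
    have r0: "0 \<le> r" using cardZ by linarith
    obtain w' where w': "w' \<in> W" "(\<Sum>z\<in>Z. \<eta> \<omega> z) = (r * t V) *\<^sub>R w'" using sumZ by (auto simp: dilate_def)
    \<comment> \<open>The corridor sum is \<open>r * t V\<close> times a vector of \<open>W\<close>,
      where \<open>\<phi>\<close> is at least -1.\<close>
    have "- (r * t V) \<le> (r * t V) * \<phi> w'"
      using W(2)[OF w'(1)] mult_left_mono[of "-1" "\<phi> w'" "r * t V"] r0 tV by auto
    also have "\<dots> = ?N * \<phi> w" using Npos w' by (simp add: w_def \<phi>.scale)
    finally have "?M * (\<Sum>k<K. \<phi> (u k)) \<le> t V * r + ?N * \<phi> (field_mean (lattice_box 0 n) (\<eta> \<omega>))"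
      unfolding mean using Npos by (simp add: \<phi>.add \<phi>.scale \<phi>.sum algebra_simps)
    then have "exp (?M * (\<Sum>k<K. \<phi> (u k))) \<le> exp (t V * r) * weight \<phi> n \<omega>"
      unfolding weight_def exp_add[symmetric] by simp
    moreover have "(\<Prod>j<K. ennreal (f j \<omega>)) = ennreal (exp (?M * (\<Sum>k<K. \<phi> (u k))))"
    proof -
      have "(\<Prod>j<K. ennreal (f j \<omega>)) = (\<Prod>j<K. ennreal (exp (?M * \<phi> (u j))))"
        using True by (intro prod.cong) (auto simp: f_def F_def U'_def u_def)
      then show ?thesis by (simp add: prod_ennreal exp_sum sum_distrib_left)
    qed
    ultimately show ?thesis
      using True inA by (simp add: weight_def ennreal_mult[symmetric])
  qed
  have "ennreal (exp (?M * (\<Sum>k<K. \<beta> k) - real K * c m + r * ln (\<alpha> V)))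
      = ennreal (\<alpha> V ^ card Z) * (\<Prod>j<K. ennreal (exp (- c m)) * ennreal (exp (?M * \<beta> j)))"
  proof -
    have "(\<Prod>j<K. ennreal (exp (- c m)) * ennreal (exp (?M * \<beta> j))) = ennreal (\<Prod>j<K. exp (?M * \<beta> j - c m))"
      by (subst prod_ennreal[symmetric]) (auto simp: ennreal_mult[symmetric] exp_add[symmetric] intro!: prod.cong)
    also have "(\<Prod>j<K. exp (?M * \<beta> j - c m)) = exp (?M * (\<Sum>k<K. \<beta> k) - real K * c m)"
      by (simp add: exp_sum[symmetric] sum_subtractf sum_distrib_left)
    finally have "(\<Prod>j<K. ennreal (exp (- c m)) * ennreal (exp (?M * \<beta> j))) = ennreal (exp (?M * (\<Sum>k<K. \<beta> k) - real K * c m))" .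
    moreover have "\<alpha> V ^ card Z = exp (r * ln (\<alpha> V))"
      using aV by (simp add: cardZ[symmetric] exp_of_nat_mult)
    ultimately show ?thesis
      by (simp add: ennreal_mult[symmetric] exp_add[symmetric] algebra_simps)
  qed
  also have "\<dots> \<le> ennreal (\<alpha> V ^ card Z) * (\<Prod>j<K. ennreal (exp (- c m)) * (\<integral>\<^sup>+ \<omega>. ennreal (f j \<omega>) \<partial>M))"
    by (intro mult_left_mono prod_mono_ennreal) (use \<beta> int_f in \<open>auto intro!: mult_left_mono\<close>)
  also have "\<dots> \<le> (\<integral>\<^sup>+ \<omega>. (\<Prod>j<K. ennreal (f j \<omega>)) * indicator ?Q \<omega> \<partial>M)" by (rule dec)
  also have "\<dots> \<le> (\<integral>\<^sup>+ \<omega>. ennreal (exp (t V * r)) * (ennreal (weight \<phi> n \<omega>) * indicator A (field_mean (lattice_box 0 n) (\<eta> \<omega>))) \<partial>M)"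
    by (intro nn_integral_mono point)
  also have "\<dots> = ennreal (exp (t V * r)) * emeasure (tilted \<phi> n) A"
  proof -
    note [measurable] = weight_meas[OF \<phi>] A
    show ?thesis unfolding emeasure_tilted[OF \<phi> A] by (intro nn_integral_cmult) measurable
  qed
  finally have "ennreal (exp (- (t V * r))) * ennreal (exp (?M * (\<Sum>k<K. \<beta> k) - real K * c m + r * ln (\<alpha> V)))
     \<le> ennreal (exp (- (t V * r))) * (ennreal (exp (t V * r)) * emeasure (tilted \<phi> n) A)"
    by (rule mult_left_mono) simp
  also have "\<dots> = emeasure (tilted \<phi> n) A"
    by (simp add: mult.assoc[symmetric] ennreal_mult[symmetric] exp_add[symmetric])
  finally show ?thesis
    by (simp add: ennreal_mult[symmetric] exp_add[symmetric] algebra_simps)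
qed

section \<open>Superadditivity of the tilted masses\<close>

text \<open>\<open>K\<close> blocks of side \<open>m\<close> fill up to a fraction \<open>\<epsilon>\<close> a box of side \<open>n\<close>; the block means \<open>u k\<close> may be
  prescribed independently, and \<open>w\<close> is the contribution of the corridors.\<close>

definition combines :: "('y \<Rightarrow> real) \<Rightarrow> 'y set \<Rightarrow> real \<Rightarrow> nat \<Rightarrow> nat \<Rightarrow> nat \<Rightarrow> bool" where
  "combines \<phi> W \<epsilon> m n K \<longleftrightarrow> 1 / \<epsilon> \<le> real K \<and>
       (1 - \<epsilon>) * real (n ^ CARD('d)) \<le> real K * real (m ^ CARD('d)) \<and> real K * real (m ^ CARD('d)) \<le> real (n ^ CARD('d)) \<and>
       (\<forall>U \<beta> A. (\<forall>k<K. open (U k) \<and> convex (U k) \<and>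
            ennreal (exp (real (m ^ CARD('d)) * \<beta> k)) \<le> emeasure (tilted \<phi> m) (U k)) \<longrightarrow>
          A \<in> sets borel \<longrightarrow>
          (\<forall>u w. (\<forall>k<K. u k \<in> U k) \<longrightarrow> w \<in> dilate \<epsilon> W \<longrightarrow>
             (real (m ^ CARD('d)) / real (n ^ CARD('d))) *\<^sub>R (\<Sum>k<K. u k) + w \<in> A) \<longrightarrow>
          ennreal (exp (real (m ^ CARD('d)) * (\<Sum>k<K. \<beta> k) - \<epsilon> * real (n ^ CARD('d)))) \<le> emeasure (tilted \<phi> n) A)"

text \<open>The threshold \<open>m0\<close> is fixed before sets, rates and target are chosen, so
  that a block size can later be picked from an infinite set of good sizes.\<close>

lemma tilted_superadditive:
  assumes \<phi>: "\<phi> \<in> topological_dual" and W: "disk W" "\<And>w. w \<in> W \<Longrightarrow> \<bar>\<phi> w\<bar> \<le> 1"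
    and \<epsilon>: "0 < \<epsilon>" "\<epsilon> < 1"
  obtains m0 where "1 \<le> m0"
    "\<And>m. m0 \<le> m \<Longrightarrow> \<exists>n0\<ge>1. \<forall>n\<ge>n0. \<exists>K. combines \<phi> W \<epsilon> m n K"
proof -
  obtain V where V: "V \<in> C0" "V \<subseteq> W" using base_sub[OF W(1)] by metis
  note tV = t_pos[OF V(1)] and aV = alpha_pos[OF V(1)] alpha_le[OF V(1)]
  \<comment> \<open>Loss per site in units of \<open>e\<close>: 1 from c.a.d.i. and
    \<open>t V - ln (\<alpha> V)\<close> from the corridors. Dividing \<open>\<epsilon>\<close> by
    it makes the whole loss at most \<open>\<epsilon>\<close> and also keeps the corridor part of
    the mean inside \<open>dilate \<epsilon> W\<close>.\<close>
  define q where "q = 1 + t V - ln (\<alpha> V)"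
  have lna: "ln (\<alpha> V) \<le> 0" using aV by simp
  have q: "1 \<le> q" "t V \<le> q" using tV lna by (auto simp: q_def)
  define e where "e = \<epsilon> / q"
  have e: "0 < e" "e < 1" "e \<le> \<epsilon>" "e * q = \<epsilon>" using \<epsilon> q by (auto simp: e_def field_simps)
  have d1: "1 \<le> CARD('d)" by (simp add: Suc_leI)
  obtain m0 where m0: "1 \<le> m0" "\<And>m. m0 \<le> m \<Longrightarrow> \<exists>L. l dvd L \<and> real m + g m \<le> real L \<and> m \<le> L \<and>
     c m \<le> e * real (m ^ CARD('d)) \<and>
     (\<exists>n0. \<forall>n\<ge>n0. (1 - e) * real (n ^ CARD('d)) \<le> real ((n div L) ^ CARD('d) * m ^ CARD('d)) \<and>
        (n div L) ^ CARD('d) * m ^ CARD('d) \<le> n ^ CARD('d) \<and> 1 / e \<le> real ((n div L) ^ CARD('d)))"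
    using block_asymptotics[OF g_nonneg g_lim c_lim l d1 e(1,2)] by blast
  show ?thesis
  proof (rule that[OF m0(1)])
    fix m assume m: "m0 \<le> m"
    obtain L n1 where L: "l dvd L" "real m + g m \<le> real L" "m \<le> L" "c m \<le> e * real (m ^ CARD('d))"
      and n1: "\<And>n. n1 \<le> n \<Longrightarrow> (1 - e) * real (n ^ CARD('d)) \<le> real ((n div L) ^ CARD('d) * m ^ CARD('d)) \<and>
        (n div L) ^ CARD('d) * m ^ CARD('d) \<le> n ^ CARD('d) \<and> 1 / e \<le> real ((n div L) ^ CARD('d))"
      using m0(2)[OF m] by blast
    have m1: "1 \<le> m" using m m0 by simp
    show "\<exists>n0\<ge>1. \<forall>n\<ge>n0. \<exists>K. combines \<phi> W \<epsilon> m n K"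
    proof (rule exI[of _ "max n1 1"], intro conjI allI impI)
      fix n assume n: "max n1 1 \<le> n"
      let ?K = "(n div L) ^ CARD('d)" and ?M = "real (m ^ CARD('d))" and ?N = "real (n ^ CARD('d))"
      have n11: "1 \<le> n" and Npos: "0 < ?N" using n by auto
      have b: "(1 - e) * ?N \<le> real ?K * ?M" "real ?K * ?M \<le> ?N" "1 / e \<le> real ?K"
      proof -
        have "n1 \<le> n" using n by simp
        note n1[OF this]
        then show "(1 - e) * ?N \<le> real ?K * ?M" "1 / e \<le> real ?K" by (auto simp only: of_nat_mult)
        show "real ?K * ?M \<le> ?N" using n1[OF \<open>n1 \<le> n\<close>] by (metis of_nat_le_iff of_nat_mult)
      qed
      define r where "r = ?N - real (?K * m ^ CARD('d))"
      have r: "0 \<le> r" "r \<le> e * ?N" using b by (auto simp: r_def algebra_simps)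
      have 1: "1 / \<epsilon> \<le> 1 / e" using e by (intro divide_left_mono) auto
      have 2: "(1 - \<epsilon>) * ?N \<le> (1 - e) * ?N" using e Npos by (intro mult_right_mono) auto
      have 3: "ennreal (exp (?M * (\<Sum>k<?K. \<beta> k) - \<epsilon> * ?N)) \<le> emeasure (tilted \<phi> n) A"
        if U: "\<forall>k<?K. open (U k) \<and> convex (U k) \<and> ennreal (exp (?M * \<beta> k)) \<le> emeasure (tilted \<phi> m) (U k)"
          and A: "A \<in> sets borel"
          and incl: "\<forall>u w. (\<forall>k<?K. u k \<in> U k) \<longrightarrow> w \<in> dilate \<epsilon> W \<longrightarrow> (?M / ?N) *\<^sub>R (\<Sum>k<?K. u k) + w \<in> A"
        for U \<beta> A
      proof -
        have "r / ?N * t V \<le> e * q"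
          using r q tV e Npos by (intro mult_mono) (auto simp: field_simps)
        then have rt: "0 \<le> r / ?N * t V" "r / ?N * t V \<le> \<epsilon>" using e r tV Npos by auto
        have incl': "(?M / ?N) *\<^sub>R (\<Sum>k<?K. u k) + w \<in> A"
          if "\<And>k. k < ?K \<Longrightarrow> u k \<in> U k" "w \<in> dilate (r / ?N * t V) W" for u w
          using incl that dilate_mono[OF W(1) rt] by blast
        have "ennreal (exp (?M * (\<Sum>k<?K. \<beta> k) - real ?K * c m - r * (t V - ln (\<alpha> V)))) \<le> emeasure (tilted \<phi> n) A"
        proof (rule tilted_block_lower_bound[where U = U and \<beta> = \<beta>, OF \<phi> W V m1 L(2,3,1) n11 refl _ _ _ A r_def])
          show "open (U k)" "convex (U k)" "ennreal (exp (?M * \<beta> k)) \<le> emeasure (tilted \<phi> m) (U k)"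
            if "k < ?K" for k using U that by blast+
        qed (assumption, rule incl')
        moreover have "real ?K * c m + r * (t V - ln (\<alpha> V)) \<le> \<epsilon> * ?N"
        proof -
          have "real ?K * c m \<le> real ?K * (e * ?M)" using L(4) by (intro mult_left_mono) auto
          also have "\<dots> = e * (real ?K * ?M)" by simp
          also have "\<dots> \<le> e * ?N" using b e by (intro mult_left_mono) auto
          finally have 1: "real ?K * c m \<le> e * ?N" .
          have "r * (t V - ln (\<alpha> V)) \<le> (e * ?N) * (t V - ln (\<alpha> V))"
            using r tV lna by (intro mult_right_mono) auto
          with 1 have "real ?K * c m + r * (t V - ln (\<alpha> V)) \<le> (e * q) * ?N"
            by (simp add: q_def algebra_simps)
          then show ?thesis using e by simp
        qed
        then have "ennreal (exp (?M * (\<Sum>k<?K. \<beta> k) - \<epsilon> * ?N))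
           \<le> ennreal (exp (?M * (\<Sum>k<?K. \<beta> k) - real ?K * c m - r * (t V - ln (\<alpha> V))))"
          by (intro ennreal_leI) simp
        ultimately show ?thesis by (rule order_trans[rotated])
      qed
      have "combines \<phi> W \<epsilon> m n ?K"
        unfolding combines_def
      proof (intro conjI)
        show "1 / \<epsilon> \<le> real ?K" "(1 - \<epsilon>) * ?N \<le> real ?K * ?M" "real ?K * ?M \<le> ?N"
          using b 1 2 by linarith+
      qed (intro allI impI, rule 3, assumption+)
      then show "\<exists>K. combines \<phi> W \<epsilon> m n K" ..
    qed simp
  qed
qed

end

section \<open>Concentration points of the tilted laws\<close>

definition shifted :: "'y::real_vector \<Rightarrow> 'y set \<Rightarrow> 'y set" where
  "shifted x W = {v. v - x \<in> W}"

lemma shifted_open_convex: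
  fixes W :: "'y::frechet_space set"
  assumes "disk W"
  shows "open (shifted x W)" "convex (shifted x W)" "x \<in> shifted x W"
proof -
  have eq: "shifted x W = (\<lambda>v. x + 1 *\<^sub>R v) ` W"
    by (subst affine_image_eq) (auto simp: shifted_def)
  show "open (shifted x W)" unfolding eq using assms by (intro open_affine_image) (auto simp: disk_def)
  show "convex (shifted x W)" unfolding eq using assms by (intro convex_affine_image) (auto simp: disk_def)
  show "x \<in> shifted x W" using assms by (simp add: shifted_def disk_def)
qed

lemma exists_shifted_subset:
  fixes O' :: "'y::frechet_space set"
  assumes "open O'" "x \<in> O'" "0 < r"
  obtains W where "disk W" "shifted x (dilate r W) \<subseteq> O'"
proof -
  have "open {v. x + r *\<^sub>R v \<in> O'}" using assms(1) by (rule open_vimage_affine)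
  moreover have "0 \<in> {v. x + r *\<^sub>R v \<in> O'}" using assms by simp
  ultimately obtain W where W: "disk W" "W \<subseteq> {v. x + r *\<^sub>R v \<in> O'}" by (rule exists_disk_subset)
  have "shifted x (dilate r W) \<subseteq> O'"
  proof
    fix v assume "v \<in> shifted x (dilate r W)"
    then obtain w where "w \<in> W" "v - x = r *\<^sub>R w" by (auto simp: shifted_def dilate_def)
    then have "x + r *\<^sub>R w \<in> O'" "v = x + r *\<^sub>R w" using W by (auto simp: algebra_simps)
    then show "v \<in> O'" by simp
  qed
  then show ?thesis using W that by blast
qed

lemma scaled_sum_in_dilate:
  assumes "disk W" "\<And>k. k < K \<Longrightarrow> w k \<in> dilate r W" "0 \<le> r" "0 \<le> s"
  shows "s *\<^sub>R (\<Sum>k<K. w k) \<in> dilate (s * (real K * r)) W"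
proof -
  have "(\<Sum>k<K. w k) \<in> dilate (real (card {..<K}) * r) W"
    by (rule dilate_sum) (use assms in auto)
  from dilate_scale[OF assms(1) this, of s] show ?thesis using assms by simp
qed

text \<open>One small number meets two demands: the loss in the exponent stays below
  \<open>\<delta>\<close>, and a centre scaled by the filled fraction of the box, which lies between
  \<open>1 - e\<close> and 1, moves only by an element of \<open>W\<close>.\<close>

lemma small_scale_ex:
  fixes x :: "'y::frechet_space"
  assumes "disk W" "0 < \<delta>"
  obtains e where "0 < e" "e < 1" "e * \<bar>b\<bar> + e \<le> \<delta>" "\<And>s. \<bar>s\<bar> \<le> e \<Longrightarrow> s *\<^sub>R x \<in> W"
proof -
  obtain e1 where e1: "0 < e1" "\<And>s. \<bar>s\<bar> \<le> e1 \<Longrightarrow> s *\<^sub>R x \<in> W" using disk_absorbs[OF assms(1)] by blast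
  define e where "e = min e1 (min (1/2) (\<delta> / (\<bar>b\<bar> + 1)))"
  have "0 < e" using e1 assms by (simp add: e_def)
  moreover have "e \<le> e1" "e \<le> 1/2" "e \<le> \<delta> / (\<bar>b\<bar> + 1)" unfolding e_def by linarith+
  ultimately have e: "0 < e" "e \<le> e1" "e \<le> 1/2" "e \<le> \<delta> / (\<bar>b\<bar> + 1)" by blast+
  have "e * (\<bar>b\<bar> + 1) \<le> \<delta> / (\<bar>b\<bar> + 1) * (\<bar>b\<bar> + 1)" using e by (intro mult_right_mono) auto
  also have "\<dots> = \<delta>" by (simp add: add_eq_0_iff_both_eq_0)
  finally have "e * \<bar>b\<bar> + e \<le> \<delta>" by (simp add: algebra_simps)
  then show ?thesis using that[of e] e e1 by auto
qed

text \<open>The rate \<open>b\<close> may have either sign, so the volume \<open>\<kappa>\<close>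
  covered by blocks is needed from below if \<open>b\<close> is nonnegative and from above if it is
  negative.\<close>

lemma exponent_bound:
  fixes N :: real
  assumes "(1 - \<epsilon>) * N \<le> \<kappa>" "\<kappa> \<le> N" "0 \<le> N" "0 \<le> \<epsilon>" "\<epsilon> * \<bar>b\<bar> + \<epsilon> \<le> \<delta>"
  shows "N * (b - \<delta>) \<le> \<kappa> * b - \<epsilon> * N"
proof -
  have "\<kappa> * b \<ge> N * b - \<epsilon> * N * \<bar>b\<bar>"
  proof (cases "0 \<le> b")
    case True
    then show ?thesis using mult_right_mono[OF assms(1) True] by (simp add: algebra_simps)
  next
    case False
    then have "N * b \<le> \<kappa> * b" using assms(2) by (intro mult_right_mono_neg) auto
    moreover have "0 \<le> \<epsilon> * N * \<bar>b\<bar>" using assms by simp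
    ultimately show ?thesis by linarith
  qed
  moreover have "N * (\<epsilon> * \<bar>b\<bar> + \<epsilon>) \<le> N * \<delta>" using assms by (intro mult_left_mono)
  ultimately show ?thesis by (simp add: algebra_simps)
qed

context mixing_field
begin

section \<open>Masses above an exponential threshold\<close>

lemma self_le_box_volume: "real n \<le> real (n ^ CARD('d))"
proof -
  have "n \<le> n ^ CARD('d)" by (cases "n = 0") (auto intro: self_le_power)
  then show ?thesis by simp
qed

text \<open>Comparison of an exponential rate with a real number, written without logarithms so that
  the masses 0 and \<infinity> are covered.\<close>

definition heavy :: "('y \<Rightarrow> real) \<Rightarrow> 'y set \<Rightarrow> real \<Rightarrow> nat \<Rightarrow> bool" where
  "heavy \<phi> A b n \<longleftrightarrow> ennreal (exp (real (n ^ CARD('d)) * b)) \<le> emeasure (tilted \<phi> n) A"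

lemma heavy_mono:
  assumes "heavy \<phi> A b n" "A \<subseteq> B" "B \<in> sets borel" "b' \<le> b"
  shows "heavy \<phi> B b' n"
proof -
  have "ennreal (exp (real (n ^ CARD('d)) * b')) \<le> ennreal (exp (real (n ^ CARD('d)) * b))"
    using assms by (intro ennreal_leI) (simp add: mult_left_mono)
  also have "\<dots> \<le> emeasure (tilted \<phi> n) A" using assms by (simp add: heavy_def)
  also have "\<dots> \<le> emeasure (tilted \<phi> n) B" using assms by (intro emeasure_mono) auto
  finally show ?thesis by (simp add: heavy_def)
qed

lemma combinesD:
  assumes "combines \<phi> W \<epsilon> m n K"
    and "\<And>k. k < K \<Longrightarrow> open (U k)" "\<And>k. k < K \<Longrightarrow> convex (U k)" "\<And>k. k < K \<Longrightarrow> heavy \<phi> (U k) (\<beta> k) m"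
    and "A \<in> sets borel"
    and "\<And>u w. (\<And>k. k < K \<Longrightarrow> u k \<in> U k) \<Longrightarrow> w \<in> dilate \<epsilon> W \<Longrightarrow> (real (m ^ CARD('d)) / real (n ^ CARD('d))) *\<^sub>R (\<Sum>k<K. u k) + w \<in> A"
  shows "ennreal (exp (real (m ^ CARD('d)) * (\<Sum>k<K. \<beta> k) - \<epsilon> * real (n ^ CARD('d)))) \<le> emeasure (tilted \<phi> n) A"
  using assms(1)[unfolded combines_def, THEN conjunct2, THEN conjunct2, THEN conjunct2, rule_format, of U \<beta> A]
    assms(2-6) unfolding heavy_def by blast

lemma combines_bounds:
  assumes "combines \<phi> W \<epsilon> m n K"
  shows "1 / \<epsilon> \<le> real K" "(1 - \<epsilon>) * real (n ^ CARD('d)) \<le> real K * real (m ^ CARD('d))" "real K * real (m ^ CARD('d)) \<le> real (n ^ CARD('d))"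
  using assms by (auto simp: combines_def)

text \<open>A single good block size beyond \<open>m0\<close> is copied into every large box. Three
  errors of size \<open>W\<close> arise, from the deviations of the block means, from the corridors
  and from the unfilled part of the box, whence the factor 3.\<close>

lemma heavy_frequently_imp_eventually:
  assumes \<phi>: "\<phi> \<in> topological_dual" and W: "disk W" "\<And>w. w \<in> W \<Longrightarrow> \<bar>\<phi> w\<bar> \<le> 1"
    and freq: "\<exists>\<^sub>F n in sequentially. heavy \<phi> (shifted x W) b n" and \<delta>: "0 < \<delta>"
  shows "\<forall>\<^sub>F n in sequentially. heavy \<phi> (shifted x (dilate 3 W)) (b - \<delta>) n"
proof -
  obtain e where e: "0 < e" "e < 1" "e * \<bar>b\<bar> + e \<le> \<delta>" "\<And>s. \<bar>s\<bar> \<le> e \<Longrightarrow> s *\<^sub>R x \<in> W"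
    using small_scale_ex[OF W(1) \<delta>] by blast
  obtain m0 where m0: "1 \<le> m0" "\<And>m. m0 \<le> m \<Longrightarrow> \<exists>n0\<ge>1. \<forall>n\<ge>n0. \<exists>K. combines \<phi> W e m n K"
    using tilted_superadditive[OF \<phi> W e(1,2)] by blast
  obtain m where m: "m0 \<le> m" "heavy \<phi> (shifted x W) b m" using freq by (auto simp: frequently_sequentially)
  obtain n0 where n0: "1 \<le> n0" "\<And>n. n0 \<le> n \<Longrightarrow> \<exists>K. combines \<phi> W e m n K" using m0(2)[OF m(1)] by blast
  have "heavy \<phi> (shifted x (dilate 3 W)) (b - \<delta>) n" if n: "n0 \<le> n" for n
  proof -
    obtain K where K: "combines \<phi> W e m n K" using n0 n by blast
    note bd = combines_bounds[OF K]
    have N: "0 < real (n ^ CARD('d))" using n n0 by simp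
    define \<theta> where "\<theta> = real (m ^ CARD('d)) / real (n ^ CARD('d)) * real K"
    have \<theta>: "1 - e \<le> \<theta>" "\<theta> \<le> 1" using bd N by (auto simp: \<theta>_def field_simps)
    have "ennreal (exp (real (m ^ CARD('d)) * (\<Sum>k<K. b) - e * real (n ^ CARD('d)))) \<le> emeasure (tilted \<phi> n) (shifted x (dilate 3 W))"
    proof (rule combinesD[OF K, where U = "\<lambda>_. shifted x W"])
      fix u w assume u: "\<And>k. k < K \<Longrightarrow> u k \<in> shifted x W" and w: "w \<in> dilate e W"
      have "(real (m ^ CARD('d)) / real (n ^ CARD('d))) *\<^sub>R (\<Sum>k<K. u k - x) \<in> dilate (real (m ^ CARD('d)) / real (n ^ CARD('d)) * (real K * 1)) W"
        by (rule scaled_sum_in_dilate[OF W(1)]) (use u in \<open>auto simp: shifted_def\<close>)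
      then have 1: "(real (m ^ CARD('d)) / real (n ^ CARD('d))) *\<^sub>R (\<Sum>k<K. u k - x) \<in> dilate 1 W"
        using dilate_mono[OF W(1), of \<theta> 1] \<theta> e by (auto simp: \<theta>_def)
      have 2: "w \<in> dilate 1 W" using w dilate_mono[OF W(1), of e 1] e by auto
      have 3: "(\<theta> - 1) *\<^sub>R x \<in> dilate 1 W" using e(4)[of "\<theta> - 1"] \<theta> by simp
      have "(real (m ^ CARD('d)) / real (n ^ CARD('d))) *\<^sub>R (\<Sum>k<K. u k - x) + w + (\<theta> - 1) *\<^sub>R x \<in> dilate (1 + 1 + 1) W"
        by (intro dilate_add[OF W(1)] 1 2 3) auto
      also have "(real (m ^ CARD('d)) / real (n ^ CARD('d))) *\<^sub>R (\<Sum>k<K. u k - x) + w + (\<theta> - 1) *\<^sub>R x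
          = (real (m ^ CARD('d)) / real (n ^ CARD('d))) *\<^sub>R (\<Sum>k<K. u k) + w - x"
        by (simp add: sum_subtractf sum_constant_scaleR \<theta>_def algebra_simps)
      finally show "(real (m ^ CARD('d)) / real (n ^ CARD('d))) *\<^sub>R (\<Sum>k<K. u k) + w \<in> shifted x (dilate 3 W)" by (simp add: shifted_def)
    qed (use m shifted_open_convex[OF W(1)] shifted_open_convex[OF disk_dilate[OF W(1), of 3]] in auto)
    moreover have "real (n ^ CARD('d)) * (b - \<delta>) \<le> (real K * real (m ^ CARD('d))) * b - e * real (n ^ CARD('d))"
      by (rule exponent_bound) (use bd N e in auto)
    then have "ennreal (exp (real (n ^ CARD('d)) * (b - \<delta>))) \<le> ennreal (exp (real (m ^ CARD('d)) * (\<Sum>k<K. b) - e * real (n ^ CARD('d))))"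
      by (intro ennreal_leI) (simp add: mult_ac)
    ultimately show ?thesis unfolding heavy_def by (rule order_trans[rotated])
  qed
  then show ?thesis by (auto simp: eventually_sequentially)
qed

text \<open>The finite set \<open>F\<close> carrying most of the mass depends on the block
  size, which in turn depends on \<open>W'\<close>; that is why the limit point below has to be constructed by
  successive approximations instead of inside one fixed compact set.\<close>

lemma heavy_finite_approx:
  assumes W0: "disk W0" and W': "disk W'" and h: "heavy \<phi> (shifted x W0) b m" and b': "b' < b" and m: "1 \<le> m"
  obtains F where "finite F" "F \<noteq> {}" "F \<subseteq> shifted x W0"
    "open (\<Union>f\<in>convex hull F. shifted f W')" "convex (\<Union>f\<in>convex hull F. shifted f W')"
    "heavy \<phi> (\<Union>f\<in>convex hull F. shifted f W') b' m"
proof -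
  \<comment> \<open>Decoupling requires convex sets, and a union of neighbourhoods of finitely many
    points need not be convex; taking the hull of the points repairs this.\<close>
  let ?U = "\<lambda>F. \<Union>f\<in>convex hull F. shifted f W'"
  have op: "open (?U F)" for F using shifted_open_convex[OF W'] by (intro open_UN) auto
  have cv: "convex (?U F)" for F
  proof (rule convexI)
    fix p q and u v :: real assume "p \<in> ?U F" "q \<in> ?U F" and uv: "0 \<le> u" "0 \<le> v" "u + v = 1"
    then obtain f h where f: "f \<in> convex hull F" "p - f \<in> W'" and h: "h \<in> convex hull F" "q - h \<in> W'"
      by (auto simp: shifted_def)
    have "u *\<^sub>R f + v *\<^sub>R h \<in> convex hull F" using f h uv by (intro convexD[OF convex_convex_hull])
    moreover have "u *\<^sub>R (p - f) + v *\<^sub>R (q - h) \<in> W'" using f h uv W' by (intro convexD) (auto simp: disk_def)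
    then have "u *\<^sub>R p + v *\<^sub>R q \<in> shifted (u *\<^sub>R f + v *\<^sub>R h) W'" by (simp add: shifted_def algebra_simps)
    ultimately show "u *\<^sub>R p + v *\<^sub>R q \<in> ?U F" by blast
  qed
  \<comment> \<open>Second countability: countably many translates already cover
    \<open>shifted x W0\<close>.\<close>
  have "open S" if "S \<in> (\<lambda>f. shifted f W') ` shifted x W0" for S using that shifted_open_convex(1)[OF W'] by auto
  then obtain \<F> where "\<F> \<subseteq> (\<lambda>f. shifted f W') ` shifted x W0" "countable \<F>" "\<Union>\<F> = \<Union>((\<lambda>f. shifted f W') ` shifted x W0)"
    using Lindelof[of "(\<lambda>f. shifted f W') ` shifted x W0"] by blast
  then obtain C where C: "C \<subseteq> shifted x W0" "countable C" "(\<Union>f\<in>C. shifted f W') = (\<Union>f\<in>shifted x W0. shifted f W')"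
    by (metis countable_subset_image)
  have sub: "shifted x W0 \<subseteq> (\<Union>f\<in>C. shifted f W')"
    unfolding C(3) using shifted_open_convex(3)[OF W'] by blast
  then have Cne: "C \<noteq> {}" using shifted_open_convex(3)[OF W0] by blast
  define F where "F j = from_nat_into C ` {..j}" for j :: nat
  have FC: "F j \<subseteq> C" for j using from_nat_into[OF Cne] by (auto simp: F_def)
  have inc: "incseq (\<lambda>j. ?U (F j))"
  proof (rule incseq_SucI)
    fix j
    have "convex hull F j \<subseteq> convex hull F (Suc j)" by (intro hull_mono) (auto simp: F_def)
    then show "?U (F j) \<subseteq> ?U (F (Suc j))" by blast
  qed
  have cover: "shifted x W0 \<subseteq> (\<Union>j. ?U (F j))"
  proof
    fix v assume "v \<in> shifted x W0"
    then obtain f where "f \<in> C" "v \<in> shifted f W'" using sub by blast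
    moreover obtain j where "f = from_nat_into C j"
      using from_nat_into_surj[OF C(2) \<open>f \<in> C\<close>] by metis
    then have "f \<in> convex hull F j" by (intro hull_inc) (auto simp: F_def)
    ultimately show "v \<in> (\<Union>j. ?U (F j))" by blast
  qed
  have meas: "?U (F j) \<in> sets (tilted \<phi> m)" for j using op by simp
  \<comment> \<open>The strict gap \<open>b' < b\<close> lets a finite stage of the increasing union
    already carry enough mass.\<close>
  have "0 < real (m ^ CARD('d))" using m by simp
  then have "ennreal (exp (real (m ^ CARD('d)) * b')) < ennreal (exp (real (m ^ CARD('d)) * b))" using b' by (simp add: ennreal_less_iff)
  also have "\<dots> \<le> emeasure (tilted \<phi> m) (shifted x W0)" using h by (simp add: heavy_def)
  also have "\<dots> \<le> emeasure (tilted \<phi> m) (\<Union>j. ?U (F j))"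
    using cover op by (intro emeasure_mono) (auto intro!: open_UN)
  also have "\<dots> = (SUP j. emeasure (tilted \<phi> m) (?U (F j)))"
    by (rule SUP_emeasure_incseq[symmetric]) (use meas inc in auto)
  finally obtain j where "ennreal (exp (real (m ^ CARD('d)) * b')) < emeasure (tilted \<phi> m) (?U (F j))"
    by (auto simp: less_SUP_iff)
  then have "heavy \<phi> (?U (F j)) b' m" by (simp add: heavy_def)
  moreover have "finite (F j)" "F j \<noteq> {}" "F j \<subseteq> shifted x W0" using FC C(1) by (auto simp: F_def)
  ultimately show ?thesis using that op cv by blast
qed

text \<open>Block means close to a compact hull force the mean over the large box close to a
  rescaled point of that hull, and a finite net then contains a centre that is heavy infinitely
  often. The size of the net is a factor independent of \<open>n\<close> and disappears on the
  exponential scale.\<close>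

lemma heavy_localise:
  assumes \<phi>: "\<phi> \<in> topological_dual" and W0: "disk W0"
    and W': "disk W'" "W' \<subseteq> W0" "\<And>w. w \<in> W' \<Longrightarrow> \<bar>\<phi> w\<bar> \<le> 1"
    and freq: "\<exists>\<^sub>F n in sequentially. heavy \<phi> (shifted x W0) b n" and \<delta>: "0 < \<delta>"
  obtains x' where "x' - x \<in> dilate 3 W0" "\<exists>\<^sub>F n in sequentially. heavy \<phi> (shifted x' (dilate 3 W')) (b - \<delta>) n"
proof -
  \<comment> \<open>The loss \<open>\<delta>\<close> is split into thirds: passing to finitely many
    points, filling the large box, and the pigeonhole step.\<close>
  define b' where "b' = b - \<delta> / 3"
  have \<delta>3: "0 < \<delta> / 3" using \<delta> by simp
  obtain e where e: "0 < e" "e < 1" "e * \<bar>b'\<bar> + e \<le> \<delta> / 3" "\<And>s. \<bar>s\<bar> \<le> e \<Longrightarrow> s *\<^sub>R x \<in> W'"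
    using small_scale_ex[OF W'(1) \<delta>3] by blast
  obtain m0 where m0: "1 \<le> m0" "\<And>m. m0 \<le> m \<Longrightarrow> \<exists>n0\<ge>1. \<forall>n\<ge>n0. \<exists>K. combines \<phi> W' e m n K"
    using tilted_superadditive[OF \<phi> W'(1,3) e(1,2)] by blast
  obtain m where m: "m0 \<le> m" "heavy \<phi> (shifted x W0) b m" using freq by (auto simp: frequently_sequentially)
  obtain n0 where n0: "1 \<le> n0" "\<And>n. n0 \<le> n \<Longrightarrow> \<exists>K. combines \<phi> W' e m n K" using m0(2)[OF m(1)] by blast
  have m1: "1 \<le> m" using m m0 by simp
  have b'b: "b' < b" using \<delta> by (simp add: b'_def)
  obtain F where F: "finite F" "F \<noteq> {}" "F \<subseteq> shifted x W0"
    "open (\<Union>f\<in>convex hull F. shifted f W')" "convex (\<Union>f\<in>convex hull F. shifted f W')"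
    "heavy \<phi> (\<Union>f\<in>convex hull F. shifted f W') b' m"
    using heavy_finite_approx[OF W0 W'(1) m(2) b'b m1] by blast
  let ?U = "\<Union>f\<in>convex hull F. shifted f W'"
  have hullF: "convex hull F \<subseteq> shifted x W0" using F shifted_open_convex[OF W0] by (intro hull_minimal) auto
  \<comment> \<open>The origin is added because the blocks fill only a fraction
    \<open>\<theta>\<close> of the box, so that the point to approximate is
    \<open>\<theta> *\<^sub>R h\<close>, between 0 and \<open>h\<close>.\<close>
  obtain T where T: "finite T" "\<And>v. v \<in> convex hull (insert 0 F) \<Longrightarrow> \<exists>c\<in>T. v - c \<in> W'"
    using convex_hull_finite_totally_bounded[of "insert 0 F" W'] F(1) W'(1) by auto
  \<comment> \<open>Only net points near \<open>x\<close> are kept. The bound 3 adds up the mesh of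
    the net, the extent of \<open>W0\<close> and the filling error.\<close>
  define I where "I = {c \<in> T. c - x \<in> dilate 3 W0}"
  let ?A = "\<Union>c\<in>I. shifted c (dilate 3 W')"
  have Ifin: "finite I" using T by (simp add: I_def)
  have nbm: "shifted c (dilate 3 W') \<in> sets borel" for c
    using shifted_open_convex(1)[OF disk_dilate[OF W'(1), of 3]] by simp
  have Am: "?A \<in> sets borel" using Ifin nbm by (intro sets.finite_UN) auto
  have big: "heavy \<phi> ?A (b' - \<delta> / 3) n" if n: "n0 \<le> n" for n
  proof -
    obtain K where K: "combines \<phi> W' e m n K" using n0 n by blast
    note bd = combines_bounds[OF K]
    have N: "0 < real (n ^ CARD('d))" using n n0 by simp
    have "1 / e > 0" using e by simp
    then have Kpos: "0 < real K" using bd(1) by linarith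
    define \<theta> where "\<theta> = real (m ^ CARD('d)) / real (n ^ CARD('d)) * real K"
    have \<theta>: "1 - e \<le> \<theta>" "\<theta> \<le> 1" using bd N by (auto simp: \<theta>_def field_simps)
    have "ennreal (exp (real (m ^ CARD('d)) * (\<Sum>k<K. b') - e * real (n ^ CARD('d)))) \<le> emeasure (tilted \<phi> n) ?A"
    proof (rule combinesD[OF K, where U = "\<lambda>_. ?U"])
      fix u w assume u: "\<And>k. k < K \<Longrightarrow> u k \<in> ?U" and w: "w \<in> dilate e W'"
      have "\<forall>k. \<exists>f. k < K \<longrightarrow> f \<in> convex hull F \<and> u k - f \<in> W'" using u by (fastforce simp: shifted_def)
      then obtain f where f: "\<And>k. k < K \<Longrightarrow> f k \<in> convex hull F" "\<And>k. k < K \<Longrightarrow> u k - f k \<in> W'" by metis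
      define h where "h = (\<Sum>k<K. (1 / real K) *\<^sub>R f k)"
      have h: "h \<in> convex hull F"
        unfolding h_def by (rule convex_sum[OF _ convex_convex_hull]) (use f Kpos in auto)
      have \<theta>h: "\<theta> *\<^sub>R h = (real (m ^ CARD('d)) / real (n ^ CARD('d))) *\<^sub>R (\<Sum>k<K. f k)"
        using Kpos by (simp add: h_def \<theta>_def scaleR_sum_right)
      have "h \<in> convex hull (insert 0 F)" using h hull_mono[of F "insert 0 F"] by blast
      moreover have "0 \<in> convex hull (insert 0 F)" by (simp add: hull_inc)
      ultimately have "\<theta> *\<^sub>R h + (1 - \<theta>) *\<^sub>R 0 \<in> convex hull (insert 0 F)"
        using \<theta> e by (intro convexD[OF convex_convex_hull]) auto
      then obtain c where c: "c \<in> T" "\<theta> *\<^sub>R h - c \<in> W'" using T(2) by force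
      have "- (\<theta> *\<^sub>R h - c) \<in> W'" using c W'(1) unfolding disk_def by blast
      then have 1: "c - \<theta> *\<^sub>R h \<in> dilate 1 W0" using W'(2) by auto
      have "\<theta> *\<^sub>R (h - x) \<in> dilate (\<bar>\<theta>\<bar> * 1) W0"
        using h hullF by (intro dilate_scale[OF W0]) (auto simp: shifted_def)
      then have 2: "\<theta> *\<^sub>R (h - x) \<in> dilate 1 W0" using dilate_mono[OF W0, of "\<bar>\<theta>\<bar>" 1] \<theta> e by auto
      have 3: "(\<theta> - 1) *\<^sub>R x \<in> dilate 1 W0" using e(4)[of "\<theta> - 1"] \<theta> W'(2) by auto
      have "(c - \<theta> *\<^sub>R h) + \<theta> *\<^sub>R (h - x) + (\<theta> - 1) *\<^sub>R x \<in> dilate (1 + 1 + 1) W0"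
        by (intro dilate_add[OF W0] 1 2 3) auto
      then have "c \<in> I" using c by (simp add: I_def algebra_simps)
      have "(real (m ^ CARD('d)) / real (n ^ CARD('d))) *\<^sub>R (\<Sum>k<K. u k - f k) \<in> dilate (real (m ^ CARD('d)) / real (n ^ CARD('d)) * (real K * 1)) W'"
        by (rule scaled_sum_in_dilate[OF W'(1)]) (use f in auto)
      then have 4: "(real (m ^ CARD('d)) / real (n ^ CARD('d))) *\<^sub>R (\<Sum>k<K. u k - f k) \<in> dilate 1 W'"
        using dilate_mono[OF W'(1), of \<theta> 1] \<theta> e by (auto simp: \<theta>_def)
      have 5: "w \<in> dilate 1 W'" using w dilate_mono[OF W'(1), of e 1] e by auto
      have 6: "\<theta> *\<^sub>R h - c \<in> dilate 1 W'" using c by simp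
      have "(real (m ^ CARD('d)) / real (n ^ CARD('d))) *\<^sub>R (\<Sum>k<K. u k - f k) + w + (\<theta> *\<^sub>R h - c) \<in> dilate (1 + 1 + 1) W'"
        by (intro dilate_add[OF W'(1)] 4 5 6) auto
      also have "(real (m ^ CARD('d)) / real (n ^ CARD('d))) *\<^sub>R (\<Sum>k<K. u k - f k) + w + (\<theta> *\<^sub>R h - c)
          = (real (m ^ CARD('d)) / real (n ^ CARD('d))) *\<^sub>R (\<Sum>k<K. u k) + w - c"
        unfolding \<theta>h by (simp add: sum_subtractf algebra_simps)
      finally show "(real (m ^ CARD('d)) / real (n ^ CARD('d))) *\<^sub>R (\<Sum>k<K. u k) + w \<in> ?A" using \<open>c \<in> I\<close> by (auto simp: shifted_def)
    qed (use F Am in auto)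
    moreover have "real (n ^ CARD('d)) * (b' - \<delta> / 3) \<le> (real K * real (m ^ CARD('d))) * b' - e * real (n ^ CARD('d))"
      by (rule exponent_bound) (use bd N e in auto)
    then have "ennreal (exp (real (n ^ CARD('d)) * (b' - \<delta> / 3))) \<le> ennreal (exp (real (m ^ CARD('d)) * (\<Sum>k<K. b') - e * real (n ^ CARD('d))))"
      by (intro ennreal_leI) (simp add: mult_ac)
    ultimately show ?thesis unfolding heavy_def by (rule order_trans[rotated])
  qed
  \<comment> \<open>Beyond \<open>n1\<close> the exponential of \<open>\<delta> / 3\<close> times
    the volume exceeds the size of the net, by \<open>exp s \<ge> 1 + s\<close>.\<close>
  obtain n1 :: nat where n1: "real (card T) / (\<delta> / 3) < real n1" using reals_Archimedean2 by blast
  have pigeon: "\<exists>c\<in>I. heavy \<phi> (shifted c (dilate 3 W')) (b - \<delta>) n" if n: "max n0 n1 \<le> n" for n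
  proof (rule ccontr)
    assume "\<not> ?thesis"
    then have small: "emeasure (tilted \<phi> n) (shifted c (dilate 3 W')) \<le> ennreal (exp (real (n ^ CARD('d)) * (b - \<delta>)))" if "c \<in> I" for c
      using that by (auto simp: heavy_def)
    have "real n1 \<le> real (n ^ CARD('d))" using n self_le_box_volume[of n] by linarith
    then have "real (card T) / (\<delta> / 3) < real (n ^ CARD('d))" using n1 by linarith
    then have "real (card T) < real (n ^ CARD('d)) * (\<delta> / 3)" using \<delta> by (simp add: field_simps)
    also have "\<dots> < exp (real (n ^ CARD('d)) * (\<delta> / 3))" using exp_ge_add_one_self[of "real (n ^ CARD('d)) * (\<delta> / 3)"] by linarith
    finally have cT: "real (card I) < exp (real (n ^ CARD('d)) * (\<delta> / 3))"
      using card_mono[OF T(1), of I] by (auto simp: I_def)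
    have "ennreal (exp (real (n ^ CARD('d)) * (b' - \<delta> / 3))) \<le> emeasure (tilted \<phi> n) ?A"
      using big[of n] n by (simp add: heavy_def)
    also have "\<dots> \<le> (\<Sum>c\<in>I. emeasure (tilted \<phi> n) (shifted c (dilate 3 W')))"
      using Ifin nbm by (intro emeasure_subadditive_finite) auto
    also have "\<dots> \<le> (\<Sum>c\<in>I. ennreal (exp (real (n ^ CARD('d)) * (b - \<delta>))))" using small by (intro sum_mono)
    also have "\<dots> = ennreal (real (card I) * exp (real (n ^ CARD('d)) * (b - \<delta>)))"
      by (simp add: ennreal_mult ennreal_of_nat_eq_real_of_nat)
    also have "\<dots> < ennreal (exp (real (n ^ CARD('d)) * (\<delta> / 3)) * exp (real (n ^ CARD('d)) * (b - \<delta>)))"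
      using cT by (simp add: ennreal_less_iff)
    also have "exp (real (n ^ CARD('d)) * (\<delta> / 3)) * exp (real (n ^ CARD('d)) * (b - \<delta>)) = exp (real (n ^ CARD('d)) * (b' - \<delta> / 3))"
      unfolding exp_add[symmetric] b'_def by (simp add: algebra_simps)
    finally show False by simp
  qed
  then have "\<forall>\<^sub>F n in sequentially. \<exists>c\<in>I. heavy \<phi> (shifted c (dilate 3 W')) (b - \<delta>) n"
    unfolding eventually_sequentially by blast
  then have "\<exists>\<^sub>F n in sequentially. \<exists>c\<in>I. heavy \<phi> (shifted c (dilate 3 W')) (b - \<delta>) n"
    by (rule eventually_frequently[OF sequentially_bot])
  then have "\<exists>c\<in>I. \<exists>\<^sub>F n in sequentially. heavy \<phi> (shifted c (dilate 3 W')) (b - \<delta>) n"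
    by (rule frequently_bex_finite[OF Ifin])
  then obtain c where "c \<in> I" "\<exists>\<^sub>F n in sequentially. heavy \<phi> (shifted c (dilate 3 W')) (b - \<delta>) n" by blast
  then show ?thesis using that[of c] by (simp add: I_def)
qed

section \<open>Successive localisation to a point\<close>

lemma dist_eq_dist_0: "dist v x = dist (v - x) (0 :: 'y)"
  using dist_translation[of "v - x" x 0] by simp

text \<open>One localisation moves the centre by an element of
  \<open>dilate 3 (dilate 3 (W k))\<close>, whence the 9, and geometric radii make the centres a
  Cauchy sequence. The whole space as \<open>W 0\<close> lets the iteration start from a bound on
  the total mass; the bound on \<open>\<phi>\<close> starts at index 1.\<close>

lemma shrinking_disks:
  assumes \<phi>: "\<phi> \<in> topological_dual"
  obtains W :: "nat \<Rightarrow> 'y set" where "W 0 = UNIV" "\<And>k. disk (W k)" "\<And>k. W (Suc k) \<subseteq> W k"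
    "\<And>k. dilate 9 (W (Suc k)) \<subseteq> ball 0 (1 / 2 ^ Suc k)" "\<And>k w. w \<in> W (Suc k) \<Longrightarrow> \<bar>\<phi> w\<bar> \<le> 1"
proof -
  obtain B where B: "disk B" "\<And>w. w \<in> B \<Longrightarrow> \<bar>\<phi> w\<bar> \<le> 1" using disk_dual_bounded[OF \<phi> zero_less_one] by blast
  have ex: "\<exists>D :: 'y set. disk D \<and> D \<subseteq> C \<and> D \<subseteq> B \<and> dilate 9 D \<subseteq> ball 0 r" if "disk C" "0 < r" for C r
  proof -
    have "open (ball (0::'y) r)" "(0::'y) \<in> ball 0 r" "(0::real) < 9" using that by auto
    then obtain D where D: "disk D" "shifted 0 (dilate 9 D) \<subseteq> ball (0::'y) r" by (rule exists_shifted_subset)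
    have "disk (D \<inter> B \<inter> C)" using D B that by (intro disk_Int)
    moreover have "dilate 9 (D \<inter> B \<inter> C) \<subseteq> dilate 9 D" by (auto simp: dilate_def)
    ultimately show ?thesis using D by (intro exI[of _ "D \<inter> B \<inter> C"]) (auto simp: shifted_def)
  qed
  have "\<exists>W :: nat \<Rightarrow> 'y set. W 0 = UNIV \<and> (\<forall>k. disk (W k) \<and>
     (W (Suc k) \<subseteq> W k \<and> W (Suc k) \<subseteq> B \<and> dilate 9 (W (Suc k)) \<subseteq> ball 0 (1 / 2 ^ Suc k)))"
  proof -
    define step where "step k C = (SOME D :: 'y set. disk D \<and> D \<subseteq> C \<and> D \<subseteq> B \<and> dilate 9 D \<subseteq> ball 0 (1 / 2 ^ Suc k))" for k C
    have step: "disk (step k C) \<and> step k C \<subseteq> C \<and> step k C \<subseteq> B \<and> dilate 9 (step k C) \<subseteq> ball 0 (1 / 2 ^ Suc k)"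
      if "disk C" for k C
      unfolding step_def by (rule someI_ex) (rule ex[OF that], simp)
    define W where "W = rec_nat UNIV step"
    have W0: "W 0 = UNIV" and WS: "W (Suc k) = step k (W k)" for k by (simp_all add: W_def)
    have Wd: "disk (W k)" for k
    proof (induction k)
      case 0
      then show ?case by (simp add: W0 disk_UNIV)
    next
      case (Suc k)
      then show ?case using step[OF Suc] by (simp add: WS)
    qed
    show ?thesis
      by (intro exI[of _ W] conjI allI) (use W0 Wd step[OF Wd] in \<open>simp_all add: WS\<close>)
  qed
  then obtain W :: "nat \<Rightarrow> 'y set" where W: "W 0 = UNIV" "\<And>k. disk (W k)" "\<And>k. W (Suc k) \<subseteq> W k"
     "\<And>k. W (Suc k) \<subseteq> B" "\<And>k. dilate 9 (W (Suc k)) \<subseteq> ball 0 (1 / 2 ^ Suc k)" by blast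
  show ?thesis
  proof (rule that[OF W(1,2,3,5)])
    show "\<bar>\<phi> w\<bar> \<le> 1" if "w \<in> W (Suc k)" for k w using B(2) W(4) that by blast
  qed
qed

text \<open>Localisation is repeated with losses \<open>\<delta> / 2 ^ Suc k\<close>, whose sum is
  \<open>\<delta>\<close>, and completeness provides the limit of the centres. Every neighbourhood
  of the limit contains one of the heavy sets.\<close>

lemma heavy_point:
  assumes \<phi>: "\<phi> \<in> topological_dual"
    and freq: "\<exists>\<^sub>F n in sequentially. heavy \<phi> UNIV b n" and \<delta>: "0 < \<delta>"
  obtains x where "\<And>O'. open O' \<Longrightarrow> x \<in> O' \<Longrightarrow> \<exists>\<^sub>F n in sequentially. heavy \<phi> O' (b - \<delta>) n"
proof -
  obtain W where W: "W 0 = UNIV" "\<And>k. disk (W k)" "\<And>k. W (Suc k) \<subseteq> W k"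
    "\<And>k. dilate 9 (W (Suc k)) \<subseteq> ball 0 (1 / 2 ^ Suc k)" "\<And>k w. w \<in> W (Suc k) \<Longrightarrow> \<bar>\<phi> w\<bar> \<le> 1"
    using shrinking_disks[OF \<phi>] by blast
  define P where "P k x \<longleftrightarrow> (\<exists>\<^sub>F n in sequentially. heavy \<phi> (shifted x (dilate 3 (W k))) (b - \<delta> * (1 - 1 / 2 ^ k)) n)" for k x
  have "\<exists>x. \<forall>k. P k (x k) \<and> x (Suc k) - x k \<in> dilate 9 (W k)"
  proof (rule dependent_nat_choice)
    have "shifted 0 (dilate 3 (W 0)) = UNIV"
    proof -
      have "v = 3 *\<^sub>R ((1 / 3) *\<^sub>R v)" for v :: 'y by simp
      then show ?thesis unfolding W shifted_def dilate_def by blast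
    qed
    then have "P 0 0" using freq by (simp add: P_def)
    then show "\<exists>x. P 0 x" ..
  next
    fix x k assume "P k x"
    then have fr: "\<exists>\<^sub>F n in sequentially. heavy \<phi> (shifted x (dilate 3 (W k))) (b - \<delta> * (1 - 1 / 2 ^ k)) n" by (simp add: P_def)
    have sub: "W (Suc k) \<subseteq> dilate 3 (W k)" using W(3)[of k] dilate_mono[OF W(2), of 1 3 k] by auto
    have d3: "disk (dilate 3 (W k))" using disk_dilate[OF W(2)] by simp
    have pos: "0 < \<delta> / 2 ^ Suc k" using \<delta> by simp
    have Wk: "\<bar>\<phi> w\<bar> \<le> 1" if "w \<in> W (Suc k)" for w using W(5)[OF that] .
    obtain x' where x': "x' - x \<in> dilate 3 (dilate 3 (W k))"
      "\<exists>\<^sub>F n in sequentially. heavy \<phi> (shifted x' (dilate 3 (W (Suc k)))) (b - \<delta> * (1 - 1 / 2 ^ k) - \<delta> / 2 ^ Suc k) n"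
      using heavy_localise[OF \<phi> d3 W(2) sub Wk fr pos] by blast
    have "b - \<delta> * (1 - 1 / 2 ^ k) - \<delta> / 2 ^ Suc k = b - \<delta> * (1 - 1 / 2 ^ Suc k)" by (simp add: field_simps)
    then have "P (Suc k) x'" unfolding P_def using x'(2) by (simp only:)
    then show "\<exists>x'. P (Suc k) x' \<and> x' - x \<in> dilate 9 (W k)" using x'(1) by (auto simp: dilate_dilate)
  qed
  then obtain x where x: "\<And>k. P k (x k)" "\<And>k. x (Suc k) - x k \<in> dilate 9 (W k)" by blast
  have near: "dilate 9 (W k) \<subseteq> ball 0 (1 / 2 ^ k)" if "1 \<le> k" for k using W(4)[of "k - 1"] that by simp
  have d: "dist (x (Suc k)) (x k) < 1 / 2 ^ k" if "1 \<le> k" for k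
    using near[OF that] x(2)[of k] dist_eq_dist_0[of "x (Suc k)" "x k"] by (auto simp: dist_commute)
  \<comment> \<open>The subtracted term is the tail of the geometric series and makes the induction
    close.\<close>
  have far: "dist (x (k + j)) (x k) \<le> 2 / 2 ^ k - 2 / 2 ^ (k + j)" if "1 \<le> k" for k j
  proof (induction j)
    case (Suc j)
    have "dist (x (k + Suc j)) (x k) \<le> dist (x (Suc (k + j))) (x (k + j)) + dist (x (k + j)) (x k)"
      using dist_triangle by simp
    also have "\<dots> \<le> 1 / 2 ^ (k + j) + (2 / 2 ^ k - 2 / 2 ^ (k + j))" using d[of "k + j"] that Suc by simp
    also have "\<dots> = 2 / 2 ^ k - 2 / 2 ^ (k + Suc j)" by (simp add: field_simps)
    finally show ?case .
  qed simp
  have small: "\<exists>k\<ge>1. 2 / 2 ^ k < e" if e: "0 < e" for e :: real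
  proof -
    obtain k where "(1 / 2) ^ k < e / 2" using real_arch_pow_inv[of "e / 2" "1 / 2"] e by auto
    then have "2 / 2 ^ k < e" by (simp add: power_divide field_simps)
    moreover have "2 / 2 ^ Suc k \<le> (2 :: real) / 2 ^ k" by (simp add: field_simps)
    ultimately show ?thesis by (intro exI[of _ "Suc k"]) auto
  qed
  have "Cauchy x"
  proof (rule metric_CauchyI)
    fix e :: real assume "0 < e"
    then obtain k where k: "1 \<le> k" "2 / 2 ^ k < e / 2" using small[of "e / 2"] by auto
    have kk: "dist (x n) (x k) < e / 2" if "k \<le> n" for n
    proof -
      have "dist (x n) (x k) \<le> 2 / 2 ^ k - 2 / 2 ^ n" using far[OF k(1), of "n - k"] that by simp
      also have "\<dots> \<le> 2 / 2 ^ k" by simp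
      finally show ?thesis using k by simp
    qed
    show "\<exists>M. \<forall>m\<ge>M. \<forall>n\<ge>M. dist (x m) (x n) < e"
    proof (intro exI[of _ k] allI impI)
      fix m n assume "k \<le> m" "k \<le> n"
      then show "dist (x m) (x n) < e"
        using kk[of m] kk[of n] dist_triangle2[of "x m" "x n" "x k"] by linarith
    qed
  qed
  then obtain l' where lim: "x \<longlonglongrightarrow> l'" by (metis Cauchy_convergent convergent_def)
  show ?thesis
  proof (rule that[of l'])
    fix O' :: "'y set" assume O': "open O'" "l' \<in> O'"
    then obtain e where e: "0 < e" "ball l' e \<subseteq> O'" by (auto simp: open_contains_ball)
    obtain k1 where k1: "\<And>k. k1 \<le> k \<Longrightarrow> dist (x k) l' < e / 2"
      using lim e(1) unfolding lim_sequentially by (meson half_gt_zero)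
    obtain k2 where k2: "1 \<le> k2" "2 / 2 ^ k2 < e / 2" using small[of "e / 2"] e(1) by auto
    define k where "k = max k1 k2"
    have "(2::real) ^ k2 \<le> 2 ^ k" by (simp add: k_def power_increasing)
    then have "(1::real) / 2 ^ k \<le> 2 / 2 ^ k2" by (simp add: frac_le)
    then have kk: "1 \<le> k" "dist (x k) l' < e / 2" "1 / 2 ^ k < e / 2"
      using k1[of k] k2 by (auto simp: k_def)
    have "shifted (x k) (dilate 3 (W k)) \<subseteq> O'"
    proof
      fix v assume "v \<in> shifted (x k) (dilate 3 (W k))"
      then have "v - x k \<in> dilate 9 (W k)" using dilate_mono[OF W(2), of 3 9 k] by (auto simp: shifted_def)
      then have "dist v (x k) < 1 / 2 ^ k"
        using near[OF kk(1)] dist_eq_dist_0[of v "x k"] by (auto simp: dist_commute)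
      then have "dist v l' < e" using kk dist_triangle[of v l' "x k"] by linarith
      then show "v \<in> O'" using e by (auto simp: dist_commute)
    qed
    moreover have "b - \<delta> \<le> b - \<delta> * (1 - 1 / 2 ^ k)" using \<delta> by (simp add: algebra_simps)
    moreover have "O' \<in> sets borel" using O' by simp
    ultimately have "heavy \<phi> O' (b - \<delta>) n" if "heavy \<phi> (shifted (x k) (dilate 3 (W k))) (b - \<delta> * (1 - 1 / 2 ^ k)) n" for n
      using heavy_mono[OF that] by blast
    then show "\<exists>\<^sub>F n in sequentially. heavy \<phi> O' (b - \<delta>) n"
      using x(1)[of k] unfolding P_def by (rule frequently_elim1[rotated])
  qed
qed

end

section \<open>Entropy and pressure\<close>

text \<open>The conventions of \<open>elog\<close> at 0 and \<infinity> agree with the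
  multiplicative form, so a real threshold \<open>b\<close> can be tested without
  exceptions.\<close>

lemma le_elog_div_iff:
  assumes "0 < N"
  shows "ereal b \<le> elog p / ereal N \<longleftrightarrow> ennreal (exp (N * b)) \<le> p"
proof (cases p)
  case (real r)
  show ?thesis
  proof (cases "r = 0")
    case True
    then show ?thesis using assms real by (simp add: elog_def)
  next
    case False
    then have r: "0 < r" using real by simp
    have "ereal b \<le> elog p / ereal N \<longleftrightarrow> b \<le> ln r / N" using real r assms by (simp add: elog_def)
    also have "\<dots> \<longleftrightarrow> N * b \<le> ln r" using assms by (simp add: field_simps)
    also have "\<dots> \<longleftrightarrow> exp (N * b) \<le> r" using r by (simp add: ln_ge_iff)
    finally show ?thesis using real r by (simp add: ennreal_le_iff)
  qed
next
  case top
  then show ?thesis using assms by (simp add: elog_def)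
qed

lemma ereal_le_if_reals_le:
  assumes "\<And>r. ereal r < a \<Longrightarrow> ereal r \<le> b"
  shows "a \<le> b"
proof (rule ccontr)
  assume "\<not> a \<le> b"
  then obtain r where "b < ereal r" "ereal r < a" using ereal_dense2[of b a] by (auto simp: not_le)
  then show False using assms[of r] by auto
qed

lemma Liminf_ge_iff_reals:
  fixes X :: "'a \<Rightarrow> ereal"
  shows "ereal b \<le> Liminf F X \<longleftrightarrow> (\<forall>\<delta>>0. \<forall>\<^sub>F n in F. ereal (b - \<delta>) \<le> X n)"
proof
  assume L: "ereal b \<le> Liminf F X"
  show "\<forall>\<delta>>0. \<forall>\<^sub>F n in F. ereal (b - \<delta>) \<le> X n"
  proof (intro allI impI)
    fix \<delta> :: real assume "0 < \<delta>"
    then have "ereal (b - \<delta>) < ereal b" by simp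
    then have "\<forall>\<^sub>F n in F. ereal (b - \<delta>) < X n" using L unfolding le_Liminf_iff by blast
    then show "\<forall>\<^sub>F n in F. ereal (b - \<delta>) \<le> X n" by (rule eventually_mono) simp
  qed
next
  assume R: "\<forall>\<delta>>0. \<forall>\<^sub>F n in F. ereal (b - \<delta>) \<le> X n"
  show "ereal b \<le> Liminf F X"
  proof (rule ereal_le_if_reals_le)
    fix r assume "ereal r < ereal b"
    then have "\<forall>\<^sub>F n in F. ereal r \<le> X n" using R[rule_format, of "b - r"] by simp
    then show "ereal r \<le> Liminf F X" by (rule Liminf_bounded)
  qed
qed

context mixing_field
begin

lemma eventually_pos: "\<forall>\<^sub>F n in sequentially. 0 < real (n ^ CARD('d))"
  by (rule eventually_sequentiallyI[of 1]) simp

lemma entropy_sets_open: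
  assumes "A \<in> entropy_sets C0"
  shows "open A"
  using assms base unfolding entropy_sets_def convex_nhds_base_def by (auto intro!: open_affine_image)

lemma entropy_set_inside:
  assumes "open O'" "x \<in> O'"
  obtains A where "A \<in> entropy_sets C0" "x \<in> A" "A \<subseteq> O'"
proof -
  obtain W where W: "disk W" "shifted x (dilate 1 W) \<subseteq> O'" using exists_shifted_subset[OF assms zero_less_one] by blast
  obtain V where V: "V \<in> C0" "V \<subseteq> W" "open V" "convex V" "0 \<in> V" using base_sub[OF W(1)] by blast
  show ?thesis
  proof (rule that)
    show "(\<lambda>v. x + 1 *\<^sub>R v) ` V \<in> entropy_sets C0"
      unfolding entropy_sets_def mem_Collect_eq by (intro exI[of _ x] exI[of _ 1] exI[of _ V] conjI refl V) simp
    show "x \<in> (\<lambda>v. x + 1 *\<^sub>R v) ` V" using V(5) by force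
    show "(\<lambda>v. x + 1 *\<^sub>R v) ` V \<subseteq> O'"
    proof
      fix v assume "v \<in> (\<lambda>v. x + 1 *\<^sub>R v) ` V"
      then have "v - x \<in> W" using V(2) by auto
      then show "v \<in> O'" using W(2) by (auto simp: shifted_def)
    qed
  qed
qed

lemma rate_ge_iff:
  assumes "open A"
  shows "ereal b \<le> liminf (\<lambda>n. elog (emeasure M {\<omega>\<in>space M. field_mean (lattice_box 0 n) (\<eta> \<omega>) \<in> A})
                     / ereal (real (card (lattice_box (0 :: int ^ 'd) n)))) \<longleftrightarrow>
     (\<forall>\<delta>>0. \<forall>\<^sub>F n in sequentially. heavy (\<lambda>_. 0) A (b - \<delta>) n)"
  unfolding Liminf_ge_iff_reals
proof (intro all_cong)
  fix \<delta> :: real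
  let ?X = "\<lambda>n. elog (emeasure M {\<omega>\<in>space M. field_mean (lattice_box 0 n) (\<eta> \<omega>) \<in> A})
                     / ereal (real (card (lattice_box (0 :: int ^ 'd) n)))"
  have "\<forall>\<^sub>F n in sequentially. ereal (b - \<delta>) \<le> ?X n \<longleftrightarrow> heavy (\<lambda>_. 0) A (b - \<delta>) n"
    using eventually_pos
  proof eventually_elim
    case (elim n)
    show ?case using le_elog_div_iff[OF elim] assms
      by (simp only: card_lattice_box heavy_def) (simp add: emeasure_tilted_0)
  qed
  then show "(\<forall>\<^sub>F n in sequentially. ereal (b - \<delta>) \<le> ?X n) \<longleftrightarrow> (\<forall>\<^sub>F n in sequentially. heavy (\<lambda>_. 0) A (b - \<delta>) n)"
    by (rule eventually_subst)
qed

text \<open>Entropy sets are open and one of them around \<open>x\<close> fits into every open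
  neighbourhood of \<open>x\<close>, so all open neighbourhoods may serve as tests; this criterion
  does not mention the base \<open>C0\<close>.\<close>

lemma entropy_ge_iff:
  "ereal b \<le> field_entropy M C0 \<eta> x \<longleftrightarrow>
    (\<forall>O'. open O' \<and> x \<in> O' \<longrightarrow> (\<forall>\<delta>>0. \<forall>\<^sub>F n in sequentially. heavy (\<lambda>_. 0) O' (b - \<delta>) n))"
proof
  assume L: "ereal b \<le> field_entropy M C0 \<eta> x"
  show "\<forall>O'. open O' \<and> x \<in> O' \<longrightarrow> (\<forall>\<delta>>0. \<forall>\<^sub>F n in sequentially. heavy (\<lambda>_. 0) O' (b - \<delta>) n)"
  proof (intro allI impI)
    fix O' :: "'y set" and \<delta> :: real assume O': "open O' \<and> x \<in> O'" and \<delta>: "0 < \<delta>"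
    then obtain A where A: "A \<in> entropy_sets C0" "x \<in> A" "A \<subseteq> O'" using entropy_set_inside[of O' x] by blast
    have "ereal b \<le> liminf (\<lambda>n. elog (emeasure M {\<omega>\<in>space M. field_mean (lattice_box 0 n) (\<eta> \<omega>) \<in> A})
                     / ereal (real (card (lattice_box (0 :: int ^ 'd) n))))"
      using L A unfolding field_entropy_def by (intro order_trans[OF L[unfolded field_entropy_def] INF_lower]) auto
    then have "\<forall>\<^sub>F n in sequentially. heavy (\<lambda>_. 0) A (b - \<delta>) n"
      using rate_ge_iff[OF entropy_sets_open[OF A(1)]] \<delta> by blast
    then show "\<forall>\<^sub>F n in sequentially. heavy (\<lambda>_. 0) O' (b - \<delta>) n"
      by (rule eventually_mono) (rule heavy_mono[OF _ A(3)], use O' in auto)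
  qed
next
  assume R: "\<forall>O'. open O' \<and> x \<in> O' \<longrightarrow> (\<forall>\<delta>>0. \<forall>\<^sub>F n in sequentially. heavy (\<lambda>_. 0) O' (b - \<delta>) n)"
  show "ereal b \<le> field_entropy M C0 \<eta> x"
    unfolding field_entropy_def
  proof (rule INF_greatest)
    fix A assume "A \<in> {A \<in> entropy_sets C0. x \<in> A}"
    then have A: "open A" "x \<in> A" using entropy_sets_open by auto
    show "ereal b \<le> liminf (\<lambda>n. elog (emeasure M {\<omega>\<in>space M. field_mean (lattice_box 0 n) (\<eta> \<omega>) \<in> A})
                     / ereal (real (card (lattice_box (0 :: int ^ 'd) n))))"
      unfolding rate_ge_iff[OF A(1)] using R A by blast
  qed
qed

lemma entropy_nonpos: "field_entropy M C0 \<eta> x \<le> 0"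
proof (rule ereal_le_if_reals_le)
  fix r assume "ereal r < field_entropy M C0 \<eta> x"
  then have ge: "ereal r \<le> field_entropy M C0 \<eta> x" by simp
  have "r \<le> 0"
  proof (rule ccontr)
    assume r: "\<not> r \<le> 0"
    then have "0 < r / 2" by simp
    then have "\<forall>\<^sub>F n in sequentially. heavy (\<lambda>_. 0) UNIV (r - r / 2) n"
      using ge[unfolded entropy_ge_iff] open_UNIV UNIV_I by blast
    with eventually_pos have "\<forall>\<^sub>F n in sequentially. False"
    proof eventually_elim
      case (elim n)
      have "ennreal (exp (real (n ^ CARD('d)) * (r - r / 2))) \<le> 1"
        using elim(2) by (simp add: heavy_def emeasure_tilted_0 emeasure_space_1)
      then have "real (n ^ CARD('d)) * (r - r / 2) \<le> 0" by (simp add: ennreal_le_1)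
      moreover have "0 < real (n ^ CARD('d)) * (r - r / 2)" using elim(1) r by (intro mult_pos_pos) auto
      ultimately show False by linarith
    qed
    then show False by simp
  qed
  then show "ereal r \<le> 0" by simp
qed

section \<open>Change of tilt, and pressure against entropy\<close>

lemma tilted_compare:
  assumes \<phi>: "\<phi> \<in> topological_dual" and \<psi>: "\<psi> \<in> topological_dual" and A: "A \<in> sets borel"
    and le: "\<And>v. v \<in> A \<Longrightarrow> \<phi> v \<le> \<psi> v + a"
  shows "emeasure (tilted \<phi> n) A \<le> ennreal (exp (real (n ^ CARD('d)) * a)) * emeasure (tilted \<psi> n) A"
proof -
  note [measurable] = weight_meas[OF \<psi>] A
  have "weight \<phi> n \<omega> \<le> exp (real (n ^ CARD('d)) * a) * weight \<psi> n \<omega>"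
    if "field_mean (lattice_box 0 n) (\<eta> \<omega>) \<in> A" for \<omega>
    using mult_left_mono[OF le[OF that], of "real (n ^ CARD('d))"]
    unfolding weight_def exp_add[symmetric] by (simp add: algebra_simps)
  then have "emeasure (tilted \<phi> n) A \<le> (\<integral>\<^sup>+ \<omega>. ennreal (exp (real (n ^ CARD('d)) * a)) *
      (ennreal (weight \<psi> n \<omega>) * indicator A (field_mean (lattice_box 0 n) (\<eta> \<omega>))) \<partial>M)"
    unfolding emeasure_tilted[OF \<phi> A]
    by (intro nn_integral_mono) (auto split: split_indicator simp: ennreal_mult[symmetric] weight_def intro!: ennreal_leI)
  also have "\<dots> = ennreal (exp (real (n ^ CARD('d)) * a)) * emeasure (tilted \<psi> n) A"
    unfolding emeasure_tilted[OF \<psi> A] by (intro nn_integral_cmult) measurable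
  finally show ?thesis .
qed

lemma heavy_compare:
  assumes \<phi>: "\<phi> \<in> topological_dual" and \<psi>: "\<psi> \<in> topological_dual" and A: "A \<in> sets borel"
    and le: "\<And>v. v \<in> A \<Longrightarrow> \<phi> v \<le> \<psi> v + a" and h: "heavy \<phi> A b n"
  shows "heavy \<psi> A (b - a) n"
proof -
  let ?N = "real (n ^ CARD('d))"
  have "ennreal (exp (?N * (b - a))) = ennreal (exp (- (?N * a))) * ennreal (exp (?N * b))"
    by (simp add: ennreal_mult[symmetric] exp_add[symmetric] algebra_simps)
  also have "\<dots> \<le> ennreal (exp (- (?N * a))) * (ennreal (exp (?N * a)) * emeasure (tilted \<psi> n) A)"
    using h tilted_compare[OF \<phi> \<psi> A le, of n] by (intro mult_left_mono) (auto simp: heavy_def)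
  also have "\<dots> = emeasure (tilted \<psi> n) A"
    by (simp add: mult.assoc[symmetric] ennreal_mult[symmetric] exp_add[symmetric])
  finally show ?thesis by (simp add: heavy_def)
qed

text \<open>Near \<open>x\<close> the tilt is almost the constant \<open>\<phi> x\<close>, so a
  neighbourhood heavy under the tilt is heavy for the law of the mean itself, with the rate lowered
  by about \<open>\<phi> x\<close>. Superadditivity first replaces infinitely many sizes by all
  large ones, as a lower limit requires.\<close>

lemma entropy_attains_pressure:
  assumes \<phi>: "\<phi> \<in> topological_dual"
    and freq: "\<exists>\<^sub>F n in sequentially. heavy \<phi> UNIV b n" and \<delta>: "0 < \<delta>"
  obtains x where "ereal (b - \<delta> - \<phi> x) \<le> field_entropy M C0 \<eta> x"
proof -
  interpret \<phi>: linear \<phi> using \<phi> by (simp add: topological_dual_def)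
  obtain x where x: "\<And>O'. open O' \<Longrightarrow> x \<in> O' \<Longrightarrow> \<exists>\<^sub>F n in sequentially. heavy \<phi> O' (b - \<delta>) n"
    using heavy_point[OF \<phi> freq \<delta>] by blast
  have "ereal (b - \<delta> - \<phi> x) \<le> field_entropy M C0 \<eta> x"
    unfolding entropy_ge_iff
  proof (intro allI impI)
    fix O' :: "'y set" and d :: real assume O': "open O' \<and> x \<in> O'" and d: "0 < d"
    \<comment> \<open>The bound 1 is what superadditivity asks for; \<open>d / 6\<close> leaves an
      error of \<open>d / 2\<close> after the enlargement by 3.\<close>
    have r: "0 < min 1 (d / 6)" using d by simp
    obtain W1 where W1: "disk W1" "\<And>w. w \<in> W1 \<Longrightarrow> \<bar>\<phi> w\<bar> \<le> min 1 (d / 6)"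
      using disk_dual_bounded[OF \<phi> r] by blast
    have O1: "open O'" "x \<in> O'" using O' by auto
    obtain W2 where W2: "disk W2" "shifted x (dilate 3 W2) \<subseteq> O'"
      using exists_shifted_subset[OF O1, of 3] by auto
    define W where "W = W1 \<inter> W2"
    have W: "disk W" "\<And>w. w \<in> W \<Longrightarrow> \<bar>\<phi> w\<bar> \<le> 1" using W1 W2 by (auto simp: W_def disk_Int)
    have sub: "shifted x (dilate 3 W) \<subseteq> O'" using W2(2) by (auto simp: shifted_def dilate_def W_def)
    have nbm: "shifted x (dilate 3 W) \<in> sets borel" using shifted_open_convex(1)[OF disk_dilate[OF W(1), of 3]] by simp
    have "\<exists>\<^sub>F n in sequentially. heavy \<phi> (shifted x W) (b - \<delta>) n"
      using shifted_open_convex[OF W(1)] by (intro x)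
    from heavy_frequently_imp_eventually[OF \<phi> W this, of "d / 2"]
    have "\<forall>\<^sub>F n in sequentially. heavy \<phi> (shifted x (dilate 3 W)) (b - \<delta> - d / 2) n" using d by simp
    then show "\<forall>\<^sub>F n in sequentially. heavy (\<lambda>_. 0) O' (b - \<delta> - \<phi> x - d) n"
    proof (rule eventually_mono)
      fix n assume h: "heavy \<phi> (shifted x (dilate 3 W)) (b - \<delta> - d / 2) n"
      have "heavy (\<lambda>_. 0) (shifted x (dilate 3 W)) (b - \<delta> - d / 2 - (\<phi> x + d / 2)) n"
      proof (rule heavy_compare[OF \<phi> zero_dual nbm _ h])
        fix v assume "v \<in> shifted x (dilate 3 W)"
        then obtain w where w: "w \<in> W1" "v - x = 3 *\<^sub>R w" by (auto simp: shifted_def dilate_def W_def)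
        have "\<phi> v - \<phi> x = 3 * \<phi> w" using w(2) by (metis \<phi>.diff \<phi>.scale real_scaleR_def)
        then show "\<phi> v \<le> 0 + (\<phi> x + d / 2)" using W1(2)[OF w(1)] by auto
      qed
      then show "heavy (\<lambda>_. 0) O' (b - \<delta> - \<phi> x - d) n"
        by (rule heavy_mono[OF _ sub]) (use O' in auto)
    qed
  qed
  then show ?thesis by (rule that)
qed

text \<open>The half-space where \<open>\<phi>\<close> exceeds
  \<open>\<phi> x - \<delta> / 2\<close> is a neighbourhood of \<open>x\<close>, and on it the tilt
  is bounded below.\<close>

lemma pressure_ge_entropy:
  assumes \<phi>: "\<phi> \<in> topological_dual" and s: "ereal r \<le> field_entropy M C0 \<eta> x" and \<delta>: "0 < \<delta>"
  shows "\<forall>\<^sub>F n in sequentially. heavy \<phi> UNIV (r + \<phi> x - \<delta>) n"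
proof -
  define A where "A = {v. \<phi> x - \<delta> / 2 < \<phi> v}"
  have "open A" unfolding A_def using \<phi>
    by (intro open_Collect_less continuous_intros) (auto simp: topological_dual_def)
  moreover have "x \<in> A" using \<delta> by (simp add: A_def)
  moreover have "0 < \<delta> / 2" using \<delta> by simp
  ultimately have "\<forall>\<^sub>F n in sequentially. heavy (\<lambda>_. 0) A (r - \<delta> / 2) n"
    using s unfolding entropy_ge_iff by blast
  then show ?thesis
  proof (rule eventually_mono)
    fix n assume h: "heavy (\<lambda>_. 0) A (r - \<delta> / 2) n"
    have "heavy \<phi> A (r - \<delta> / 2 - (\<delta> / 2 - \<phi> x)) n"
      by (rule heavy_compare[OF zero_dual \<phi> _ _ h]) (use \<open>open A\<close> in \<open>auto simp: A_def\<close>)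
    then show "heavy \<phi> UNIV (r + \<phi> x - \<delta>) n" by (rule heavy_mono) auto
  qed
qed

lemma finite_pressure_ge_iff:
  assumes \<phi>: "\<phi> \<in> topological_dual" and "0 < real (n ^ CARD('d))"
  shows "ereal b \<le> finite_pressure M (lattice_box 0 n) \<eta> \<phi> \<longleftrightarrow> heavy \<phi> UNIV b n"
proof -
  interpret \<phi>: linear \<phi> using \<phi> by (simp add: topological_dual_def)
  have "exp (\<phi> (\<Sum>z\<in>lattice_box 0 n. \<eta> \<omega> z)) = weight \<phi> n \<omega>" for \<omega>
    using assms(2) by (simp add: weight_def field_mean_def card_lattice_box \<phi>.scale)
  then have "(\<integral>\<^sup>+ \<omega>. ennreal (exp (\<phi> (\<Sum>z\<in>lattice_box 0 n. \<eta> \<omega> z))) \<partial>M) = emeasure (tilted \<phi> n) UNIV"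
    by (simp add: emeasure_tilted[OF \<phi>])
  then show ?thesis
    unfolding finite_pressure_def heavy_def card_lattice_box by (simp only: le_elog_div_iff[OF assms(2)])
qed

lemma heavy_below_limsup:
  assumes \<phi>: "\<phi> \<in> topological_dual"
    and b: "ereal b < limsup (\<lambda>n. finite_pressure M (lattice_box 0 n) \<eta> \<phi>)"
  shows "\<exists>\<^sub>F n in sequentially. heavy \<phi> UNIV b n"
proof -
  let ?X = "\<lambda>n. finite_pressure M (lattice_box 0 n) \<eta> \<phi>"
  have "\<exists>\<^sub>F n in sequentially. ereal b < ?X n"
    using b Limsup_bounded[of ?X "ereal b" sequentially] by (auto simp: frequently_def not_less)
  then have "\<exists>\<^sub>F n in sequentially. 0 < real (n ^ CARD('d)) \<and> ereal b < ?X n"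
    using eventually_pos by (rule frequently_eventually_conj)
  then show ?thesis
    by (rule frequently_elim1) (use finite_pressure_ge_iff[OF \<phi>] in \<open>auto dest: less_imp_le\<close>)
qed

text \<open>\<open>pressure\<close> is defined by \<open>lim\<close>, so convergence has to be shown
  before it can be used. A rate reached infinitely often yields a point \<open>x\<close>, and the
  half-space bound at \<open>x\<close> returns this rate, up to \<open>\<delta>\<close>, for all
  large boxes.\<close>

lemma pressure_limit:
  assumes \<phi>: "\<phi> \<in> topological_dual"
  shows "liminf (\<lambda>n. finite_pressure M (lattice_box 0 n) \<eta> \<phi>) = pressure M \<eta> \<phi>"
    and "limsup (\<lambda>n. finite_pressure M (lattice_box 0 n) \<eta> \<phi>) = pressure M \<eta> \<phi>"
proof -
  let ?X = "\<lambda>n. finite_pressure M (lattice_box 0 n) \<eta> \<phi>"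
  have "limsup ?X \<le> liminf ?X"
  proof (rule ereal_le_if_reals_le)
    fix b assume "ereal b < limsup ?X"
    then have freq: "\<exists>\<^sub>F n in sequentially. heavy \<phi> UNIV b n" by (rule heavy_below_limsup[OF \<phi>])
    show "ereal b \<le> liminf ?X"
      unfolding Liminf_ge_iff_reals
    proof (intro allI impI)
      fix \<delta> :: real assume "0 < \<delta>"
      then have d: "0 < \<delta> / 2" by simp
      obtain x where "ereal (b - \<delta> / 2 - \<phi> x) \<le> field_entropy M C0 \<eta> x"
        using entropy_attains_pressure[OF \<phi> freq d] by blast
      from pressure_ge_entropy[OF \<phi> this d] have "\<forall>\<^sub>F n in sequentially. heavy \<phi> UNIV (b - \<delta>) n" by simp
      with eventually_pos show "\<forall>\<^sub>F n in sequentially. ereal (b - \<delta>) \<le> ?X n"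
        by eventually_elim (use finite_pressure_ge_iff[OF \<phi>] in blast)
    qed
  qed
  then have eq: "liminf ?X = limsup ?X" by (intro antisym Liminf_le_Limsup) auto
  then have "?X \<longlonglongrightarrow> liminf ?X" by (intro Liminf_eq_Limsup) auto
  then have "lim ?X = liminf ?X" by (rule limI)
  then show "liminf ?X = pressure M \<eta> \<phi>" "limsup ?X = pressure M \<eta> \<phi>" using eq by (simp_all add: pressure_def)
qed

end

section \<open>Concavity of the entropy\<close>

lemma sum_two_values:
  fixes x y :: "'a::real_vector"
  assumes "a \<le> K"
  shows "(\<Sum>k<K. if k < a then x else y) = real a *\<^sub>R x + real (K - a) *\<^sub>R y"
  using assms
proof (induction K)
  case (Suc K)
  show ?case
  proof (cases "a \<le> K")
    case True
    then show ?thesis using Suc by (simp add: Suc_diff_le algebra_simps)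
  next
    case False
    then have a: "a = Suc K" using Suc by simp
    have "(\<Sum>k<Suc K. if k < a then x else y) = (\<Sum>k<Suc K. x)"
      by (intro sum.cong) (auto simp: a)
    then show ?thesis by (simp add: a sum_constant_scaleR del: sum.lessThan_Suc)
  qed
qed simp

context mixing_field
begin

text \<open>A proportion \<open>u\<close> of the blocks is asked to have mean near
  \<open>x1\<close>, the others near \<open>x2\<close>, with \<open>\<phi> = 0\<close>. Real numbers
  below the entropies replace the entropies themselves, which avoids convex combinations of infinite
  values.\<close>

lemma entropy_concave:
  assumes s1: "ereal b1 \<le> field_entropy M C0 \<eta> x1" and s2: "ereal b2 \<le> field_entropy M C0 \<eta> x2"
    and u: "0 \<le> u" "u \<le> 1"
  shows "ereal (u * b1 + (1 - u) * b2) \<le> field_entropy M C0 \<eta> (u *\<^sub>R x1 + (1 - u) *\<^sub>R x2)"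
  unfolding entropy_ge_iff
proof (intro allI impI)
  fix O' :: "'y set" and \<delta> :: real
  let ?z = "u *\<^sub>R x1 + (1 - u) *\<^sub>R x2"
  assume O': "open O' \<and> ?z \<in> O'" and \<delta>: "0 < \<delta>"
  have O1: "open O'" "?z \<in> O'" "(0::real) < 4" using O' by auto
  \<comment> \<open>Four errors: deviations of the block means, corridors, and one displacement for
    each of the two centres.\<close>
  obtain W where W: "disk W" "shifted ?z (dilate 4 W) \<subseteq> O'" using exists_shifted_subset[OF O1] by blast
  define c1 c2 where "c1 = b1 - \<delta> / 2" and "c2 = b2 - \<delta> / 2"
  \<comment> \<open>Rounding the proportion and filling only part of the box shift each of the two
    weights by up to \<open>2 * e\<close>, hence the factors 2.\<close>
  let ?B = "2 * \<bar>c1\<bar> + 2 * \<bar>c2\<bar>"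
  have \<delta>2: "0 < \<delta> / 2" using \<delta> by simp
  obtain e1 where e1: "0 < e1" "e1 < 1" "e1 * \<bar>?B\<bar> + e1 \<le> \<delta> / 2" "\<And>s. \<bar>s\<bar> \<le> e1 \<Longrightarrow> s *\<^sub>R x1 \<in> W"
    using small_scale_ex[OF W(1) \<delta>2, of ?B x1] by blast
  obtain e2 where e2: "0 < e2" "e2 < 1" "e2 * \<bar>?B\<bar> + e2 \<le> \<delta> / 2" "\<And>s. \<bar>s\<bar> \<le> e2 \<Longrightarrow> s *\<^sub>R x2 \<in> W"
    using small_scale_ex[OF W(1) \<delta>2, of ?B x2] by blast
  \<comment> \<open>Halving makes shifts of size \<open>2 * e\<close> admissible for both
    \<open>x1\<close> and \<open>x2\<close>.\<close>
  define e where "e = min e1 e2 / 2"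
  have e: "0 < e" "e < 1" "2 * e \<le> e1" "2 * e \<le> e2" "e \<le> e1" using e1 e2 by (auto simp: e_def)
  have eB: "e * (2 * \<bar>c1\<bar> + 2 * \<bar>c2\<bar> + 1) \<le> \<delta> / 2"
  proof -
    have "e * (?B + 1) \<le> e1 * (?B + 1)" using e by (intro mult_right_mono) auto
    then show ?thesis using e1(3) by (simp add: algebra_simps)
  qed
  have zero: "\<bar>0::real\<bar> \<le> 1" by simp
  obtain m0 where m0: "1 \<le> m0"
    "\<And>m. m0 \<le> m \<Longrightarrow> \<exists>n0\<ge>1. \<forall>n\<ge>n0. \<exists>K. combines (\<lambda>_. 0) W e m n K"
    using tilted_superadditive[OF zero_dual W(1) zero e(1,2)] by blast
  note nbW = shifted_open_convex[OF W(1)]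
  have "\<forall>\<^sub>F m in sequentially. heavy (\<lambda>_. 0) (shifted x1 W) c1 m \<and> heavy (\<lambda>_. 0) (shifted x2 W) c2 m \<and> m0 \<le> m"
    using s1[unfolded entropy_ge_iff, rule_format, OF conjI[OF nbW(1,3)] \<delta>2]
      s2[unfolded entropy_ge_iff, rule_format, OF conjI[OF nbW(1,3)] \<delta>2]
      eventually_ge_at_top[of m0] unfolding c1_def c2_def by eventually_elim simp
  then obtain m where m: "heavy (\<lambda>_. 0) (shifted x1 W) c1 m" "heavy (\<lambda>_. 0) (shifted x2 W) c2 m" "m0 \<le> m"
    by (auto simp: eventually_sequentially)
  obtain n0 where n0: "1 \<le> n0" "\<And>n. n0 \<le> n \<Longrightarrow> \<exists>K. combines (\<lambda>_. 0) W e m n K" using m0(2)[OF m(3)] by blast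
  have "heavy (\<lambda>_. 0) O' (u * b1 + (1 - u) * b2 - \<delta>) n" if n: "n0 \<le> n" for n
  proof -
    let ?M = "real (m ^ CARD('d))" and ?N = "real (n ^ CARD('d))"
    obtain K where K: "combines (\<lambda>_. 0) W e m n K" using n0 n by blast
    note bd = combines_bounds[OF K]
    have N: "0 < ?N" using n n0 by simp
    have "0 < 1 / e" using e by simp
    then have Kpos: "0 < real K" using bd(1) by linarith
    \<comment> \<open>The integer part is off by less than 1, and since there are at least
      \<open>1 / e\<close> blocks the proportion is off by at most \<open>e\<close>.\<close>
    define a where "a = nat \<lfloor>u * real K\<rfloor>"
    have uK: "0 \<le> u * real K" "u * real K \<le> real K" using u Kpos by (auto simp: mult_left_le_one_le)
    then have aK: "real a \<le> u * real K" "u * real K \<le> real a + 1" unfolding a_def by linarith+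
    then have aleK: "a \<le> K" using uK by linarith
    define p q where "p = ?M / ?N * real a" and "q = ?M / ?N * real (K - a)"
    define \<theta> where "\<theta> = ?M / ?N * real K"
    have \<theta>: "1 - e \<le> \<theta>" "\<theta> \<le> 1" using bd N by (auto simp: \<theta>_def field_simps)
    have eK: "1 \<le> e * real K" using bd(1) e by (simp add: field_simps)
    define \<rho> where "\<rho> = real a / real K"
    have \<rho>: "\<rho> \<le> u" "u - e \<le> \<rho>" using aK eK Kpos by (auto simp: \<rho>_def field_simps)
    have K\<rho>: "real a = real K * \<rho>" using Kpos by (simp add: \<rho>_def)
    then have p: "p = \<theta> * \<rho>" by (simp add: p_def \<theta>_def)
    have "real (K - a) = real K * (1 - \<rho>)" using aleK K\<rho> by (simp add: of_nat_diff right_diff_distrib)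
    then have q: "q = \<theta> * (1 - \<rho>)" by (simp add: q_def \<theta>_def)
    have \<rho>01: "0 \<le> \<rho>" "\<rho> \<le> 1" using \<rho>(1) u(2) by (simp add: \<rho>_def, linarith)
    have near: "\<bar>\<theta> * \<kappa> - \<kappa>\<bar> \<le> e" if "0 \<le> \<kappa>" "\<kappa> \<le> 1" for \<kappa>
    proof -
      have "(1 - \<theta>) * \<kappa> \<le> (1 - \<theta>) * 1" using \<theta> that by (intro mult_left_mono) auto
      moreover have "0 \<le> (1 - \<theta>) * \<kappa>" using \<theta> that by simp
      ultimately show ?thesis using \<theta> by (simp add: left_diff_distrib)
    qed
    have pu: "\<bar>p - u\<bar> \<le> 2 * e" using near[of \<rho>] \<rho> \<rho>01 unfolding p by linarith
    have qu: "\<bar>q - (1 - u)\<bar> \<le> 2 * e" using near[of "1 - \<rho>"] \<rho> \<rho>01 unfolding q by linarith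
    define \<beta> where "\<beta> k = (if k < a then c1 else c2)" for k
    define ctr where "ctr k = (if k < a then x1 else x2)" for k
    have "ennreal (exp (?M * (\<Sum>k<K. \<beta> k) - e * ?N)) \<le> emeasure (tilted (\<lambda>_. 0) n) O'"
    proof (rule combinesD[OF K, where U = "\<lambda>k. shifted (ctr k) W"])
      fix v w assume v: "\<And>k. k < K \<Longrightarrow> v k \<in> shifted (ctr k) W" and w: "w \<in> dilate e W"
      have "(?M / ?N) *\<^sub>R (\<Sum>k<K. v k - ctr k) \<in> dilate (?M / ?N * (real K * 1)) W"
        by (rule scaled_sum_in_dilate[OF W(1)]) (use v in \<open>auto simp: shifted_def\<close>)
      then have 1: "(?M / ?N) *\<^sub>R (\<Sum>k<K. v k - ctr k) \<in> dilate 1 W"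
        using dilate_mono[OF W(1), of \<theta> 1] \<theta> e by (auto simp: \<theta>_def)
      have 2: "w \<in> dilate 1 W" using w dilate_mono[OF W(1), of e 1] e by auto
      have 3: "(p - u) *\<^sub>R x1 \<in> dilate 1 W" using e1(4)[of "p - u"] pu e by simp
      have 4: "(q - (1 - u)) *\<^sub>R x2 \<in> dilate 1 W" using e2(4)[of "q - (1 - u)"] qu e by simp
      have mem: "(?M / ?N) *\<^sub>R (\<Sum>k<K. v k - ctr k) + w + (p - u) *\<^sub>R x1 + (q - (1 - u)) *\<^sub>R x2 \<in> dilate (1 + 1 + 1 + 1) W"
        by (intro dilate_add[OF W(1)] 1 2 3 4) auto
      have "(?M / ?N) *\<^sub>R (\<Sum>k<K. ctr k) = p *\<^sub>R x1 + q *\<^sub>R x2"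
        unfolding ctr_def sum_two_values[OF aleK] p_def q_def by (simp add: scaleR_right_distrib)
      then have eq: "(?M / ?N) *\<^sub>R (\<Sum>k<K. v k - ctr k) + w + (p - u) *\<^sub>R x1 + (q - (1 - u)) *\<^sub>R x2
          = (?M / ?N) *\<^sub>R (\<Sum>k<K. v k) + w - ?z"
        unfolding sum_subtractf scaleR_right_diff_distrib by (simp add: scaleR_left_diff_distrib)
      have "(?M / ?N) *\<^sub>R (\<Sum>k<K. v k) + w \<in> shifted ?z (dilate 4 W)" using mem[unfolded eq] by (simp add: shifted_def)
      then show "(?M / ?N) *\<^sub>R (\<Sum>k<K. v k) + w \<in> O'" using W(2) by blast
    qed (use m nbW O' in \<open>auto simp: ctr_def \<beta>_def\<close>)
    moreover have "?N * (u * b1 + (1 - u) * b2 - \<delta>) \<le> ?M * (\<Sum>k<K. \<beta> k) - e * ?N"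
    proof -
      have "?M * (\<Sum>k<K. \<beta> k) = ?N * (p * c1 + q * c2)"
        using sum_two_values[OF aleK, of c1 c2] N by (simp add: \<beta>_def p_def q_def field_simps)
      moreover have "u * c1 - p * c1 \<le> 2 * e * \<bar>c1\<bar>"
      proof -
        have "u * c1 - p * c1 \<le> \<bar>(u - p) * c1\<bar>" by (simp add: left_diff_distrib)
        also have "\<dots> \<le> 2 * e * \<bar>c1\<bar>" using pu by (auto simp: abs_mult abs_minus_commute intro!: mult_right_mono)
        finally show ?thesis .
      qed
      moreover have "(1 - u) * c2 - q * c2 \<le> 2 * e * \<bar>c2\<bar>"
      proof -
        have "(1 - u) * c2 - q * c2 \<le> \<bar>((1 - u) - q) * c2\<bar>" by (simp add: left_diff_distrib)
        also have "\<dots> \<le> 2 * e * \<bar>c2\<bar>" using qu by (auto simp: abs_mult abs_minus_commute intro!: mult_right_mono)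
        finally show ?thesis .
      qed
      moreover have "u * b1 + (1 - u) * b2 - \<delta> = u * c1 + (1 - u) * c2 - \<delta> / 2"
        by (simp add: c1_def c2_def field_simps)
      ultimately have "u * b1 + (1 - u) * b2 - \<delta> \<le> p * c1 + q * c2 - e" using eB by (simp add: algebra_simps)
      then have "?N * (u * b1 + (1 - u) * b2 - \<delta>) \<le> ?N * (p * c1 + q * c2 - e)" using N by (intro mult_left_mono) auto
      then show ?thesis using \<open>?M * (\<Sum>k<K. \<beta> k) = _\<close> by (simp add: algebra_simps)
    qed
    then have "ennreal (exp (?N * (u * b1 + (1 - u) * b2 - \<delta>))) \<le> ennreal (exp (?M * (\<Sum>k<K. \<beta> k) - e * ?N))"
      by (intro ennreal_leI) simp
    ultimately show ?thesis unfolding heavy_def by (rule order_trans[rotated])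
  qed
  then show "\<forall>\<^sub>F n in sequentially. heavy (\<lambda>_. 0) O' (u * b1 + (1 - u) * b2 - \<delta>) n"
    unfolding eventually_sequentially by blast
qed

section \<open>Fenchel-Legendre duality\<close>

lemma entropy_le_neg_conjugate: "field_entropy M C0 \<eta> y \<le> - pressure_conjugate M \<eta> y"
proof (rule ereal_le_if_reals_le)
  fix r assume "ereal r < field_entropy M C0 \<eta> y"
  then have r: "ereal r \<le> field_entropy M C0 \<eta> y" by simp
  have "ereal (f y) - pressure M \<eta> f \<le> ereal (- r)" if f: "f \<in> topological_dual" for f
  proof -
    have "ereal (r + f y) \<le> pressure M \<eta> f"
      unfolding pressure_limit(1)[OF f, symmetric] Liminf_ge_iff_reals
    proof (intro allI impI)
      fix \<delta> :: real assume "0 < \<delta>"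
      from eventually_pos pressure_ge_entropy[OF f r this]
      show "\<forall>\<^sub>F n in sequentially. ereal (r + f y - \<delta>) \<le> finite_pressure M (lattice_box 0 n) \<eta> f"
        by eventually_elim (use finite_pressure_ge_iff[OF f] in blast)
    qed
    then show ?thesis by (cases "pressure M \<eta> f") auto
  qed
  then have "pressure_conjugate M \<eta> y \<le> ereal (- r)"
    unfolding pressure_conjugate_def by (intro SUP_least)
  then show "ereal r \<le> - pressure_conjugate M \<eta> y"
    by (metis ereal_minus_le_minus ereal_uminus_uminus uminus_ereal.simps(1))
qed

text \<open>If the entropy at \<open>y\<close> is below \<open>r\<close>, a single entropy set
  around \<open>y\<close> witnesses this for all its points, so \<open>- s\<close> is at least
  \<open>- r\<close> near \<open>y\<close>. The affine minorant through \<open>(y, - r)\<close> has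
  a slope \<open>f\<close> with \<open>s x + f x \<le> f y + r\<close> for all \<open>x\<close>;
  since the pressure is attained up to \<open>\<delta>\<close>, it is at most
  \<open>f y + r\<close>.\<close>

lemma neg_conjugate_le_entropy: "- pressure_conjugate M \<eta> y \<le> field_entropy M C0 \<eta> y"
proof (rule ccontr)
  assume "\<not> ?thesis"
  then obtain r where r: "field_entropy M C0 \<eta> y < ereal r" "ereal r < - pressure_conjugate M \<eta> y"
    using ereal_dense2 by (meson not_le)
  \<comment> \<open>The epigraph of \<open>- s\<close> with real heights: points of entropy
    \<open>- \<infinity>\<close> have no fibre, so infinite values do not enter the separation
    argument.\<close>
  define E where "E = {(x, b). ereal (- b) \<le> field_entropy M C0 \<eta> x}"
  have "convex E"
  proof (rule convexI)
    fix p q and u v :: real assume p: "p \<in> E" and q: "q \<in> E" and uv: "0 \<le> u" "0 \<le> v" "u + v = 1"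
    obtain x1 b1 x2 b2 where pq: "p = (x1, b1)" "q = (x2, b2)" by (metis surj_pair)
    have v: "v = 1 - u" "u \<le> 1" using uv by auto
    have "ereal (u * (- b1) + (1 - u) * (- b2)) \<le> field_entropy M C0 \<eta> (u *\<^sub>R x1 + (1 - u) *\<^sub>R x2)"
      using p q uv v by (intro entropy_concave) (auto simp: E_def pq)
    moreover have "u * (- b1) + (1 - u) * (- b2) = - (u * b1 + v * b2)" by (simp add: v)
    ultimately show "u *\<^sub>R p + v *\<^sub>R q \<in> E" by (simp add: E_def pq v)
  qed
  moreover have "E \<noteq> {}"
  proof -
    \<comment> \<open>Total mass 1 has rate 0, so the concentration argument for
      \<open>\<phi> = 0\<close> with loss 1 gives a point of entropy at least -1.\<close>
    have "heavy (\<lambda>_. 0) UNIV 0 n" for n by (simp add: heavy_def emeasure_tilted_0 emeasure_space_1)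
    then have "\<exists>\<^sub>F n in sequentially. heavy (\<lambda>_. 0) UNIV 0 n"
      by (intro eventually_frequently[OF sequentially_bot] always_eventually) blast
    then obtain x where "ereal (0 - 1 - 0) \<le> field_entropy M C0 \<eta> x"
      using entropy_attains_pressure[OF zero_dual _ zero_less_one] by blast
    then have "(x, 1) \<in> E" by (simp add: E_def)
    then show ?thesis by blast
  qed
  moreover have "0 \<le> b" if "(x, b) \<in> E" for x b
  proof -
    have "ereal (- b) \<le> field_entropy M C0 \<eta> x" using that by (simp add: E_def)
    also have "\<dots> \<le> 0" by (rule entropy_nonpos)
    finally show ?thesis by simp
  qed
  moreover obtain A where A: "A \<in> entropy_sets C0" "y \<in> A"
    "liminf (\<lambda>n. elog (emeasure M {\<omega>\<in>space M. field_mean (lattice_box 0 n) (\<eta> \<omega>) \<in> A})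
                     / ereal (real (card (lattice_box (0 :: int ^ 'd) n)))) < ereal r"
    using r(1) unfolding field_entropy_def INF_less_iff by auto
  moreover obtain W where W: "disk W" "shifted y (dilate 1 W) \<subseteq> A"
    using exists_shifted_subset[OF entropy_sets_open[OF A(1)] A(2) zero_less_one] by blast
  moreover have "- r \<le> b" if "(x, b) \<in> E" "x - y \<in> W" for x b
  proof -
    have xA: "x \<in> A" using that W(2) by (auto simp: shifted_def)
    have "ereal (- b) \<le> field_entropy M C0 \<eta> x" using that by (simp add: E_def)
    also have "\<dots> \<le> liminf (\<lambda>n. elog (emeasure M {\<omega>\<in>space M. field_mean (lattice_box 0 n) (\<eta> \<omega>) \<in> A})
                     / ereal (real (card (lattice_box (0 :: int ^ 'd) n))))"
      unfolding field_entropy_def using A xA by (intro INF_lower) auto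
    also have "\<dots> < ereal r" by (rule A(3))
    finally show ?thesis by simp
  qed
  ultimately obtain f where f: "f \<in> topological_dual" "\<And>x b. (x, b) \<in> E \<Longrightarrow> f x - f y \<le> b - (- r)"
    using affine_minorant[of E W y "- r"] by blast
  have "pressure M \<eta> f \<le> ereal (f y + r)"
  proof (rule ereal_le_if_reals_le)
    fix b assume "ereal b < pressure M \<eta> f"
    then have freq: "\<exists>\<^sub>F n in sequentially. heavy f UNIV b n"
      by (intro heavy_below_limsup[OF f(1)]) (simp add: pressure_limit(2)[OF f(1)])
    have "b \<le> f y + r"
    proof (rule field_le_epsilon)
      fix \<delta> :: real assume "0 < \<delta>"
      then obtain x where "ereal (b - \<delta> - f x) \<le> field_entropy M C0 \<eta> x"
        using entropy_attains_pressure[OF f(1) freq] by blast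
      then have "(x, - (b - \<delta> - f x)) \<in> E" unfolding E_def by simp
      from f(2)[OF this] show "b \<le> f y + r + \<delta>" by simp
    qed
    then show "ereal b \<le> ereal (f y + r)" by simp
  qed
  then have "ereal (- r) \<le> ereal (f y) - pressure M \<eta> f" by (cases "pressure M \<eta> f") auto
  also have "\<dots> \<le> pressure_conjugate M \<eta> y"
    unfolding pressure_conjugate_def using f(1) by (rule SUP_upper)
  finally have "- pressure_conjugate M \<eta> y \<le> ereal r"
    by (metis ereal_minus_le_minus ereal_uminus_uminus uminus_ereal.simps(1))
  then show False using r(2) by simp
qed

end

lemma mixing_fieldI:
  fixes \<eta> :: "'w \<Rightarrow> int ^ 'd \<Rightarrow> 'y::separable_frechet_space"
  assumes "convex_nhds_base C0" "l \<ge> 1" "random_field M \<eta>" "cadi M \<eta>" "cl M C0 \<eta>" "R_invariant M l \<eta>"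
  obtains g c t \<alpha> where "mixing_field M \<eta> C0 l g c t \<alpha>"
proof -
  obtain g c where gc: "\<forall>n\<ge>1. 0 \<le> g n \<and> 0 \<le> c n" "(\<lambda>n. g n / real n) \<longlonglongrightarrow> 0"
    "(\<lambda>n. c n / real (card (lattice_box (0 :: int ^ 'd) n))) \<longlonglongrightarrow> 0"
    and dec: "\<forall>z. \<forall>n\<ge>1. \<forall>S. finite S \<longrightarrow>
          (\<forall>C\<in>convex_open (lattice_box z n). \<forall>D\<in>convex_open S.
             lattice_dist S (lattice_box z n) > ereal (g n) \<longrightarrow>
             measure M {\<omega>\<in>space M. restrict (\<eta> \<omega>) (lattice_box z n) \<in> C \<and> restrict (\<eta> \<omega>) S \<in> D}
             \<ge> exp (- c n) * measure M {\<omega>\<in>space M. restrict (\<eta> \<omega>) (lattice_box z n) \<in> C}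
                 * measure M {\<omega>\<in>space M. restrict (\<eta> \<omega>) S \<in> D})"
    using assms(4) unfolding cadi_def by blast
  obtain t \<alpha> where ta: "\<forall>V\<in>C0. 0 < t V \<and> 0 < \<alpha> V \<and> \<alpha> V \<le> 1"
    and loc: "\<forall>V\<in>C0. \<forall>z. \<forall>S. finite S \<and> z \<notin> S \<longrightarrow>
          (\<forall>D\<in>convex_open S.
             measure M {\<omega>\<in>space M. \<eta> \<omega> z \<in> (\<lambda>v. t V *\<^sub>R v) ` V \<and> restrict (\<eta> \<omega>) S \<in> D}
             \<ge> \<alpha> V * measure M {\<omega>\<in>space M. restrict (\<eta> \<omega>) S \<in> D})"
    using assms(5) unfolding cl_def by blast
  interpret prob_space M using assms(3) by (simp add: random_field_def)
  have "mixing_field M \<eta> C0 l g c t \<alpha>"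
  proof
    show "\<eta> \<in> M \<rightarrow>\<^sub>M (\<Pi>\<^sub>M z\<in>UNIV. borel)" using assms(3) by (simp add: random_field_def)
    show "(\<lambda>n. c n / real (n ^ CARD('d))) \<longlonglongrightarrow> 0" using gc(3) by (simp only: card_lattice_box)
    show "exp (- c n) * prob E * prob F \<le> prob (E \<inter> F)"
      if h: "1 \<le> n" "finite S" "convex_event M \<eta> (lattice_box z n) E" "convex_event M \<eta> S F"
        "ereal (g n) < lattice_dist S (lattice_box z n)" for z n S E F
    proof -
      obtain C where C: "C \<in> convex_open (lattice_box z n)" "E = {\<omega>\<in>space M. restrict (\<eta> \<omega>) (lattice_box z n) \<in> C}"
        using h(3) unfolding convex_event_def by blast
      obtain D where D: "D \<in> convex_open S" "F = {\<omega>\<in>space M. restrict (\<eta> \<omega>) S \<in> D}"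
        using h(4) unfolding convex_event_def by blast
      have "E \<inter> F = {\<omega>\<in>space M. restrict (\<eta> \<omega>) (lattice_box z n) \<in> C \<and> restrict (\<eta> \<omega>) S \<in> D}"
        unfolding C D by blast
      then show ?thesis using dec[rule_format, OF h(1,2) C(1) D(1) h(5)] C(2) D(2) by simp
    qed
    show "\<alpha> V * prob E \<le> prob ({\<omega>\<in>space M. \<eta> \<omega> z \<in> dilate (t V) V} \<inter> E)"
      if h: "V \<in> C0" "finite S" "z \<notin> S" "convex_event M \<eta> S E" for V z S E
    proof -
      obtain D where D: "D \<in> convex_open S" "E = {\<omega>\<in>space M. restrict (\<eta> \<omega>) S \<in> D}"
        using h(4) unfolding convex_event_def by blast
      have "{\<omega>\<in>space M. \<eta> \<omega> z \<in> dilate (t V) V} \<inter> E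
          = {\<omega>\<in>space M. \<eta> \<omega> z \<in> (\<lambda>v. t V *\<^sub>R v) ` V \<and> restrict (\<eta> \<omega>) S \<in> D}"
        unfolding D dilate_def by blast
      then show ?thesis using loc[rule_format, OF h(1) conjI[OF h(2,3)] D(1)] D(2) by simp
    qed
  qed (use assms gc ta in auto)
  then show ?thesis by (rule that)
qed

theorem mainTheorem2:
  fixes M :: "'w measure"
    and \<eta> :: "'w \<Rightarrow> int ^ 'd \<Rightarrow> 'y::separable_frechet_space"
    and C0 :: "'y set set"
    and l :: nat
    and y :: 'y
  assumes "convex_nhds_base C0"
    and "l \<ge> 1"
    and "random_field M \<eta>"
    and "cadi M \<eta>"
    and "cl M C0 \<eta>"
    and "R_invariant M l \<eta>"
  shows "field_entropy M C0 \<eta> y = - pressure_conjugate M \<eta> y"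
proof -
  obtain g c t \<alpha> where "mixing_field M \<eta> C0 l g c t \<alpha>" using mixing_fieldI[OF assms] by blast
  then interpret mixing_field M \<eta> C0 l g c t \<alpha> .
  show ?thesis by (intro antisym entropy_le_neg_conjugate neg_conjugate_le_entropy)
qed

end
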